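(* Let $N\ge2$, $T>0$ and $\delta\ge0$. Then $$\mathscr N_N\text{ has property }(\mathsf P_\delta)\quad\Longleftrightarrow\quad \delta=0 .$$ In particular, no original-state autonomous architecture whose admissible evolutions are continuous semiflows can satisfy simultaneous cell controllability (SCC); that is, no class $\mathscr S$ of continuous autonomous semiflows on $\mathbb R^N$ has SCC.
   Context: $\mathscr N_N$ is the class of shallow ReLU vector fields $x\mapsto\sum_{j=1}^p w_j(a_j^\top x+b_j)_+$ on $\mathbb R^N$, with $p\in\{0,1,2,\dots\}$, $w_j,a_j\in\mathbb R^N$, $b_j\in\mathbb R$, $(s)_+=\max\{s,0\}$; each generates a global flow $\Phi_V^t$. $\mathrm B_r(x)$, $\overline{\mathrm B}_r(x)$ are the open and closed Euclidean balls. Let $T>0$ be fixed and let $\mathscr F$ be a class of autonomous vector fields with global flows. Property $(\mathsf P_0)$: for every finite dataset $\{(x_i,y_i)\}_{i=1}^M\subset\mathbb R^N\times\mathbb R^N$ that is admissible (the $x_i$ are pairwise distinct and the $y_i$ are pairwise distinct) there is $V\in\mathscr F$ with $\Phi_V^T(x_i)=y_i$ for all $i$. Property $(\mathsf P_\delta)$ for $\delta>0$: for every finite family of centers $x_1,\dots,x_M$ for which the balls $\overline{\mathrm B}_\delta(x_i)$ are pairwise disjoint, every family of pairwise distinct target centers $y_1,\dots,y_M$, and every $0<\varepsilon<\delta$, there exists $V\in\mathscr F$ such that $\Phi_V^T(\overline{\mathrm B}_\delta(x_i))\subset\mathrm B_\varepsilon(y_i)$ for $i=1,\dots,M$. A continuous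 autonomous semiflow on $\mathbb R^N$ is a family $(\Psi^t)_{t\ge0}$ of self-maps of $\mathbb R^N$ with $(t,x)\mapsto\Psi^t(x)$ continuous on $[0,\infty)\times\mathbb R^N$, $\Psi^0=\mathrm{Id}$, $\Psi^{t+s}=\Psi^t\circ\Psi^s$. A class $\mathscr S$ of such semiflows has SCC if for every finite family of pairwise disjoint compact convex sets $C_1,\dots,C_M\subset\mathbb R^N$, all pairwise distinct targets $y_1,\dots,y_M\in\mathbb R^N$ and every $\varepsilon>0$ there are $(\Psi^t)\in\mathscr S$ and a terminal time $\tau>0$ with $\Psi^{\tau}(C_i)\subset\mathrm B_\varepsilon(y_i)$ for all $i$. *)

theory Defs
  imports "HOL-Analysis.Analysis"
begin

definition shallow_relu_fields :: "(real^'n \<Rightarrow> real^'n) set" where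
  "shallow_relu_fields =
     {V. \<exists>(p::nat) (w :: nat \<Rightarrow> real^'n) (a :: nat \<Rightarrow> real^'n) (b :: nat \<Rightarrow> real).
           V = (\<lambda>x. \<Sum>j=1..p. max (a j \<bullet> x + b j) 0 *\<^sub>R w j)}"

definition integral_curve :: "(real^'n \<Rightarrow> real^'n) \<Rightarrow> real^'n \<Rightarrow> (real \<Rightarrow> real^'n) \<Rightarrow> bool" where
  "integral_curve V x u \<longleftrightarrow>
     u 0 = x \<and> (\<forall>t. (u has_vector_derivative V (u t)) (at t))"

(* The description denotes whenever V generates a global flow, e.g. when V is globally
   Lipschitz, as every member of shallow_relu_fields is. *)
definition flow :: "(real^'n \<Rightarrow> real^'n) \<Rightarrow> real \<Rightarrow> real^'n \<Rightarrow> real^'n" where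
  "flow V t x = (THE u. integral_curve V x u) t"

definition property_P0 :: "(real^'n \<Rightarrow> real^'n) set \<Rightarrow> real \<Rightarrow> bool" where
  "property_P0 F T \<longleftrightarrow>
     (\<forall>(M::nat) (x :: nat \<Rightarrow> real^'n) (y :: nat \<Rightarrow> real^'n).
        inj_on x {1..M} \<and> inj_on y {1..M} \<longrightarrow>
        (\<exists>V\<in>F. \<forall>i\<in>{1..M}. flow V T (x i) = y i))"

definition property_Ppos :: "(real^'n \<Rightarrow> real^'n) set \<Rightarrow> real \<Rightarrow> real \<Rightarrow> bool" where
  "property_Ppos F T \<delta> \<longleftrightarrow>
     (\<forall>(M::nat) (x :: nat \<Rightarrow> real^'n) (y :: nat \<Rightarrow> real^'n) (\<epsilon>::real).
        disjoint_family_on (\<lambda>i. cball (x i) \<delta>) {1..M} \<and> inj_on y {1..M} \<and>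
        0 < \<epsilon> \<and> \<epsilon> < \<delta> \<longrightarrow>
        (\<exists>V\<in>F. \<forall>i\<in>{1..M}. flow V T ` cball (x i) \<delta> \<subseteq> ball (y i) \<epsilon>))"

definition property_P :: "(real^'n \<Rightarrow> real^'n) set \<Rightarrow> real \<Rightarrow> real \<Rightarrow> bool" where
  "property_P F T \<delta> \<longleftrightarrow> (if \<delta> = 0 then property_P0 F T else property_Ppos F T \<delta>)"

(* Semiflows are total in the time argument; values at negative times are unconstrained. *)
definition continuous_semiflow :: "(real \<Rightarrow> real^'n \<Rightarrow> real^'n) \<Rightarrow> bool" where
  "continuous_semiflow \<Psi> \<longleftrightarrow>
     continuous_on ({0..} \<times> UNIV) (\<lambda>(t, x). \<Psi> t x) \<and>
     \<Psi> 0 = id \<and>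
     (\<forall>t\<ge>0. \<forall>s\<ge>0. \<Psi> (t + s) = \<Psi> t \<circ> \<Psi> s)"

definition SCC :: "(real \<Rightarrow> real^'n \<Rightarrow> real^'n) set \<Rightarrow> bool" where
  "SCC S \<longleftrightarrow>
     (\<forall>(M::nat) (C :: nat \<Rightarrow> (real^'n) set) (y :: nat \<Rightarrow> real^'n) (\<epsilon>::real).
        (\<forall>i\<in>{1..M}. compact (C i) \<and> convex (C i)) \<and>
        disjoint_family_on C {1..M} \<and> inj_on y {1..M} \<and> \<epsilon> > 0 \<longrightarrow>
        (\<exists>\<Psi>\<in>S. \<exists>\<tau>>0. \<forall>i\<in>{1..M}. \<Psi> \<tau> ` C i \<subseteq> ball (y i) \<epsilon>))"

end

theory Submission
  imports Defs "HOL-Combinatorics.Orbits"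
begin

text \<open>Exact interpolation by a shallow ReLU field is obtained as follows.  A partial injection
  \<open>x i \<mapsto> y i\<close> extends to a permutation of a finite set of points, and by shears the points can
  be moved onto concentric circles on which the permutation is a rotation by one step on each circle.
  Bumps placed in the middle of the arcs perturb this rotation with one parameter for each coordinate of
  each endpoint, and the sign of the parameter is the sign of the displacement.  This sign
  pattern is stable when the fields are replaced by ReLU approximations, so the
  Poincare--Miranda theorem yields parameters for which all displacements vanish.

  Conversely, no continuous semiflow can swap two disjoint balls while contracting them: a fixed
  point of the square of the time-\<open>\<tau>\<close> map has an orbit consisting of such fixed points, which is
  therefore trapped in the small ball.\<close>

section \<open>Flows of Lipschitz fields\<close>

text \<open>Density alone only brings endpoints close to their targets; exactness needs a
  topological argument with one unknown for each scalar equation. The obstacle is autonomy: a target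
  may also be an input, so trajectories cannot be steered independently. Completing the data to a
  permutation makes this harmless: in the unperturbed rotation every point lies on a closed orbit
  and starts exactly one arc, and even a fixed point runs once around a circle of its own. Arcs of
  one circle overlap only near their ends, and different cycles get different integer radii, so up
  to time \<open>T\<close> a bump in the middle of an arc is felt only by the trajectory that starts
  there. Thus the parameters decouple from point to point. Both the circles and the shears require a
  second dimension. Polynomial shears destroy global Lipschitz continuity, though not Lipschitz
  continuity on balls; trajectories are therefore carried along explicitly, with a norm bound, until
  ReLU fields take over.\<close>

lemma has_vector_derivative_imp_continuous_on:
  assumes "\<And>t. (u has_vector_derivative u' t) (at t)"
  shows "continuous_on S u"
  by (rule continuous_at_imp_continuous_on) (auto intro: has_vector_derivative_continuous assms)

lemma antiderivative_exists:
  fixes g :: "real \<Rightarrow> 'a::banach"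
  assumes "continuous_on UNIV g"
  obtains G where "G 0 = 0" "\<And>t. (G has_vector_derivative g t) (at t)"
proof -
  have int: "g integrable_on {a..b}" for a b
    by (rule integrable_continuous_interval) (rule continuous_on_subset[OF assms], simp)
  \<comment> \<open>Signed integral: for each \<open>t\<close> one of the two terms vanishes. On a
    window \<open>{-m..m}\<close> it differs by a constant from the integral with fixed left end, to
    which the fundamental theorem applies.\<close>
  define G where "G t = integral {0..t} g - integral {t..0} g" for t
  have G_eq: "G t = integral {-m..t} g - integral {-m..0} g" if "t \<in> {-m..m}" for t m
  proof (cases "t \<ge> 0")
    case True
    with that int show ?thesis
      using Henstock_Kurzweil_Integration.integral_combine[of "-m" 0 t g]
      by (cases "t = 0") (auto simp: G_def algebra_simps)
  next
    case False
    with that int show ?thesis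
      using Henstock_Kurzweil_Integration.integral_combine[of "-m" t 0 g]
      by (auto simp: G_def algebra_simps)
  qed
  show thesis
  proof
    show "G 0 = 0" by (simp add: G_def)
    fix t :: real
    define m where "m = \<bar>t\<bar> + 1"
    have t: "t \<in> {-m<..<m}" by (auto simp: m_def)
    have "((\<lambda>u. integral {-m..u} g) has_vector_derivative g t) (at t within {-m..m})"
      by (rule integral_has_vector_derivative) (use t in \<open>auto intro: continuous_on_subset[OF assms]\<close>)
    then have "((\<lambda>u. integral {-m..u} g) has_vector_derivative g t) (at t)"
      using t at_within_Icc_at[of "-m" t m] by simp
    then have "((\<lambda>u. integral {-m..u} g - integral {-m..0} g) has_vector_derivative g t) (at t)"
      by (auto intro!: derivative_eq_intros)
    then show "(G has_vector_derivative g t) (at t)"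
      by (rule has_vector_derivative_transform_within_open[where S = "{-m<..<m}"])
         (use t in \<open>auto simp: G_eq[where m = m]\<close>)
  qed
qed

lemma has_vector_derivative_reflect:
  fixes u :: "real \<Rightarrow> 'a::real_normed_vector"
  assumes "(u has_vector_derivative D) (at (- t))"
  shows "((\<lambda>t. u (- t)) has_vector_derivative - D) (at t)"
proof -
  have "(uminus has_vector_derivative (- 1 :: real)) (at t)"
    by (auto intro!: derivative_eq_intros)
  then show ?thesis
    using vector_diff_chain_at[of uminus "-1" t u D] assms by (simp add: o_def)
qed

text \<open>Integration gains a factor \<open>1 / c\<close> in the exponentially weighted norm. With
  \<open>K\<close> equal to \<open>L\<close> times a distance this is the contraction constant
  \<open>L / c\<close> of Picard's operator. Negative times are reduced to positive ones by
  reflection.\<close>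

lemma antiderivative_exp_bound:
  fixes G :: "real \<Rightarrow> 'a::real_normed_vector"
  assumes "G 0 = 0" and G: "\<And>t. (G has_vector_derivative g t) (at t)"
    and g: "\<And>t. norm (g t) \<le> K * exp (c * \<bar>t\<bar>)" and "c > 0"
  shows "norm (G t) \<le> K / c * exp (c * \<bar>t\<bar>)"
proof -
  have *: "norm (H s) \<le> K / c * exp (c * s)"
    if "s \<ge> 0" "H 0 = 0" "\<And>t. (H has_vector_derivative h t) (at t)"
      "\<And>t. norm (h t) \<le> K * exp (c * \<bar>t\<bar>)" for s h and H :: "real \<Rightarrow> 'a"
  proof -
    have "0 \<le> K" using order_trans[OF norm_ge_zero that(4)[of 0]] by simp
    show ?thesis
    proof (cases "s = 0")
      case True
      then show ?thesis using that \<open>0 \<le> K\<close> \<open>c > 0\<close> by simp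
    next
      case False
      have "norm (H s - H 0) \<le> K / c * exp (c * s) - K / c * exp (c * 0)"
      proof (rule differentiable_bound_general)
        show "0 < s" using \<open>s \<ge> 0\<close> False by simp
        show "continuous_on {0..s} H"
          using that(3) by (rule has_vector_derivative_imp_continuous_on)
        show "((\<lambda>s. K / c * exp (c * s)) has_vector_derivative K * exp (c * x)) (at x)" for x
          unfolding has_real_derivative_iff_has_vector_derivative[symmetric]
          using \<open>c > 0\<close> by (auto intro!: derivative_eq_intros)
        show "norm (h x) \<le> K * exp (c * x)" if "0 < x" "x < s" for x
          using \<open>\<And>t. norm (h t) \<le> K * exp (c * \<bar>t\<bar>)\<close>[of x] that by simp
        show "continuous_on {0..s} (\<lambda>s. K / c * exp (c * s))"
          by (intro continuous_intros)
      qed (use that(3) in auto)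
      moreover have "0 \<le> K / c" using \<open>0 \<le> K\<close> \<open>c > 0\<close> by simp
      ultimately show ?thesis using \<open>H 0 = 0\<close> by simp
    qed
  qed
  show ?thesis
  proof (cases "t \<ge> 0")
    case True
    then show ?thesis using *[of t G g] assms by simp
  next
    case False
    have "norm (- g (- s)) \<le> K * exp (c * \<bar>s\<bar>)" for s
      using g[of "-s"] by simp
    then show ?thesis
      using *[of "-t" "\<lambda>t. G (- t)" "\<lambda>t. - g (- t)"] \<open>G 0 = 0\<close> False
        has_vector_derivative_reflect[OF G] by simp
  qed
qed

text \<open>Picard's operator is a contraction for the weighted norm \<open>sup exp (- c * \<bar>t\<bar>) * norm (u t - x)\<close>
  with \<open>c > L\<close>, so the solution is global at once.\<close>

lemma lipschitz_ode_solution: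
  fixes f :: "'a::banach \<Rightarrow> 'a"
  assumes lip: "L-lipschitz_on UNIV f"
  obtains u where "u 0 = x" "\<And>t. (u has_vector_derivative f (u t)) (at t)"
proof -
  have L: "0 \<le> L" and lipn: "norm (f x - f y) \<le> L * norm (x - y)" for x y
    using lipschitz_onD[OF lip] lipschitz_on_nonneg[OF lip] by (auto simp: dist_norm)
  have fc: "continuous_on S f" for S
    by (rule continuous_on_subset[OF lipschitz_on_continuous_on[OF lip]]) simp
  define c where "c = L + 1"
  have c: "c > 0" using L by (simp add: c_def)
  define e where "e t = exp (c * \<bar>t\<bar>)" for t
  have e: "e t > 0" "e t \<ge> 1" for t using c by (auto simp: e_def)
  have ec: "continuous_on UNIV e" by (auto simp: e_def intro!: continuous_intros)
  \<comment> \<open>The unknown is \<open>w t = (u t - x) / e t\<close>, which turns the weighted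
    norm into the sup norm on the complete space of bounded continuous functions.\<close>
  define g where "g w t = f (x + e t *\<^sub>R apply_bcontfun w t)" for w :: "real \<Rightarrow>\<^sub>C 'a" and t
  have gc: "continuous_on UNIV (g w)" for w
    unfolding g_def
    by (rule continuous_on_compose2[OF fc[of UNIV]]) (auto intro!: continuous_intros ec)
  have "\<exists>G. G 0 = 0 \<and> (\<forall>t. (G has_vector_derivative g w t) (at t))" for w
    using antiderivative_exists[OF gc[of w]] by metis
  then obtain G where G0: "\<And>w. G w 0 = 0"
    and G: "\<And>w t. (G w has_vector_derivative g w t) (at t)" by metis
  define h where "h w t = G w t /\<^sub>R e t" for w t
  have hb: "h w \<in> bcontfun" for w
  proof (rule bcontfun_normI)
    have "continuous_on UNIV (G w)"
      using G by (rule has_vector_derivative_imp_continuous_on)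
    then show "continuous_on UNIV (h w)"
      unfolding h_def using e by (intro continuous_intros ec) (auto simp: less_imp_neq[symmetric])
    have gb: "norm (g w t) \<le> (norm (f x) + L * norm w) * exp (c * \<bar>t\<bar>)" for t
    proof -
      have "norm (g w t) \<le> norm (f x) + norm (g w t - f x)"
        using norm_triangle_ineq[of "f x" "g w t - f x"] by simp
      also have "norm (g w t - f x) \<le> L * (e t * norm (apply_bcontfun w t))"
        using lipn[of "x + e t *\<^sub>R apply_bcontfun w t" x] e[of t] by (simp add: g_def)
      also have "\<dots> \<le> L * (e t * norm w)"
        using L e[of t] norm_bounded[of w t] by (intro mult_left_mono) auto
      also have "norm (f x) \<le> norm (f x) * e t"
        using e[of t] by (simp add: mult_le_cancel_left1)
      finally show ?thesis by (simp add: e_def algebra_simps)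
    qed
    show "norm (h w t) \<le> (norm (f x) + L * norm w) / c" for t
      using antiderivative_exp_bound[OF G0 G gb c, of t] e[of t]
      by (simp add: h_def e_def field_simps)
  qed
  define P where "P w = Bcontfun (h w)" for w
  have P: "apply_bcontfun (P w) = h w" for w
    by (simp add: P_def Bcontfun_inverse hb)
  have "\<exists>!w. P w = w"
  proof (rule banach_fix_type[where c = "L / c"])
    show "0 \<le> L / c" "L / c < 1" using L by (auto simp: c_def)
    show "\<forall>w v. dist (P w) (P v) \<le> L / c * dist w v"
    proof (intro allI dist_bound)
      fix w v :: "real \<Rightarrow>\<^sub>C 'a" and t :: real
      have gb: "norm (g w s - g v s) \<le> (L * dist w v) * exp (c * \<bar>s\<bar>)" for s
      proof -
        have "norm (g w s - g v s) \<le> L * norm (e s *\<^sub>R (apply_bcontfun w s - apply_bcontfun v s))"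
          using lipn[of "x + e s *\<^sub>R apply_bcontfun w s" "x + e s *\<^sub>R apply_bcontfun v s"]
          by (simp add: g_def algebra_simps)
        also have "\<dots> = L * (e s * dist (apply_bcontfun w s) (apply_bcontfun v s))"
          using e[of s] by (simp add: dist_norm)
        also have "\<dots> \<le> L * (e s * dist w v)"
          using L e[of s] dist_bounded[of w s v] by (intro mult_left_mono) auto
        finally show ?thesis by (simp add: e_def algebra_simps)
      qed
      have "norm (G w t - G v t) \<le> L * dist w v / c * exp (c * \<bar>t\<bar>)"
        by (rule antiderivative_exp_bound[OF _ _ gb c])
           (auto simp: G0 intro!: derivative_eq_intros G)
      then have "norm (G w t - G v t) / e t \<le> L * dist w v / c"
        using e[of t] by (simp add: e_def pos_divide_le_eq)
      moreover have "norm (h w t - h v t) = norm (G w t - G v t) / e t"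
        using e[of t] unfolding h_def real_vector.scale_right_diff_distrib[symmetric]
        by (simp add: divide_inverse mult.commute)
      ultimately show "dist (apply_bcontfun (P w) t) (apply_bcontfun (P v) t) \<le> L / c * dist w v"
        by (simp add: P dist_norm)
    qed
  qed
  then obtain w where w: "P w = w" by auto
  have weq: "G w t = e t *\<^sub>R apply_bcontfun w t" for t
  proof -
    have "apply_bcontfun w t = G w t /\<^sub>R e t"
      using P[of w] unfolding w by (simp add: h_def)
    then show ?thesis using e[of t] by simp
  qed
  show thesis
  proof (rule that[of "\<lambda>t. x + G w t"])
    show "((\<lambda>t. x + G w t) has_vector_derivative f (x + G w t)) (at t)" for t
    proof -
      have "g w t = f (x + G w t)" by (simp add: g_def weq)
      then show ?thesis using has_vector_derivative_add[OF has_vector_derivative_const G[of w t], of x]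
        by simp
    qed
  qed (simp add: G0)
qed

text \<open>The squared norm is used because it is differentiable even where the curves meet. Adding
  the constant \<open>\<epsilon>\<^sup>2\<close> to it absorbs the mixed term through \<open>2 *
  norm (d t) * \<epsilon> \<le> d t \<bullet> d t + \<epsilon>\<^sup>2\<close>, so that the weighted
  sum is nonincreasing. Only \<open>f\<close> has to be Lipschitz, and closeness is asked only along
  \<open>v\<close>.\<close>

lemma gronwall_difference:
  fixes u v :: "real \<Rightarrow> 'a::real_inner"
  assumes "0 \<le> T"
    and u: "\<And>t. t \<in> {0..T} \<Longrightarrow> (u has_vector_derivative f (u t)) (at t within {0..T})"
    and v: "\<And>t. t \<in> {0..T} \<Longrightarrow> (v has_vector_derivative g (v t)) (at t within {0..T})"
    and lip: "L-lipschitz_on UNIV f"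
    and close: "\<And>t. t \<in> {0..T} \<Longrightarrow> norm (f (v t) - g (v t)) \<le> \<epsilon>"
  shows "(norm (u T - v T))\<^sup>2 \<le> ((norm (u 0 - v 0))\<^sup>2 + \<epsilon>\<^sup>2) * exp ((2 * L + 1) * T)"
proof -
  define d where "d t = u t - v t" for t
  define \<phi> where "\<phi> t = (d t \<bullet> d t + \<epsilon>\<^sup>2) * exp (- ((2 * L + 1) * t))" for t
  have cont: "continuous_on {0..T} u" "continuous_on {0..T} v"
    using has_vector_derivative_continuous[OF u] has_vector_derivative_continuous[OF v]
    unfolding continuous_on_eq_continuous_within by blast+
  have "\<phi> T \<le> \<phi> 0"
  proof (rule DERIV_nonpos_imp_decreasing_open[OF \<open>0 \<le> T\<close>])
    show "continuous_on {0..T} \<phi>"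
      unfolding \<phi>_def d_def by (intro continuous_intros cont)
  next
    fix t assume t: "0 < t" "t < T"
    define w where "w = f (u t) - g (v t)"
    have "(d has_vector_derivative w) (at t within {0..T})"
      unfolding d_def w_def by (rule has_vector_derivative_diff) (use t in \<open>auto intro: u v\<close>)
    then have d': "(d has_vector_derivative w) (at t)"
      using at_within_Icc_at[of 0 t T] t by simp
    have "((\<lambda>t. d t \<bullet> d t) has_real_derivative 2 * (d t \<bullet> w)) (at t)"
      unfolding has_field_derivative_def
      by (rule has_derivative_eq_rhs[OF has_derivative_inner[OF
            d'[unfolded has_vector_derivative_def] d'[unfolded has_vector_derivative_def]]])
         (auto simp: inner_commute fun_eq_iff algebra_simps)
    then have D: "(\<phi> has_real_derivative
        exp (- ((2 * L + 1) * t)) * (2 * (d t \<bullet> w) - (2 * L + 1) * (d t \<bullet> d t + \<epsilon>\<^sup>2))) (at t)"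
      unfolding \<phi>_def by (auto intro!: derivative_eq_intros simp: algebra_simps)
    have L: "0 \<le> L" by (rule lipschitz_on_nonneg[OF lip])
    have "norm w \<le> norm (f (u t) - f (v t)) + norm (f (v t) - g (v t))"
      using norm_triangle_ineq[of "f (u t) - f (v t)" "f (v t) - g (v t)"] by (simp add: w_def)
    also have "\<dots> \<le> L * norm (d t) + \<epsilon>"
      using lipschitz_onD[OF lip, of "u t" "v t"] close[of t] t by (auto simp: d_def dist_norm)
    finally have "norm w \<le> L * norm (d t) + \<epsilon>" .
    then have "d t \<bullet> w \<le> norm (d t) * (L * norm (d t) + \<epsilon>)"
      by (intro order_trans[OF norm_cauchy_schwarz] mult_left_mono) auto
    then have "2 * (d t \<bullet> w) \<le> 2 * L * (d t \<bullet> d t) + 2 * norm (d t) * \<epsilon>"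
      by (simp add: power2_norm_eq_inner[symmetric] power2_eq_square algebra_simps)
    also have "2 * norm (d t) * \<epsilon> \<le> d t \<bullet> d t + \<epsilon>\<^sup>2"
      using sum_squares_bound[of "norm (d t)" \<epsilon>] by (simp add: power2_norm_eq_inner)
    finally have "2 * (d t \<bullet> w) - (2 * L + 1) * (d t \<bullet> d t + \<epsilon>\<^sup>2) \<le> - (2 * L) * \<epsilon>\<^sup>2"
      by (simp add: algebra_simps)
    also have "\<dots> \<le> 0" using L by simp
    finally show "\<exists>y. DERIV \<phi> t :> y \<and> y \<le> 0"
      using D by (intro exI conjI) (auto intro: mult_nonneg_nonpos)
  qed
  then have "d T \<bullet> d T + \<epsilon>\<^sup>2 \<le> (d 0 \<bullet> d 0 + \<epsilon>\<^sup>2) * exp ((2 * L + 1) * T)"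
    by (simp add: \<phi>_def exp_minus divide_simps)
  then show ?thesis
    unfolding d_def power2_norm_eq_inner using zero_le_power2[of \<epsilon>] by linarith
qed

corollary gronwall_norm_difference:
  fixes u v :: "real \<Rightarrow> 'a::real_inner"
  assumes "0 \<le> T" "0 \<le> \<epsilon>" "u 0 = v 0"
    and "\<And>t. t \<in> {0..T} \<Longrightarrow> (u has_vector_derivative f (u t)) (at t within {0..T})"
    and "\<And>t. t \<in> {0..T} \<Longrightarrow> (v has_vector_derivative g (v t)) (at t within {0..T})"
    and lip: "L-lipschitz_on UNIV f"
    and "\<And>t. t \<in> {0..T} \<Longrightarrow> norm (f (v t) - g (v t)) \<le> \<epsilon>"
  shows "norm (u T - v T) \<le> \<epsilon> * exp ((2 * L + 1) * T)"
proof (rule power2_le_imp_le)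
  have "(norm (u T - v T))\<^sup>2 \<le> ((norm (u 0 - v 0))\<^sup>2 + \<epsilon>\<^sup>2) * exp ((2 * L + 1) * T)"
    by (rule gronwall_difference[where f = f and g = g]) (use assms in auto)
  \<comment> \<open>The exponent is doubled, at a loss, to make the right-hand side a perfect
    square.\<close>
  also have "\<dots> \<le> \<epsilon>\<^sup>2 * exp (2 * ((2 * L + 1) * T))"
    using assms lipschitz_on_nonneg[OF lip] by (simp add: mult_left_mono)
  also have "\<dots> = (\<epsilon> * exp ((2 * L + 1) * T))\<^sup>2"
    by (simp only: power_mult_distrib exp_double)
  finally show "(norm (u T - v T))\<^sup>2 \<le> (\<epsilon> * exp ((2 * L + 1) * T))\<^sup>2" .
qed (use assms in simp)

lemma ode_unique_Icc:
  fixes u v :: "real \<Rightarrow> 'a::real_inner"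
  assumes "0 \<le> T"
    and "\<And>t. t \<in> {0..T} \<Longrightarrow> (u has_vector_derivative f (u t)) (at t within {0..T})"
    and "\<And>t. t \<in> {0..T} \<Longrightarrow> (v has_vector_derivative f (v t)) (at t within {0..T})"
    and "L-lipschitz_on UNIV f" and "u 0 = v 0"
  shows "u T = v T"
proof -
  have "(norm (u T - v T))\<^sup>2 \<le> ((norm (u 0 - v 0))\<^sup>2 + 0\<^sup>2) * exp ((2 * L + 1) * T)"
    by (rule gronwall_difference[where f = f and g = f]) (use assms in auto)
  then show ?thesis using \<open>u 0 = v 0\<close> by simp
qed

lemma ode_unique:
  fixes u v :: "real \<Rightarrow> 'a::real_inner"
  assumes u: "\<And>t. (u has_vector_derivative f (u t)) (at t)"
    and v: "\<And>t. (v has_vector_derivative f (v t)) (at t)"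
    and lip: "L-lipschitz_on UNIV f" and "u 0 = v 0"
  shows "u = v"
proof
  fix t
  show "u t = v t"
  proof (cases "t \<ge> 0")
    case True
    show ?thesis
      by (rule ode_unique_Icc[where f = f and u = u and v = v and L = L])
         (use True lip \<open>u 0 = v 0\<close> in \<open>auto intro: u v has_vector_derivative_at_within\<close>)
  next
    case False
    have "(\<lambda>t. u (- t)) (- t) = (\<lambda>t. v (- t)) (- t)"
      by (rule ode_unique_Icc[where f = "\<lambda>x. - f x" and L = L])
         (use False \<open>u 0 = v 0\<close> lip in
           \<open>auto intro!: has_vector_derivative_at_within has_vector_derivative_reflect u v\<close>)
    then show ?thesis by simp
  qed
qed

lemma has_vector_derivative_shift_arg:
  fixes u :: "real \<Rightarrow> 'a::real_normed_vector"
  assumes "(u has_vector_derivative D) (at (t + s))"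
  shows "((\<lambda>t. u (t + s)) has_vector_derivative D) (at t)"
proof -
  have "((\<lambda>t. t + s) has_vector_derivative 1) (at t)"
    by (auto intro!: derivative_eq_intros)
  then show ?thesis
    using vector_diff_chain_at[of "\<lambda>t. t + s" 1 t u D] assms by (simp add: o_def)
qed

text \<open>Global existence and uniqueness make the definite description in \<open>flow\<close>
  denote.\<close>

lemma integral_curve_flow:
  assumes "L-lipschitz_on UNIV V"
  shows "integral_curve V x (\<lambda>t. flow V t x)"
proof -
  obtain u where u: "integral_curve V x u"
    using lipschitz_ode_solution[OF assms, of x] unfolding integral_curve_def by metis
  have "(THE u. integral_curve V x u) = u"
    by (rule the_equality)
      (use u in \<open>auto simp: integral_curve_def intro!: ode_unique[OF _ _ assms]\<close>)
  then show ?thesis using u by (simp add: flow_def)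
qed

text \<open>A solution on \<open>{0..T}\<close> suffices. This is what allows a trajectory of a
  truncated field to be recognised as a trajectory of the original one while it stays in the ball of
  truncation.\<close>

lemma flow_eqI:
  assumes "L-lipschitz_on UNIV V" "0 \<le> T" "u 0 = x"
    and "\<And>t. t \<in> {0..T} \<Longrightarrow> (u has_vector_derivative V (u t)) (at t within {0..T})"
  shows "flow V T x = u T"
proof -
  have "integral_curve V x (\<lambda>t. flow V t x)" by (rule integral_curve_flow[OF assms(1)])
  then have "((\<lambda>t. flow V t x) has_vector_derivative V (flow V t x)) (at t within {0..T})"
    and "flow V 0 x = x" for t
    by (auto simp: integral_curve_def intro: has_vector_derivative_at_within)
  then show ?thesis
    using ode_unique_Icc[of T "\<lambda>t. flow V t x" V u L] assms by simp
qed

lemma flow_0: "L-lipschitz_on UNIV V \<Longrightarrow> flow V 0 x = x"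
  using integral_curve_flow[of L V x] by (simp add: integral_curve_def)

lemma flow_add:
  assumes "L-lipschitz_on UNIV V"
  shows "flow V (t + s) x = flow V t (flow V s x)"
proof -
  have "integral_curve V (flow V s x) (\<lambda>t. flow V (t + s) x)"
    unfolding integral_curve_def
  proof (intro conjI allI)
    fix t
    show "((\<lambda>t. flow V (t + s) x) has_vector_derivative V (flow V (t + s) x)) (at t)"
      using has_vector_derivative_shift_arg[of "\<lambda>t. flow V t x"]
        integral_curve_flow[OF assms, of x]
      by (auto simp: integral_curve_def)
  qed simp
  then have "(\<lambda>t. flow V (t + s) x) = (\<lambda>t. flow V t (flow V s x))"
    using integral_curve_flow[OF assms, of "flow V s x"] ode_unique[OF _ _ assms]
    unfolding integral_curve_def by metis
  then show ?thesis by metis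
qed

lemma flow_lipschitz:
  assumes "L-lipschitz_on UNIV V" "0 \<le> t"
  shows "(exp ((L + 1) * t))-lipschitz_on UNIV (flow V t)"
proof (rule lipschitz_onI)
  fix x y
  have "(norm (flow V t x - flow V t y))\<^sup>2
      \<le> ((norm (flow V 0 x - flow V 0 y))\<^sup>2 + 0\<^sup>2) * exp ((2 * L + 1) * t)"
    by (rule gronwall_difference[where f = V and g = V])
       (use assms integral_curve_flow[OF assms(1)] in
         \<open>auto simp: integral_curve_def intro: has_vector_derivative_at_within\<close>)
  also have "\<dots> \<le> (norm (x - y))\<^sup>2 * exp (2 * (L + 1) * t)"
    using assms by (auto simp: flow_0 intro!: mult_left_mono mult_right_mono)
  also have "\<dots> = (exp ((L + 1) * t) * norm (x - y))\<^sup>2"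
    using exp_double[of "(L + 1) * t"]
    by (simp only: power_mult_distrib mult.assoc mult.commute[of "(norm (x - y))\<^sup>2"])
  finally show "dist (flow V t x) (flow V t y) \<le> exp ((L + 1) * t) * dist x y"
    unfolding dist_norm by (rule power2_le_imp_le) simp
qed simp

lemma flow_continuous_time:
  assumes "L-lipschitz_on UNIV V"
  shows "continuous_on S (\<lambda>t. flow V t x)"
  by (rule has_vector_derivative_imp_continuous_on[where u' = "\<lambda>t. V (flow V t x)"])
     (use integral_curve_flow[OF assms, of x] in \<open>simp add: integral_curve_def\<close>)

section \<open>Obstruction to swapping two balls\<close>

lemma semiflow_no_swap:
  fixes \<Psi> :: "real \<Rightarrow> 'a::euclidean_space \<Rightarrow> 'a"
  assumes ct: "\<And>x. continuous_on {0..} (\<lambda>t. \<Psi> t x)"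
    and cx: "\<And>t. t \<ge> 0 \<Longrightarrow> continuous_on UNIV (\<Psi> t)"
    and zero: "\<And>x. \<Psi> 0 x = x"
    and add: "\<And>t s x. t \<ge> 0 \<Longrightarrow> s \<ge> 0 \<Longrightarrow> \<Psi> (t + s) x = \<Psi> t (\<Psi> s x)"
    and "\<tau> > 0" "0 < \<epsilon>" "\<epsilon> < \<delta>" and disj: "cball a \<delta> \<inter> cball b \<delta> = {}"
    and ab: "\<Psi> \<tau> ` cball a \<delta> \<subseteq> ball b \<epsilon>" and ba: "\<Psi> \<tau> ` cball b \<delta> \<subseteq> ball a \<epsilon>"
  shows False
proof -
  have into: "\<Psi> (2 * \<tau>) x \<in> ball a \<epsilon>" if "x \<in> cball a \<delta>" for x
  proof -
    have "\<Psi> (2 * \<tau>) x = \<Psi> \<tau> (\<Psi> \<tau> x)" using add[of \<tau> \<tau> x] \<open>\<tau> > 0\<close> by simp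
    moreover have "\<Psi> \<tau> x \<in> cball b \<delta>" using ab that \<open>\<epsilon> < \<delta>\<close> by (force simp: subset_iff)
    ultimately show ?thesis using ba by (metis image_subset_iff)
  qed
  obtain q where q: "q \<in> cball a \<delta>" "\<Psi> (2 * \<tau>) q = q"
  proof (rule brouwer_ball)
    show "\<Psi> (2 * \<tau>) \<in> cball a \<delta> \<rightarrow> cball a \<delta>" using into \<open>\<epsilon> < \<delta>\<close> by force
    show "continuous_on (cball a \<delta>) (\<Psi> (2 * \<tau>))"
      by (rule continuous_on_subset[OF cx]) (use \<open>\<tau> > 0\<close> in auto)
  qed (use assms in auto)
  have "\<Psi> \<tau> q \<in> cball b \<delta>" using ab q \<open>\<epsilon> < \<delta>\<close> by (force simp: subset_iff)
  then have far: "\<epsilon> \<le> dist a (\<Psi> \<tau> q)"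
    using disj \<open>\<epsilon> < \<delta>\<close> by (force simp: disjoint_iff)
  have near: "dist a (\<Psi> 0 q) \<le> \<epsilon>" using into[OF q(1)] q(2) zero by simp
  \<comment> \<open>The orbit of \<open>q\<close> starts at distance at most
    \<open>\<epsilon>\<close> from \<open>a\<close> and reaches distance at least
    \<open>\<epsilon>\<close>, so it meets the sphere of radius \<open>\<epsilon>\<close>. The point
    met there is again fixed by \<open>\<Psi> (2 * \<tau>)\<close>, because the maps of a semiflow
    commute, and so it would have to lie in the open ball.\<close>
  have "\<exists>s\<ge>0. s \<le> \<tau> \<and> dist a (\<Psi> s q) = \<epsilon>"
    by (rule IVT'[of "\<lambda>s. dist a (\<Psi> s q)", OF near far])
       (use \<open>\<tau> > 0\<close> in \<open>auto intro!: continuous_intros continuous_on_subset[OF ct[of q]]\<close>)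
  then obtain s where s: "0 \<le> s" "dist a (\<Psi> s q) = \<epsilon>" by auto
  have "\<Psi> (2 * \<tau>) (\<Psi> s q) = \<Psi> s q"
    using add[of "2 * \<tau>" s q] add[of s "2 * \<tau>" q] q s \<open>\<tau> > 0\<close> by (simp add: add.commute)
  then show False using into[of "\<Psi> s q"] s \<open>\<epsilon> < \<delta>\<close> by auto
qed

section \<open>The Poincare--Miranda theorem and density of shallow ReLU fields\<close>

lemma tendsto_fun_coordinatewise:
  fixes X :: "'a \<Rightarrow> 'b \<Rightarrow> 'c::topological_space"
  assumes "\<And>j. ((\<lambda>m. X m j) \<longlongrightarrow> x j) F"
  shows "(X \<longlongrightarrow> x) F"
proof -
  have "limitin (product_topology (\<lambda>_. euclidean) UNIV) X x F"
    by (simp add: limitin_componentwise assms)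
  then show ?thesis by (simp add: euclidean_product_topology)
qed

text \<open>Kuhn's labelling lemma is applied to the signs of \<open>F\<close> on grids of mesh
  \<open>2 / (m + 1)\<close>: some small cube carries both signs of every component, and a limit
  point of these cubes is a common zero. Parameters are functions and not vectors of a fixed type,
  because their number depends on the data.\<close>

lemma poincare_miranda_nat:
  fixes F :: "(nat \<Rightarrow> real) \<Rightarrow> nat \<Rightarrow> real"
  assumes cont: "\<And>i. i < n \<Longrightarrow> continuous_on {\<theta>. \<forall>j. \<theta> j \<in> {-1..1}} (\<lambda>\<theta>. F \<theta> i)"
    and pos: "\<And>\<theta> i. i < n \<Longrightarrow> \<forall>j. \<theta> j \<in> {-1..1} \<Longrightarrow> \<theta> i = 1 \<Longrightarrow> 0 < F \<theta> i"
    and neg: "\<And>\<theta> i. i < n \<Longrightarrow> \<forall>j. \<theta> j \<in> {-1..1} \<Longrightarrow> \<theta> i = -1 \<Longrightarrow> F \<theta> i < 0"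
  obtains \<theta> where "\<forall>j. \<theta> j \<in> {-1..1}" "\<And>i. i < n \<Longrightarrow> F \<theta> i = 0"
proof -
  define C :: "(nat \<Rightarrow> real) set" where "C = {\<theta>. \<forall>j. \<theta> j \<in> {-1..1}}"
  \<comment> \<open>Grid points of the cube; the guard on \<open>x j\<close> keeps them in the cube
    for every \<open>x\<close>, and coordinates from \<open>n\<close> on are frozen at 0.\<close>
  define pt where "pt p x j = (if j < n \<and> x j \<le> p then 2 * real (x j) / real p - 1 else 0)"
    for p :: nat and x :: "nat \<Rightarrow> nat" and j
  have pt_C: "pt p x \<in> C" if "p > 0" for p x
    using that by (auto simp: C_def pt_def divide_simps)
  have "\<exists>q. (\<forall>i<n. q i < Suc m) \<and> (\<forall>i<n. \<exists>r s.
      (\<forall>j<n. q j \<le> r j \<and> r j \<le> q j + 1) \<and> (\<forall>j<n. q j \<le> s j \<and> s j \<le> q j + 1) \<and>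
      F (pt (Suc m) r) i \<le> 0 \<and> 0 \<le> F (pt (Suc m) s) i)" for m
  proof -
    define lab where "lab x i = (if F (pt (Suc m) x) i > 0 then 1 else 0 :: nat)" for x i
    obtain q where q: "\<forall>i<n. q i < Suc m" "\<forall>i<n. \<exists>r s. (\<forall>j<n. q j \<le> r j \<and> r j \<le> q j + 1) \<and>
      (\<forall>j<n. q j \<le> s j \<and> s j \<le> q j + 1) \<and> lab r i \<noteq> lab s i"
    proof (rule kuhn_lemma[of "Suc m" n lab])
      have "F (pt (Suc m) x) i < 0" if "x i = 0" "i < n" for x i
        using neg[of i "pt (Suc m) x"] pt_C[of "Suc m" x] that by (simp add: pt_def C_def)
      then show "\<forall>x. (\<forall>i<n. x i \<le> Suc m) \<longrightarrow> (\<forall>i<n. x i = 0 \<longrightarrow> lab x i = 0)"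
        unfolding lab_def by (metis not_less_iff_gr_or_eq)
      have "F (pt (Suc m) x) i > 0" if "x i = Suc m" "i < n" for x i
        using pos[of i "pt (Suc m) x"] pt_C[of "Suc m" x] that
        by (simp add: pt_def C_def divide_simps)
      then show "\<forall>x. (\<forall>i<n. x i \<le> Suc m) \<longrightarrow> (\<forall>i<n. x i = Suc m \<longrightarrow> lab x i = 1)"
        unfolding lab_def by simp
    qed (auto simp: lab_def)
    have "\<exists>r s. (\<forall>j<n. q j \<le> r j \<and> r j \<le> q j + 1) \<and> (\<forall>j<n. q j \<le> s j \<and> s j \<le> q j + 1) \<and>
      F (pt (Suc m) r) i \<le> 0 \<and> 0 \<le> F (pt (Suc m) s) i" if "i < n" for i
    proof -
      obtain r s where rs: "\<forall>j<n. q j \<le> r j \<and> r j \<le> q j + 1"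
          "\<forall>j<n. q j \<le> s j \<and> s j \<le> q j + 1" "lab r i \<noteq> lab s i"
        using q(2) \<open>i < n\<close> by metis
      then consider "F (pt (Suc m) r) i \<le> 0" "0 \<le> F (pt (Suc m) s) i"
        | "F (pt (Suc m) s) i \<le> 0" "0 \<le> F (pt (Suc m) r) i"
        unfolding lab_def by (force split: if_splits)
      then show ?thesis
      proof cases
        case 1
        show ?thesis by (rule exI[of _ r], rule exI[of _ s]) (use rs 1 in simp)
      next
        case 2
        show ?thesis by (rule exI[of _ s], rule exI[of _ r]) (use rs 2 in simp)
      qed
    qed
    then show ?thesis using q(1) by (intro exI[of _ q]) simp
  qed
  then obtain q where q: "\<And>m i. i < n \<Longrightarrow> q m i < Suc m" and q': "\<And>m i. i < n \<Longrightarrow> \<exists>r s.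
      (\<forall>j<n. q m j \<le> r j \<and> r j \<le> q m j + 1) \<and> (\<forall>j<n. q m j \<le> s j \<and> s j \<le> q m j + 1) \<and>
      F (pt (Suc m) r) i \<le> 0 \<and> 0 \<le> F (pt (Suc m) s) i"
    by metis
  \<comment> \<open>Tychonoff's theorem, since the cube has infinitely many coordinates.\<close>
  have "compact C"
    using compactin_PiE[of "\<lambda>_::nat. euclidean :: real topology" UNIV "\<lambda>_. {-1..1}"]
    by (simp add: C_def euclidean_product_topology PiE_def Pi_def compactin_euclidean_iff)
  then have "seq_compact C" by (rule compact_imp_seq_compact)
  moreover have "\<forall>m. pt (Suc m) (q m) \<in> C" using pt_C by simp
  ultimately obtain \<theta> \<rho> where \<theta>: "\<theta> \<in> C" and \<rho>: "strict_mono \<rho>"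
    and lim: "((\<lambda>m. pt (Suc m) (q m)) \<circ> \<rho>) \<longlonglongrightarrow> \<theta>"
    unfolding seq_compact_def by (metis (no_types, lifting))
  have coord: "(\<lambda>m. pt (Suc (\<rho> m)) (q (\<rho> m)) j) \<longlonglongrightarrow> \<theta> j" for j
    using continuous_on_tendsto_compose[OF continuous_on_product_coordinates[of j] lim] by (simp add: o_def)
  \<comment> \<open>Vertices of the small cube at \<open>q m\<close> have the same limit as its
    corner. As \<open>q m j < Suc m\<close> is strict, \<open>q m j + 1\<close> is still a grid
    index and the guard in \<open>pt\<close> holds.\<close>
  have near: "(\<lambda>m. pt (Suc (\<rho> m)) (r m)) \<longlonglongrightarrow> \<theta>"
    if r: "\<And>m j. j < n \<Longrightarrow> q (\<rho> m) j \<le> r m j \<and> r m j \<le> q (\<rho> m) j + 1" for r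
  proof -
    have "(\<lambda>m. pt (Suc (\<rho> m)) (r m) j) \<longlonglongrightarrow> \<theta> j" for j
    proof (cases "j < n")
      case True
      have bd: "norm (pt (Suc (\<rho> m)) (r m) j - pt (Suc (\<rho> m)) (q (\<rho> m)) j) \<le> 2 * inverse (real (Suc (\<rho> m)))" for m
      proof -
        have "r m j \<le> Suc (\<rho> m)" "q (\<rho> m) j \<le> Suc (\<rho> m)"
          using r[OF True, of m] q[OF True, of "\<rho> m"] by auto
        then have "pt (Suc (\<rho> m)) (r m) j - pt (Suc (\<rho> m)) (q (\<rho> m)) j
            = 2 * (real (r m j) - real (q (\<rho> m) j)) / real (Suc (\<rho> m))"
          using True by (simp add: pt_def diff_divide_distrib)
        moreover have "\<bar>real (r m j) - real (q (\<rho> m) j)\<bar> \<le> 1" using r[OF True, of m] by linarith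
        ultimately show ?thesis by (simp add: abs_mult divide_simps)
      qed
      have "(\<lambda>m. 2 * inverse (real (Suc (\<rho> m)))) \<longlonglongrightarrow> 2 * 0"
        using LIMSEQ_subseq_LIMSEQ[OF LIMSEQ_inverse_real_of_nat \<rho>]
        by (intro tendsto_intros) (simp add: o_def)
      then have "(\<lambda>m. pt (Suc (\<rho> m)) (r m) j - pt (Suc (\<rho> m)) (q (\<rho> m)) j) \<longlonglongrightarrow> 0"
        by (intro Lim_null_comparison[OF always_eventually[OF allI[OF bd]]]) simp
      from tendsto_add[OF this coord[of j]] show ?thesis by simp
    next
      case False
      then show ?thesis using coord[of j] by (simp add: pt_def)
    qed
    then show ?thesis by (rule tendsto_fun_coordinatewise)
  qed
  have "F \<theta> i = 0" if i: "i < n" for i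
  proof -
    obtain r s where rs: "\<And>m j. j < n \<Longrightarrow> q m j \<le> r m j \<and> r m j \<le> q m j + 1"
        "\<And>m j. j < n \<Longrightarrow> q m j \<le> s m j \<and> s m j \<le> q m j + 1"
        "\<And>m. F (pt (Suc m) (r m)) i \<le> 0" "\<And>m. 0 \<le> F (pt (Suc m) (s m)) i"
      using q'[OF i] by metis
    have "(\<lambda>m. F (pt (Suc (\<rho> m)) (x (\<rho> m))) i) \<longlonglongrightarrow> F \<theta> i"
      if "(\<lambda>m. pt (Suc (\<rho> m)) (x (\<rho> m))) \<longlonglongrightarrow> \<theta>" for x
      using continuous_on_tendsto_compose[OF cont[OF i, folded C_def] that \<theta>] pt_C by simp
    note lim = this
    have "F \<theta> i \<le> 0"
      by (rule LIMSEQ_le_const2[OF lim[OF near[of "\<lambda>m. r (\<rho> m)"]]]) (use rs in auto)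
    moreover have "0 \<le> F \<theta> i"
      by (rule LIMSEQ_le_const[OF lim[OF near[of "\<lambda>m. s (\<rho> m)"]]]) (use rs in auto)
    ultimately show ?thesis by simp
  qed
  then show thesis using that \<theta> by (simp add: C_def)
qed

lemma poincare_miranda:
  fixes F :: "('j \<Rightarrow> real) \<Rightarrow> 'j \<Rightarrow> real"
  assumes "finite J"
    and cont: "\<And>i. i \<in> J \<Longrightarrow> continuous_on {\<theta>. \<forall>j. \<theta> j \<in> {-1..1}} (\<lambda>\<theta>. F \<theta> i)"
    and pos: "\<And>\<theta> i. i \<in> J \<Longrightarrow> \<forall>j. \<theta> j \<in> {-1..1} \<Longrightarrow> \<theta> i = 1 \<Longrightarrow> 0 < F \<theta> i"
    and neg: "\<And>\<theta> i. i \<in> J \<Longrightarrow> \<forall>j. \<theta> j \<in> {-1..1} \<Longrightarrow> \<theta> i = -1 \<Longrightarrow> F \<theta> i < 0"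
  obtains \<theta> where "\<forall>j. \<theta> j \<in> {-1..1}" "\<And>i. i \<in> J \<Longrightarrow> F \<theta> i = 0"
proof -
  obtain e where e: "bij_betw e J {0..<card J}" using ex_bij_betw_finite_nat[OF \<open>finite J\<close>] ..
  define d where "d = the_inv_into J e"
  have d: "d i \<in> J" "e (d i) = i" if "i < card J" for i
    using e that f_the_inv_into_f_bij_betw[OF e, of i] the_inv_into_into[of e J i J]
    by (auto simp: d_def bij_betw_def)
  have de: "d (e j) = j" "e j < card J" if "j \<in> J" for j
    using e that by (auto simp: d_def bij_betw_def the_inv_into_f_f)
  define X :: "(nat \<Rightarrow> real) \<Rightarrow> 'j \<Rightarrow> real" where "X \<phi> j = \<phi> (e j)" for \<phi> j
  have X: "\<forall>j. X \<phi> j \<in> {-1..1}" if "\<forall>i. \<phi> i \<in> {-1..1}" for \<phi> using that by (simp add: X_def)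
  have Xc: "continuous_on S X" for S
    unfolding X_def
    by (intro continuous_on_coordinatewise_then_product continuous_on_subset[OF continuous_on_product_coordinates]) simp
  obtain \<phi> where "\<forall>i. \<phi> i \<in> {-1..1}" "\<And>i. i < card J \<Longrightarrow> F (X \<phi>) (d i) = 0"
  proof (rule poincare_miranda_nat[of "card J" "\<lambda>\<phi> i. F (X \<phi>) (d i)"])
    show "continuous_on {\<theta>. \<forall>j. \<theta> j \<in> {-1..1}} (\<lambda>\<phi>. F (X \<phi>) (d i))" if "i < card J" for i
      by (rule continuous_on_compose2[OF cont[OF d(1)[OF that]] Xc]) (use X in auto)
    show "0 < F (X \<theta>) (d i)" if "i < card J" "\<forall>j. \<theta> j \<in> {-1..1}" "\<theta> i = 1" for \<theta> i
      using that d by (intro pos X) (auto simp: X_def)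
    show "F (X \<theta>) (d i) < 0" if "i < card J" "\<forall>j. \<theta> j \<in> {-1..1}" "\<theta> i = -1" for \<theta> i
      using that d by (intro neg X) (auto simp: X_def)
  qed blast
  then show thesis using that[of "X \<phi>"] X de by metis
qed

text \<open>Unlike global Lipschitz continuity, this is stable under products and composition and
  holds for polynomial maps, hence survives pulling back along polynomial shears.\<close>

definition lipschitz_on_balls :: "('a::real_normed_vector \<Rightarrow> 'b::real_normed_vector) \<Rightarrow> bool" where
  "lipschitz_on_balls f \<longleftrightarrow> (\<forall>R. \<exists>L. L-lipschitz_on (cball 0 R) f)"

named_theorems lob_intros

lemma lipschitz_on_balls_global: "L-lipschitz_on UNIV f \<Longrightarrow> lipschitz_on_balls f"
  unfolding lipschitz_on_balls_def using lipschitz_on_subset subset_UNIV by blast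

lemma lipschitz_on_balls_continuous:
  assumes "lipschitz_on_balls f"
  shows "continuous_on S f"
proof -
  have "continuous_on (ball 0 (norm x + 1)) f" for x
    using assms unfolding lipschitz_on_balls_def
    by (meson ball_subset_cball continuous_on_subset lipschitz_on_continuous_on)
  then have "isCont f x" for x
    by (rule continuous_on_interior[of "ball 0 (norm x + 1)"]) (simp add: interior_open)
  then show ?thesis by (simp add: continuous_at_imp_continuous_on)
qed

lemma lipschitz_on_balls_bounded:
  assumes "lipschitz_on_balls f"
  obtains K where "K \<ge> 0" "\<And>x. norm x \<le> R \<Longrightarrow> norm (f x) \<le> K"
proof -
  \<comment> \<open>The absolute value keeps the origin in the ball when \<open>R\<close> is
    negative.\<close>
  obtain L where L: "L-lipschitz_on (cball 0 \<bar>R\<bar>) f"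
    using assms unfolding lipschitz_on_balls_def by blast
  have "norm (f x) \<le> norm (f 0) + L * \<bar>R\<bar>" if "norm x \<le> R" for x
  proof -
    have "norm (f x - f 0) \<le> L * norm (x - 0)"
      by (rule lipschitz_on_normD[OF L]) (use that in auto)
    also have "\<dots> \<le> L * \<bar>R\<bar>"
      using lipschitz_on_nonneg[OF L] that by (intro mult_left_mono) auto
    finally show ?thesis using norm_triangle_sub[of "f x" "f 0"] by linarith
  qed
  then show thesis using that[of "norm (f 0) + L * \<bar>R\<bar>"] lipschitz_on_nonneg[OF L] by simp
qed

lemma lipschitz_on_balls_linear [lob_intros]:
  assumes "bounded_linear f"
  shows "lipschitz_on_balls f"
proof -
  obtain L where "L \<ge> 0" "\<And>x. norm (f x) \<le> norm x * L"
    using bounded_linear.nonneg_bounded[OF assms] by blast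
  then have "L-lipschitz_on UNIV f"
    using bounded_linear.linear[OF assms]
    by (auto intro!: lipschitz_onI simp: dist_norm mult.commute linear_diff[symmetric])
  then show ?thesis by (rule lipschitz_on_balls_global)
qed

lemma lipschitz_on_balls_const [lob_intros]: "lipschitz_on_balls (\<lambda>_. c)"
  by (rule lipschitz_on_balls_global[OF lipschitz_on_constant])

lemma lipschitz_on_balls_add [lob_intros]:
  "lipschitz_on_balls f \<Longrightarrow> lipschitz_on_balls g \<Longrightarrow> lipschitz_on_balls (\<lambda>x. f x + g x)"
  unfolding lipschitz_on_balls_def by (metis lipschitz_on_add)

lemma lipschitz_on_balls_compose:
  assumes f: "lipschitz_on_balls f" and g: "lipschitz_on_balls g"
  shows "lipschitz_on_balls (\<lambda>x. g (f x))"
  unfolding lipschitz_on_balls_def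
proof
  fix R
  obtain K where K: "\<And>x. norm x \<le> R \<Longrightarrow> norm (f x) \<le> K"
    using lipschitz_on_balls_bounded[OF f] by metis
  obtain L M where "L-lipschitz_on (cball 0 R) f" "M-lipschitz_on (cball 0 K) g"
    using f g unfolding lipschitz_on_balls_def by blast
  then have "(M * L)-lipschitz_on (cball 0 R) (\<lambda>x. g (f x))"
    using K by (intro lipschitz_on_compose2) (auto elim!: lipschitz_on_subset)
  then show "\<exists>L. L-lipschitz_on (cball 0 R) (\<lambda>x. g (f x))" ..
qed

lemma lipschitz_on_balls_scaleR [lob_intros]:
  fixes f :: "'a::real_normed_vector \<Rightarrow> real" and g :: "'a \<Rightarrow> 'b::real_normed_vector"
  assumes f: "lipschitz_on_balls f" and g: "lipschitz_on_balls g"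
  shows "lipschitz_on_balls (\<lambda>x. f x *\<^sub>R g x)"
  unfolding lipschitz_on_balls_def
proof
  fix R
  obtain K where K: "K \<ge> 0" "\<And>x. norm x \<le> R \<Longrightarrow> norm (f x) \<le> K"
    using lipschitz_on_balls_bounded[OF f, of R] by metis
  obtain K' where K': "K' \<ge> 0" "\<And>x. norm x \<le> R \<Longrightarrow> norm (g x) \<le> K'"
    using lipschitz_on_balls_bounded[OF g, of R] by metis
  obtain L M where L: "L-lipschitz_on (cball 0 R) f" and M: "M-lipschitz_on (cball 0 R) g"
    using f g unfolding lipschitz_on_balls_def by blast
  have "(K * M + L * K')-lipschitz_on (cball 0 R) (\<lambda>x. f x *\<^sub>R g x)"
  proof (rule lipschitz_onI)
    fix x y :: 'a assume xy: "x \<in> cball 0 R" "y \<in> cball 0 R"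
    have "f x *\<^sub>R g x - f y *\<^sub>R g y = f x *\<^sub>R (g x - g y) + (f x - f y) *\<^sub>R g y"
      by (simp add: algebra_simps)
    then have "norm (f x *\<^sub>R g x - f y *\<^sub>R g y) \<le> norm (f x) * norm (g x - g y) + norm (f x - f y) * norm (g y)"
      using norm_triangle_ineq[of "f x *\<^sub>R (g x - g y)" "(f x - f y) *\<^sub>R g y"] by simp
    also have "\<dots> \<le> K * (M * norm (x - y)) + (L * norm (x - y)) * K'"
      using K K' xy lipschitz_on_nonneg[OF L] lipschitz_on_normD[OF L xy] lipschitz_on_normD[OF M xy]
      by (intro add_mono mult_mono) auto
    finally show "dist (f x *\<^sub>R g x) (f y *\<^sub>R g y) \<le> (K * M + L * K') * dist x y"
      by (simp add: dist_norm algebra_simps)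
  qed (use K K' lipschitz_on_nonneg[OF L] lipschitz_on_nonneg[OF M] in auto)
  then show "\<exists>L. L-lipschitz_on (cball 0 R) (\<lambda>x. f x *\<^sub>R g x)" ..
qed

lemma lipschitz_on_balls_mult [lob_intros]:
  fixes f g :: "'a::real_normed_vector \<Rightarrow> real"
  shows "lipschitz_on_balls f \<Longrightarrow> lipschitz_on_balls g \<Longrightarrow> lipschitz_on_balls (\<lambda>x. f x * g x)"
  using lipschitz_on_balls_scaleR[of f g] by simp

lemma lipschitz_on_balls_diff [lob_intros]:
  assumes "lipschitz_on_balls f" "lipschitz_on_balls g"
  shows "lipschitz_on_balls (\<lambda>x. f x - g x)"
  using lipschitz_on_balls_add[OF assms(1) lipschitz_on_balls_scaleR[OF lipschitz_on_balls_const[of "-1"] assms(2)]]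
  by simp

lemma lipschitz_on_balls_sum [lob_intros]:
  "(\<And>i. i \<in> I \<Longrightarrow> lipschitz_on_balls (f i)) \<Longrightarrow> lipschitz_on_balls (\<lambda>x. \<Sum>i\<in>I. f i x)"
  by (induction I rule: infinite_finite_induct) (auto intro: lob_intros)

lemma lipschitz_on_balls_inner [lob_intros]:
  "lipschitz_on_balls f \<Longrightarrow> lipschitz_on_balls (\<lambda>x. a \<bullet> f x)"
  by (rule lipschitz_on_balls_compose[OF _ lipschitz_on_balls_linear[OF bounded_linear_inner_right]])

lemma lipschitz_on_balls_polynomial_function:
  fixes p :: "'a::real_normed_vector \<Rightarrow> 'b::euclidean_space"
  assumes "polynomial_function p"
  shows "lipschitz_on_balls p"
proof -
  have "lipschitz_on_balls q" if "real_polynomial_function q" for q :: "'a \<Rightarrow> real"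
    using that by induction (auto intro: lob_intros)
  then have "lipschitz_on_balls (\<lambda>x. \<Sum>b\<in>Basis. (p x \<bullet> b) *\<^sub>R b)"
    using assms unfolding polynomial_function_iff_Basis_inner
    by (intro lipschitz_on_balls_sum lipschitz_on_balls_scaleR lipschitz_on_balls_const) auto
  then show ?thesis by (simp add: euclidean_representation)
qed

section \<open>Linear structure of the shallow ReLU fields\<close>

lemma relu_lipschitz: "1-lipschitz_on UNIV (\<lambda>s::real. max s 0)"
  by (rule lipschitz_onI) (auto simp: dist_real_def)

lemma shallow_relu_lipschitz:
  assumes "V \<in> shallow_relu_fields"
  shows "\<exists>L. L-lipschitz_on UNIV V"
proof -
  obtain p w a b where V: "V = (\<lambda>x. \<Sum>j=1..(p::nat). max (a j \<bullet> x + b j) 0 *\<^sub>R w j)"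
    using assms unfolding shallow_relu_fields_def by blast
  have "(norm (a j) * norm (w j))-lipschitz_on UNIV (\<lambda>x. max (a j \<bullet> x + b j) 0 *\<^sub>R w j)" for j
  proof (rule lipschitz_onI)
    fix x y
    have "\<bar>max (a j \<bullet> x + b j) 0 - max (a j \<bullet> y + b j) 0\<bar> \<le> \<bar>a j \<bullet> (x - y)\<bar>"
      by (simp add: inner_diff_right)
    also have "\<dots> \<le> norm (a j) * norm (x - y)" by (rule Cauchy_Schwarz_ineq2)
    finally have "\<bar>max (a j \<bullet> x + b j) 0 - max (a j \<bullet> y + b j) 0\<bar> * norm (w j)
        \<le> norm (a j) * norm (x - y) * norm (w j)"
      by (rule mult_right_mono) simp
    then show "dist (max (a j \<bullet> x + b j) 0 *\<^sub>R w j) (max (a j \<bullet> y + b j) 0 *\<^sub>R w j)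
        \<le> norm (a j) * norm (w j) * dist x y"
      by (simp add: dist_norm scaleR_diff_left[symmetric] ac_simps)
  qed simp
  then have "(\<Sum>j=1..q. norm (a j) * norm (w j))-lipschitz_on UNIV
      (\<lambda>x. \<Sum>j=1..q. max (a j \<bullet> x + b j) 0 *\<^sub>R w j)" for q
    by (induction q) (auto intro: lipschitz_on_add lipschitz_on_constant)
  then show ?thesis unfolding V by blast
qed

lemma shallow_relu_zero: "(\<lambda>x. 0) \<in> shallow_relu_fields"
  unfolding shallow_relu_fields_def by (auto intro!: exI[of _ "0::nat"])

lemma shallow_relu_add_neuron:
  assumes "V \<in> shallow_relu_fields"
  shows "(\<lambda>x. V x + max (a \<bullet> x + b) 0 *\<^sub>R w) \<in> shallow_relu_fields"
proof -
  obtain p w' a' b' where V: "V = (\<lambda>x. \<Sum>j=1..(p::nat). max (a' j \<bullet> x + b' j) 0 *\<^sub>R w' j)"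
    using assms unfolding shallow_relu_fields_def by blast
  have "(\<lambda>x. V x + max (a \<bullet> x + b) 0 *\<^sub>R w) = (\<lambda>x. \<Sum>j=1..Suc p.
      max ((a'(Suc p := a)) j \<bullet> x + (b'(Suc p := b)) j) 0 *\<^sub>R (w'(Suc p := w)) j)"
    unfolding V by (auto intro!: sum.cong)
  then show ?thesis unfolding shallow_relu_fields_def by blast
qed

lemma shallow_relu_neuron: "(\<lambda>x. max (a \<bullet> x + b) 0 *\<^sub>R w) \<in> shallow_relu_fields"
  using shallow_relu_add_neuron[OF shallow_relu_zero, of a b w] by simp

lemma shallow_relu_add:
  assumes "V \<in> shallow_relu_fields" "W \<in> shallow_relu_fields"
  shows "(\<lambda>x. V x + W x) \<in> shallow_relu_fields"
proof -
  obtain p w a b where W: "W = (\<lambda>x. \<Sum>j=1..(p::nat). max (a j \<bullet> x + b j) 0 *\<^sub>R w j)"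
    using assms unfolding shallow_relu_fields_def by blast
  have "(\<lambda>x. V x + (\<Sum>j=1..q. max (a j \<bullet> x + b j) 0 *\<^sub>R w j)) \<in> shallow_relu_fields" for q
  proof (induction q)
    case (Suc q)
    then show ?case
      using shallow_relu_add_neuron[OF Suc, of "a (Suc q)" "b (Suc q)" "w (Suc q)"]
      by (simp add: add.assoc)
  qed (use assms in simp)
  then show ?thesis by (simp add: W)
qed

lemma shallow_relu_scaleR:
  assumes "V \<in> shallow_relu_fields"
  shows "(\<lambda>x. c *\<^sub>R V x) \<in> shallow_relu_fields"
proof -
  obtain p w a b where V: "V = (\<lambda>x. \<Sum>j=1..(p::nat). max (a j \<bullet> x + b j) 0 *\<^sub>R w j)"
    using assms unfolding shallow_relu_fields_def by blast
  have "(\<lambda>x. c *\<^sub>R V x) = (\<lambda>x. \<Sum>j=1..p. max (a j \<bullet> x + b j) 0 *\<^sub>R (c *\<^sub>R w j))"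
    unfolding V by (simp add: scaleR_right.sum mult.commute)
  then show ?thesis
    unfolding shallow_relu_fields_def mem_Collect_eq
    by (intro exI[of _ p] exI[of _ "\<lambda>j. c *\<^sub>R w j"] exI[of _ a] exI[of _ b])
qed

lemma shallow_relu_sum:
  "(\<And>i. i \<in> I \<Longrightarrow> V i \<in> shallow_relu_fields) \<Longrightarrow> (\<lambda>x. \<Sum>i\<in>I. V i x) \<in> shallow_relu_fields"
  by (induction I rule: infinite_finite_induct) (auto intro: shallow_relu_zero shallow_relu_add)

definition relu_approximable :: "(real^'n) set \<Rightarrow> (real^'n \<Rightarrow> real^'n) \<Rightarrow> bool" where
  "relu_approximable S f \<longleftrightarrow>
     (\<forall>\<epsilon>>0. \<exists>V\<in>shallow_relu_fields. \<forall>x\<in>S. norm (f x - V x) \<le> \<epsilon>)"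

lemma relu_approximable_add:
  assumes "relu_approximable S f" "relu_approximable S g"
  shows "relu_approximable S (\<lambda>x. f x + g x)"
  unfolding relu_approximable_def
proof (intro allI impI)
  fix \<epsilon> :: real assume "\<epsilon> > 0"
  then obtain V W where VW: "V \<in> shallow_relu_fields" "W \<in> shallow_relu_fields"
    and close: "\<And>x. x \<in> S \<Longrightarrow> norm (f x - V x) \<le> \<epsilon> / 2" "\<And>x. x \<in> S \<Longrightarrow> norm (g x - W x) \<le> \<epsilon> / 2"
    using assms unfolding relu_approximable_def by (meson half_gt_zero)
  have "norm (f x + g x - (V x + W x)) \<le> \<epsilon>" if "x \<in> S" for x
  proof -
    have "norm (f x - V x) + norm (g x - W x) \<le> \<epsilon> / 2 + \<epsilon> / 2"
      by (intro add_mono) (use that close in auto)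
    then show ?thesis
      using norm_diff_triangle_ineq[of "f x" "g x" "V x" "W x"] by simp
  qed
  then show "\<exists>V\<in>shallow_relu_fields. \<forall>x\<in>S. norm (f x + g x - V x) \<le> \<epsilon>"
    by (intro bexI[OF _ shallow_relu_add[OF VW]] ballI)
qed

lemma relu_approximable_sum:
  "(\<And>i. i \<in> I \<Longrightarrow> relu_approximable S (f i)) \<Longrightarrow> relu_approximable S (\<lambda>x. \<Sum>i\<in>I. f i x)"
proof (induction I rule: infinite_finite_induct)
  case (insert i I)
  then show ?case using relu_approximable_add by auto
qed (auto simp: relu_approximable_def intro!: bexI[OF _ shallow_relu_zero])

text \<open>The piecewise linear interpolant is written as a sum of ramps, each a difference of two
  ReLUs.\<close>

lemma relu_ridge:
  fixes a w :: "real^'n"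
  assumes "continuous_on UNIV g" "bounded S"
  shows "relu_approximable S (\<lambda>x. g (a \<bullet> x) *\<^sub>R w)"
  unfolding relu_approximable_def
proof (intro allI impI)
  fix \<epsilon> :: real assume \<epsilon>: "\<epsilon> > 0"
  obtain R where R: "R > 0" "\<And>x. x \<in> S \<Longrightarrow> norm x \<le> R"
    using \<open>bounded S\<close> bounded_pos by blast
  define A where "A = norm a * R + 1"
  have A: "A > 0" using R by (simp add: A_def add_nonneg_pos)
  have xA: "\<bar>a \<bullet> x\<bar> \<le> A" if "x \<in> S" for x
  proof -
    have "\<bar>a \<bullet> x\<bar> \<le> norm a * norm x" by (rule Cauchy_Schwarz_ineq2)
    also have "\<dots> \<le> norm a * R" using R that by (intro mult_left_mono) auto
    finally show ?thesis by (simp add: A_def)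
  qed
  \<comment> \<open>The factor 2 anticipates the interpolation error \<open>2 * \<eta>\<close>;
    adding 1 covers \<open>w = 0\<close>.\<close>
  define \<eta> where "\<eta> = \<epsilon> / (2 * (norm w + 1))"
  have \<eta>: "\<eta> > 0" using \<epsilon> by (simp add: \<eta>_def add_nonneg_pos)
  have "uniformly_continuous_on {-A..A} g"
    by (rule compact_uniformly_continuous) (auto intro: continuous_on_subset[OF assms(1)])
  then obtain d where d: "d > 0"
    and unif: "\<And>s t. s \<in> {-A..A} \<Longrightarrow> t \<in> {-A..A} \<Longrightarrow> \<bar>s - t\<bar> < d \<Longrightarrow> \<bar>g s - g t\<bar> < \<eta>"
    using \<eta> unfolding uniformly_continuous_on_def dist_real_def by (metis abs_minus_commute)
  obtain n :: nat where n: "real n > 2 * A / d" using reals_Archimedean2 by blast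
  have n0: "real n > 0" using n A d by (smt (verit) divide_pos_pos)
  define h where "h = 2 * A / real n"
  have h: "h > 0" "h < d" using n n0 A d by (auto simp: h_def field_simps)
  define s where "s m = -A + real m * h" for m :: nat
  have s: "s (Suc m) = s m + h" "s 0 = -A" "s n = A" for m
    using n0 by (auto simp: s_def h_def field_simps)
  have s_range: "s m \<in> {-A..A}" if "m \<le> n" for m
  proof -
    have "real m * h \<le> real n * h" using that h by (intro mult_right_mono) auto
    moreover have "0 \<le> real m * h" using h(1) by simp
    moreover have "real n * h = 2 * A" using n0 by (simp add: h_def)
    ultimately show ?thesis unfolding s_def atLeastAtMost_iff by linarith
  qed
  \<comment> \<open>\<open>ramp m\<close> rises from 0 to 1 between the knots \<open>s m\<close> and
    \<open>s (Suc m)\<close>. Hence \<open>l m\<close> is frozen at \<open>g (s m)\<close> to the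
    right of \<open>s m\<close>, and the next ramp does not disturb \<open>l m\<close> to the left
    of it.\<close>
  define ramp where "ramp m t = (max (t - s m) 0 - max (t - s (Suc m)) 0) / h" for m t
  define l where "l m t = g (s 0) + (\<Sum>k<m. (g (s (Suc k)) - g (s k)) * ramp k t)" for m t
  have l_far: "l m t = g (s m)" if "s m \<le> t" for m t
    using that
  proof (induction m)
    case (Suc m)
    moreover have "ramp m t = 1" using Suc.prems h s(1)[of m] by (simp add: ramp_def)
    ultimately show ?case using s(1)[of m] h by (simp add: l_def)
  qed (simp add: l_def)
  have l_near: "\<bar>g t - l m t\<bar> \<le> 2 * \<eta>" if "s 0 \<le> t" "t \<le> s m" "m \<le> n" for m t
    using that
  proof (induction m)
    case 0
    then show ?case using \<eta> by (simp add: l_def)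
  next
    case (Suc m)
    show ?case
    proof (cases "t \<le> s m")
      case True
      then have "l (Suc m) t = l m t" using s(1)[of m] h by (simp add: l_def ramp_def)
      then show ?thesis using Suc True by simp
    next
      case False
      have r: "0 \<le> ramp m t" "ramp m t \<le> 1" using False Suc.prems s(1)[of m] h by (auto simp: ramp_def)
      define \<Delta> where "\<Delta> = (g (s (Suc m)) - g (s m)) * ramp m t"
      have "\<bar>g t - g (s m)\<bar> < \<eta>" "\<bar>g (s (Suc m)) - g (s m)\<bar> < \<eta>"
        using Suc.prems False s(1)[of m] h s_range[of m] s_range[of "Suc m"] by (auto intro!: unif)
      moreover have "\<bar>\<Delta>\<bar> \<le> \<bar>g (s (Suc m)) - g (s m)\<bar> * 1"
        unfolding \<Delta>_def abs_mult using r by (intro mult_left_mono) auto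
      ultimately have "\<bar>g t - g (s m)\<bar> + \<bar>\<Delta>\<bar> \<le> 2 * \<eta>" by simp
      moreover have "l (Suc m) t = g (s m) + \<Delta>"
        using l_far[of m t] False by (simp add: l_def \<Delta>_def)
      ultimately show ?thesis using abs_triangle_ineq4[of "g t - g (s m)" \<Delta>] by simp
    qed
  qed
  define V where "V x = l n (a \<bullet> x) *\<^sub>R w" for x
  have neuron: "(\<lambda>x. (c * max (a \<bullet> x - b) 0) *\<^sub>R w) \<in> shallow_relu_fields" for b c
    using shallow_relu_neuron[of a "-b" "c *\<^sub>R w"] by (simp add: mult.commute)
  have ramp: "(\<lambda>x. (c * ramp m (a \<bullet> x)) *\<^sub>R w) \<in> shallow_relu_fields" for c m
    using shallow_relu_add[OF neuron[of "c / h" "s m"] neuron[of "- c / h" "s (Suc m)"]]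
    by (simp add: ramp_def algebra_simps add_divide_distrib diff_divide_distrib)
  \<comment> \<open>The constant term is a neuron with inner weight 0 and bias 1.\<close>
  have "(\<lambda>x. g (s 0) *\<^sub>R w + (\<Sum>k<n. ((g (s (Suc k)) - g (s k)) * ramp k (a \<bullet> x)) *\<^sub>R w)) \<in> shallow_relu_fields"
    using shallow_relu_neuron[of 0 1 "g (s 0) *\<^sub>R w"]
    by (intro shallow_relu_add shallow_relu_sum ramp) simp
  then have "V \<in> shallow_relu_fields"
    by (simp add: V_def[abs_def] l_def scaleR_add_left scaleR_left.sum)
  moreover have "norm (g (a \<bullet> x) *\<^sub>R w - V x) \<le> \<epsilon>" if "x \<in> S" for x
  proof -
    have "norm (g (a \<bullet> x) *\<^sub>R w - V x) = \<bar>g (a \<bullet> x) - l n (a \<bullet> x)\<bar> * norm w"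
      by (simp add: V_def scaleR_diff_left[symmetric])
    also have "\<dots> \<le> 2 * \<eta> * (norm w + 1)"
      using l_near[of "a \<bullet> x" n] xA[OF that] s \<eta> by (intro mult_mono) auto
    also have "\<dots> = \<epsilon>"
    proof -
      have "norm w + 1 > 0" by (simp add: add_nonneg_pos)
      then show ?thesis unfolding \<eta>_def by (simp add: divide_simps)
    qed
    finally show ?thesis .
  qed
  ultimately show "\<exists>V\<in>shallow_relu_fields. \<forall>x\<in>S. norm (g (a \<bullet> x) *\<^sub>R w - V x) \<le> \<epsilon>"
    by (intro bexI[of _ V] ballI)
qed

text \<open>Exponentials lead from ridge functions to functions of several variables: a product of
  two of them is a single one with the sum of the exponents. Their sums thus form an algebra, to
  which Stone-Weierstrass applies, while each summand remains a ridge function.\<close>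

inductive exp_sum :: "(real^'n \<Rightarrow> real) \<Rightarrow> bool" where
  exp_sum_base: "exp_sum (\<lambda>x. c * exp (a \<bullet> x))"
| exp_sum_add: "exp_sum f \<Longrightarrow> exp_sum g \<Longrightarrow> exp_sum (\<lambda>x. f x + g x)"

lemma exp_sum_mult:
  assumes "exp_sum f" "exp_sum g"
  shows "exp_sum (\<lambda>x. f x * g x)"
  using assms
proof (induction f arbitrary: g)
  case (exp_sum_base c a)
  from exp_sum_base show ?case
  proof (induction g)
    case (exp_sum_base d b)
    have "(\<lambda>x. c * exp (a \<bullet> x) * (d * exp (b \<bullet> x))) = (\<lambda>x. (c * d) * exp ((a + b) \<bullet> x))"
      by (simp add: inner_add_left exp_add ac_simps)
    then show ?case by (metis exp_sum.exp_sum_base)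
  qed (simp add: distrib_left exp_sum.exp_sum_add)
qed (simp add: distrib_right exp_sum.exp_sum_add)

lemma exp_sum_approximable:
  assumes "exp_sum f" "bounded S"
  shows "relu_approximable S (\<lambda>x. f x *\<^sub>R w)"
  using assms(1)
proof induction
  case (exp_sum_base c a)
  show ?case
    by (rule relu_ridge[where g = "\<lambda>s. c * exp s"]) (auto intro!: continuous_intros assms(2))
qed (simp add: scaleR_add_left relu_approximable_add)

lemma exp_sum_dense:
  assumes "compact S" "continuous_on S f" "\<epsilon> > 0"
  obtains g where "exp_sum g" "\<And>x. x \<in> S \<Longrightarrow> \<bar>f x - g x\<bar> < \<epsilon>"
proof -
  have "\<exists>g. exp_sum g \<and> (\<forall>x\<in>S. \<bar>f x - g x\<bar> < \<epsilon>)"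
  proof (rule Stone_Weierstrass_HOL[OF assms(1) _ _ _ _ _ assms(2,3)])
    show "exp_sum (\<lambda>x. c)" for c using exp_sum_base[of c 0] by simp
    show "continuous_on S g" if "exp_sum g" for g
      using that by induction (auto intro!: continuous_intros)
    show "\<exists>g. exp_sum g \<and> g x \<noteq> g y" if "x \<in> S \<and> y \<in> S \<and> x \<noteq> y" for x y
    proof (intro exI conjI)
      \<comment> \<open>The exponents at \<open>x\<close> and at \<open>y\<close> differ by the
        squared norm of \<open>x - y\<close>.\<close>
      show "exp_sum (\<lambda>z. 1 * exp ((x - y) \<bullet> z))" by (rule exp_sum_base)
      have "(x - y) \<bullet> (x - y) \<noteq> 0" using that by simp
      then show "1 * exp ((x - y) \<bullet> x) \<noteq> 1 * exp ((x - y) \<bullet> y)"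
        by (simp add: inner_diff_right)
    qed
  qed (simp_all add: exp_sum_add exp_sum_mult)
  then show thesis using that by blast
qed

proposition shallow_relu_dense:
  fixes f :: "real^'n \<Rightarrow> real^'n"
  assumes S: "compact S" and f: "continuous_on S f"
  shows "relu_approximable S f"
  unfolding relu_approximable_def
proof (intro allI impI)
  fix \<epsilon> :: real assume \<epsilon>: "\<epsilon> > 0"
  \<comment> \<open>The norm is bounded by the sum of the \<open>CARD('n)\<close> coordinate errors,
    which gives half of \<open>\<epsilon>\<close>; the other half is left for the ReLU
    approximation.\<close>
  define \<eta> where "\<eta> = \<epsilon> / (2 * real CARD('n))"
  have \<eta>: "\<eta> > 0" using \<epsilon> by (simp add: \<eta>_def)
  have "\<exists>g. exp_sum g \<and> (\<forall>x\<in>S. \<bar>f x $ k - g x\<bar> < \<eta>)" for k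
    using exp_sum_dense[OF S _ \<eta>, of "\<lambda>x. f x $ k"] continuous_on_component[OF f] by metis
  then obtain g where g: "\<And>k. exp_sum (g k)" "\<And>k x. x \<in> S \<Longrightarrow> \<bar>f x $ k - g k x\<bar> < \<eta>"
    by metis
  define G where "G x = (\<Sum>k\<in>UNIV. g k x *\<^sub>R axis k 1 :: real^'n)" for x
  have "relu_approximable S G"
    unfolding G_def
    by (intro relu_approximable_sum exp_sum_approximable g compact_imp_bounded S)
  then obtain V where V: "V \<in> shallow_relu_fields" "\<And>x. x \<in> S \<Longrightarrow> norm (G x - V x) \<le> \<epsilon> / 2"
    unfolding relu_approximable_def using half_gt_zero[OF \<epsilon>] by blast
  have Gk: "G x $ k = g k x" for x k
    by (simp add: G_def axis_def if_distrib sum.delta cong: if_cong)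
  have "norm (f x - V x) \<le> \<epsilon>" if "x \<in> S" for x
  proof -
    have "norm (f x - G x) \<le> (\<Sum>k\<in>UNIV. \<bar>(f x - G x) $ k\<bar>)" by (rule norm_le_l1_cart)
    also have "\<dots> \<le> (\<Sum>k\<in>(UNIV::'n set). \<eta>)"
      using g(2)[OF that] by (intro sum_mono) (simp add: Gk less_imp_le)
    also have "\<dots> = \<epsilon> / 2" by (simp add: \<eta>_def)
    finally show ?thesis using V(2)[OF that] norm_triangle_ineq[of "f x - G x" "G x - V x"] by simp
  qed
  then show "\<exists>V\<in>shallow_relu_fields. \<forall>x\<in>S. norm (f x - V x) \<le> \<epsilon>"
    using V(1) by (intro bexI[of _ V] ballI)
qed

section \<open>Robust families of fields\<close>

text \<open>\<open>robust_family\<close> is the input of the Poincare--Miranda theorem: an affine family of fields with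
  one parameter for each point and each coordinate, such that the coordinate \<open>h p k\<close> of the endpoint
  has the sign of the parameter \<open>(p, k)\<close> on the corresponding faces of the parameter cube, with
  a margin \<open>\<eta>\<close> that survives approximation of the fields.\<close>

definition robust_family ::
  "real \<Rightarrow> 'p set \<Rightarrow> ('p \<Rightarrow> 'p) \<Rightarrow> ('p \<Rightarrow> real^'n) \<Rightarrow> (real^'n \<Rightarrow> real^'n) \<Rightarrow>
   ('p \<times> 'n \<Rightarrow> real^'n \<Rightarrow> real^'n) \<Rightarrow> ('p \<Rightarrow> 'n \<Rightarrow> real^'n \<Rightarrow> real) \<Rightarrow> real \<Rightarrow> real \<Rightarrow> bool" where
  "robust_family T P \<sigma> x W E h R \<eta> \<longleftrightarrow>
     lipschitz_on_balls W \<and> (\<forall>j. lipschitz_on_balls (E j)) \<and>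
     (\<forall>p k. continuous_on UNIV (h p k)) \<and> \<eta> > 0 \<and>
     (\<forall>p\<in>P. \<forall>y. (\<forall>k. h p k y = 0) \<longrightarrow> y = x (\<sigma> p)) \<and>
     (\<forall>\<theta>. (\<forall>j. \<theta> j \<in> {-1..1}) \<longrightarrow>
       (\<forall>p\<in>P. \<exists>u. u 0 = x p \<and>
         (\<forall>t\<in>{0..T}. norm (u t) \<le> R \<and>
           (u has_vector_derivative (W (u t) + (\<Sum>j\<in>P \<times> UNIV. \<theta> j *\<^sub>R E j (u t))))
             (at t within {0..T})) \<and>
         (\<forall>k. (\<theta> (p, k) = 1 \<longrightarrow> \<eta> \<le> h p k (u T)) \<and> (\<theta> (p, k) = -1 \<longrightarrow> h p k (u T) \<le> - \<eta>))))"

definition robust :: "real \<Rightarrow> 'p set \<Rightarrow> ('p \<Rightarrow> 'p) \<Rightarrow> ('p \<Rightarrow> real^'n) \<Rightarrow> bool" where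
  "robust T P \<sigma> x \<longleftrightarrow> (\<exists>W E h R \<eta>. robust_family T P \<sigma> x W E h R \<eta>)"

text \<open>One constant serves the whole parameter cube, so that Gronwall estimates are uniform in
  the parameters.\<close>

lemma lipschitz_on_affine_combination:
  fixes W :: "'a::metric_space \<Rightarrow> 'b::real_normed_vector"
  assumes "L-lipschitz_on S W" "\<And>j. j \<in> J \<Longrightarrow> (M j)-lipschitz_on S (E j)"
    and \<theta>: "\<And>j. \<bar>\<theta> j\<bar> \<le> 1"
  shows "(L + (\<Sum>j\<in>J. M j))-lipschitz_on S (\<lambda>y. W y + (\<Sum>j\<in>J. \<theta> j *\<^sub>R E j y))"
proof -
  have "(\<Sum>j\<in>J. M j)-lipschitz_on S (\<lambda>y. \<Sum>j\<in>J. \<theta> j *\<^sub>R E j y)"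
    using assms(2)
  proof (induction J rule: infinite_finite_induct)
    case (insert j J)
    have "(1 * M j)-lipschitz_on S (\<lambda>y. \<theta> j *\<^sub>R E j y)"
      by (rule lipschitz_on_cmult_upper) (use insert \<theta> in auto)
    with insert show ?case by (auto intro!: lipschitz_on_add)
  qed (auto intro: lipschitz_on_constant)
  then show ?thesis using assms(1) by (intro lipschitz_on_add)
qed

lemma uniform_modulus:
  fixes h :: "'i \<Rightarrow> 'a::metric_space \<Rightarrow> real"
  assumes "finite I" "compact S" "\<And>i. i \<in> I \<Longrightarrow> continuous_on S (h i)" "\<eta> > 0"
  obtains \<gamma> where "\<gamma> > 0"
    "\<And>i y z. i \<in> I \<Longrightarrow> y \<in> S \<Longrightarrow> z \<in> S \<Longrightarrow> dist y z \<le> \<gamma> \<Longrightarrow> \<bar>h i y - h i z\<bar> < \<eta>"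
proof -
  have "\<exists>\<gamma>>0. \<forall>i\<in>I. \<forall>y\<in>S. \<forall>z\<in>S. dist y z \<le> \<gamma> \<longrightarrow> \<bar>h i y - h i z\<bar> < \<eta>"
    using assms(1,3)
  proof (induction I)
    case empty
    then show ?case by (auto intro: exI[of _ 1])
  next
    case (insert i I)
    then obtain \<gamma> where \<gamma>: "\<gamma> > 0" "\<forall>i\<in>I. \<forall>y\<in>S. \<forall>z\<in>S. dist y z \<le> \<gamma> \<longrightarrow> \<bar>h i y - h i z\<bar> < \<eta>"
      by auto
    have "uniformly_continuous_on S (h i)"
      using insert.prems by (intro compact_uniformly_continuous assms(2)) auto
    then obtain d where d: "d > 0" "\<And>y z. y \<in> S \<Longrightarrow> z \<in> S \<Longrightarrow> dist y z < d \<Longrightarrow> dist (h i y) (h i z) < \<eta>"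
      unfolding uniformly_continuous_on_def using assms(4) by (metis dist_commute)
    have "\<bar>h k y - h k z\<bar> < \<eta>"
      if "k \<in> insert i I" "y \<in> S" "z \<in> S" "dist y z \<le> min \<gamma> (d / 2)" for k y z
    proof (cases "k = i")
      case True
      have "dist y z < d" using that(4) d(1) by simp
      then show ?thesis using d(2)[of y z] that True by (simp add: dist_real_def)
    qed (use \<gamma> that in auto)
    then show ?case using \<gamma>(1) d(1) by (intro exI[of _ "min \<gamma> (d / 2)"]) auto
  qed
  then show thesis using that by blast
qed

text \<open>All fields are composed with the nearest-point projection onto a ball: the given ones
  become globally Lipschitz, and closeness on the ball becomes closeness everywhere. Gronwall then
  keeps the approximate trajectories in the ball, where the projection is the identity, and
  preserves the signs of the \<open>h p k\<close> on the faces of the cube. A common zero is a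
  parameter for which all endpoints are exact.\<close>

theorem robust_imp_shallow_relu:
  fixes x :: "'p \<Rightarrow> real^'n"
  assumes "finite P" "T > 0" "robust T P \<sigma> x"
  obtains V where "V \<in> shallow_relu_fields" "\<And>p. p \<in> P \<Longrightarrow> flow V T (x p) = x (\<sigma> p)"
proof -
  define J where "J = P \<times> (UNIV :: 'n set)"
  have finJ: "finite J" using \<open>finite P\<close> by (simp add: J_def)
  define cube where "cube = {\<theta> :: 'p \<times> 'n \<Rightarrow> real. \<forall>j. \<theta> j \<in> {-1..1}}"
  obtain W E h R \<eta> where *: "robust_family T P \<sigma> x W E h R \<eta>"
    using assms(3) unfolding robust_def by blast
  have W: "lipschitz_on_balls W" and E: "\<And>j. lipschitz_on_balls (E j)"
    and h: "\<And>p k. continuous_on UNIV (h p k)" and \<eta>: "\<eta> > 0"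
    and h0: "\<And>p y. p \<in> P \<Longrightarrow> (\<And>k. h p k y = 0) \<Longrightarrow> y = x (\<sigma> p)"
    using * unfolding robust_family_def by blast+
  have traj: "\<exists>u. u 0 = x p \<and>
            (\<forall>t\<in>{0..T}. norm (u t) \<le> R \<and>
              (u has_vector_derivative (W (u t) + (\<Sum>j\<in>J. \<theta> j *\<^sub>R E j (u t))))
                (at t within {0..T})) \<and>
            (\<forall>k. (\<theta> (p, k) = 1 \<longrightarrow> \<eta> \<le> h p k (u T)) \<and> (\<theta> (p, k) = -1 \<longrightarrow> h p k (u T) \<le> - \<eta>))"
    if "\<theta> \<in> cube" "p \<in> P" for \<theta> p
  proof -
    have "\<forall>j. \<theta> j \<in> {-1..1}" using that by (simp add: cube_def)
    with conjunct2[OF conjunct2[OF conjunct2[OF conjunct2[OF conjunct2[OF *[unfolded robust_family_def]]]]]]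
      that(2)
    show ?thesis unfolding J_def by blast
  qed
  \<comment> \<open>\<open>u\<close> is chosen separately for each parameter, with no claim of
    continuity; continuity in \<open>\<theta>\<close> is proved only for the ReLU trajectories
    \<open>v\<close> below.\<close>
  obtain u where u0: "\<And>\<theta> p. \<theta> \<in> cube \<Longrightarrow> p \<in> P \<Longrightarrow> u \<theta> p 0 = x p"
    and uR: "\<And>\<theta> p t. \<theta> \<in> cube \<Longrightarrow> p \<in> P \<Longrightarrow> t \<in> {0..T} \<Longrightarrow> norm (u \<theta> p t) \<le> R"
    and u': "\<And>\<theta> p t. \<theta> \<in> cube \<Longrightarrow> p \<in> P \<Longrightarrow> t \<in> {0..T} \<Longrightarrow>
       (u \<theta> p has_vector_derivative (W (u \<theta> p t) + (\<Sum>j\<in>J. \<theta> j *\<^sub>R E j (u \<theta> p t)))) (at t within {0..T})"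
    and upos: "\<And>\<theta> p k. \<theta> \<in> cube \<Longrightarrow> p \<in> P \<Longrightarrow> \<theta> (p, k) = 1 \<Longrightarrow> \<eta> \<le> h p k (u \<theta> p T)"
    and uneg: "\<And>\<theta> p k. \<theta> \<in> cube \<Longrightarrow> p \<in> P \<Longrightarrow> \<theta> (p, k) = -1 \<Longrightarrow> h p k (u \<theta> p T) \<le> - \<eta>"
    using that[of "\<lambda>\<theta> p. SOME u. u 0 = x p \<and>
            (\<forall>t\<in>{0..T}. norm (u t) \<le> R \<and>
              (u has_vector_derivative (W (u t) + (\<Sum>j\<in>J. \<theta> j *\<^sub>R E j (u t))))
                (at t within {0..T})) \<and>
            (\<forall>k. (\<theta> (p, k) = 1 \<longrightarrow> \<eta> \<le> h p k (u T)) \<and> (\<theta> (p, k) = -1 \<longrightarrow> h p k (u T) \<le> - \<eta>))"]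
      someI_ex[OF traj] by simp
  \<comment> \<open>The extra 1 is the room for \<open>v\<close> to deviate from \<open>u\<close>,
    which is why \<open>\<gamma>'\<close> is capped at 1.\<close>
  define R' where "R' = \<bar>R\<bar> + 1"
  define B where "B = cball (0 :: real^'n) R'"
  have B: "compact B" "convex B" "closed B" "B \<noteq> {}" by (auto simp: B_def R'_def)
  define \<pi> where "\<pi> = closest_point B"
  have \<pi>B: "\<pi> y \<in> B" for y unfolding \<pi>_def by (rule closest_point_in_set) (use B in auto)
  have \<pi>_id: "\<pi> y = y" if "y \<in> B" for y unfolding \<pi>_def by (rule closest_point_self[OF that])
  have \<pi>_lip: "1-lipschitz_on UNIV \<pi>"
    by (rule lipschitz_onI) (use B in \<open>auto simp: \<pi>_def intro: closest_point_lipschitz\<close>)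
  have lip\<pi>: "L-lipschitz_on UNIV (\<lambda>y. f (\<pi> y))" if "L-lipschitz_on B f" for L and f :: "real^'n \<Rightarrow> real^'n"
  proof -
    have "L-lipschitz_on (range \<pi>) f" by (rule lipschitz_on_subset[OF that]) (use \<pi>B in auto)
    then show ?thesis using lipschitz_on_compose2[OF \<pi>_lip, of L f] by simp
  qed
  obtain LW where LW: "LW-lipschitz_on B W" using W unfolding lipschitz_on_balls_def B_def by blast
  have "\<forall>j. \<exists>l. l-lipschitz_on B (E j)" using E unfolding lipschitz_on_balls_def B_def by simp
  from choice[OF this] obtain LE where LE: "\<And>j. (LE j)-lipschitz_on B (E j)" by blast
  define L where "L = LW + (\<Sum>j\<in>J. LE j)"
  define W\<theta> where "W\<theta> \<theta> y = W y + (\<Sum>j\<in>J. \<theta> j *\<^sub>R E j y)" for \<theta> y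
  have abs_cube: "\<bar>\<theta> j\<bar> \<le> 1" if "\<theta> \<in> cube" for \<theta> j
  proof -
    have "\<theta> j \<in> {-1..1}" using that unfolding cube_def by blast
    then show ?thesis by (simp add: abs_le_iff)
  qed
  have W\<theta>_lip: "L-lipschitz_on UNIV (\<lambda>y. W\<theta> \<theta> (\<pi> y))" if "\<theta> \<in> cube" for \<theta>
    unfolding W\<theta>_def L_def
    by (rule lip\<pi>, rule lipschitz_on_affine_combination) (use LW LE abs_cube[OF that] in auto)
  obtain \<gamma> where \<gamma>: "\<gamma> > 0"
    "\<And>p k y z. (p, k) \<in> J \<Longrightarrow> y \<in> B \<Longrightarrow> z \<in> B \<Longrightarrow> dist y z \<le> \<gamma> \<Longrightarrow> \<bar>h p k y - h p k z\<bar> < \<eta>"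
  proof (rule uniform_modulus[OF finJ B(1) _ \<eta>, of "\<lambda>j. h (fst j) (snd j)"])
    show "continuous_on B (h (fst j) (snd j))" for j
      by (rule continuous_on_subset[OF h]) simp
  qed force
  define \<gamma>' where "\<gamma>' = min \<gamma> 1"
  \<comment> \<open>Number of approximated fields times the Gronwall factor. \<open>L\<close>
    belongs to the given family, not to the approximations, which are chosen only after
    \<open>\<epsilon>\<close>; this avoids a circular choice.\<close>
  define c where "c = (1 + real (card J)) * exp ((2 * L + 1) * T)"
  have c: "c > 0" by (simp add: c_def add_pos_nonneg)
  define \<epsilon> where "\<epsilon> = \<gamma>' / c"
  have \<epsilon>: "\<epsilon> > 0" using \<gamma> c by (simp add: \<epsilon>_def \<gamma>'_def)
  have dense: "\<exists>V\<in>shallow_relu_fields. \<forall>y\<in>B. norm (f y - V y) \<le> \<epsilon>" if "lipschitz_on_balls f" for f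
    using shallow_relu_dense[OF B(1) lipschitz_on_balls_continuous[OF that]] \<epsilon>
    unfolding relu_approximable_def by blast
  obtain V0 where V0: "V0 \<in> shallow_relu_fields" "\<And>y. y \<in> B \<Longrightarrow> norm (W y - V0 y) \<le> \<epsilon>"
    using dense[OF W] by blast
  have "\<forall>j. \<exists>V. V \<in> shallow_relu_fields \<and> (\<forall>y\<in>B. norm (E j y - V y) \<le> \<epsilon>)"
    using dense[OF E] by blast
  from choice[OF this] obtain D where D: "\<And>j. D j \<in> shallow_relu_fields"
    "\<And>j y. y \<in> B \<Longrightarrow> norm (E j y - D j y) \<le> \<epsilon>" by blast
  define V\<theta> where "V\<theta> \<theta> y = V0 y + (\<Sum>j\<in>J. \<theta> j *\<^sub>R D j y)" for \<theta> y
  have V\<theta>_relu: "V\<theta> \<theta> \<in> shallow_relu_fields" for \<theta>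
    unfolding V\<theta>_def[abs_def] by (intro shallow_relu_add shallow_relu_sum shallow_relu_scaleR V0 D)
  obtain M0 where M0: "M0-lipschitz_on UNIV V0" using shallow_relu_lipschitz[OF V0(1)] by blast
  have "\<forall>j. \<exists>M. M-lipschitz_on UNIV (D j)" using shallow_relu_lipschitz[OF D(1)] by simp
  from choice[OF this] obtain M where M: "\<And>j. (M j)-lipschitz_on UNIV (D j)" by blast
  define L' where "L' = M0 + (\<Sum>j\<in>J. M j)"
  have V\<theta>_lip: "L'-lipschitz_on UNIV (V\<theta> \<theta>)" if "\<theta> \<in> cube" for \<theta>
    unfolding V\<theta>_def[abs_def] L'_def
    by (rule lipschitz_on_affine_combination) (use M0 M abs_cube[OF that] in auto)
  have V\<theta>\<pi>_lip: "L'-lipschitz_on UNIV (\<lambda>y. V\<theta> \<theta> (\<pi> y))" if "\<theta> \<in> cube" for \<theta>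
    by (rule lip\<pi>) (rule lipschitz_on_subset[OF V\<theta>_lip[OF that]], simp)
  have close: "norm (W\<theta> \<theta> y - V\<theta> \<theta> y) \<le> (1 + real (card J)) * \<epsilon>" if "\<theta> \<in> cube" "y \<in> B" for \<theta> y
  proof -
    have "W\<theta> \<theta> y - V\<theta> \<theta> y = (W y - V0 y) + (\<Sum>j\<in>J. \<theta> j *\<^sub>R (E j y - D j y))"
      by (simp add: W\<theta>_def V\<theta>_def sum_subtractf algebra_simps)
    also have "norm \<dots> \<le> norm (W y - V0 y) + (\<Sum>j\<in>J. norm (\<theta> j *\<^sub>R (E j y - D j y)))"
      by (rule norm_triangle_le, rule add_left_mono, rule norm_sum)
    also have "\<dots> \<le> \<epsilon> + (\<Sum>j\<in>J. \<epsilon>)"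
    proof (intro add_mono sum_mono)
      fix j
      have "norm (\<theta> j *\<^sub>R (E j y - D j y)) \<le> 1 * \<epsilon>"
        unfolding norm_scaleR using abs_cube[OF that(1)] D(2)[OF that(2)] \<epsilon>
        by (intro mult_mono) auto
      then show "norm (\<theta> j *\<^sub>R (E j y - D j y)) \<le> \<epsilon>" by simp
    qed (use V0 that in auto)
    finally show ?thesis by (simp add: algebra_simps)
  qed
  have "\<exists>v. v 0 = x p \<and> (\<forall>t. (v has_vector_derivative V\<theta> \<theta> (\<pi> (v t))) (at t))" if "\<theta> \<in> cube" for \<theta> p
    using lipschitz_ode_solution[OF V\<theta>\<pi>_lip[OF that], of "x p"] by metis
  then obtain v where v0: "\<And>\<theta> p. \<theta> \<in> cube \<Longrightarrow> v \<theta> p 0 = x p"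
    and v': "\<And>\<theta> p t. \<theta> \<in> cube \<Longrightarrow> (v \<theta> p has_vector_derivative V\<theta> \<theta> (\<pi> (v \<theta> p t))) (at t)"
    by metis
  have uv: "norm (u \<theta> p t - v \<theta> p t) \<le> \<gamma>'" if \<theta>: "\<theta> \<in> cube" and p: "p \<in> P" and t: "t \<in> {0..T}" for \<theta> p t
  proof -
    have "norm (u \<theta> p t - v \<theta> p t) \<le> ((1 + real (card J)) * \<epsilon>) * exp ((2 * L + 1) * t)"
    proof (rule gronwall_norm_difference[where f = "\<lambda>y. W\<theta> \<theta> (\<pi> y)" and g = "\<lambda>y. V\<theta> \<theta> (\<pi> y)"])
      fix s assume s: "s \<in> {0..t}"
      then have sT: "s \<in> {0..T}" using t by auto
      have "\<pi> (u \<theta> p s) = u \<theta> p s"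
        using uR[OF \<theta> p sT] by (intro \<pi>_id) (auto simp: B_def R'_def)
      then show "(u \<theta> p has_vector_derivative W\<theta> \<theta> (\<pi> (u \<theta> p s))) (at s within {0..t})"
        using u'[OF \<theta> p sT] t unfolding W\<theta>_def
        by (auto intro: has_vector_derivative_within_subset)
      show "(v \<theta> p has_vector_derivative V\<theta> \<theta> (\<pi> (v \<theta> p s))) (at s within {0..t})"
        using v'[OF \<theta>] by (rule has_vector_derivative_at_within)
      show "norm (W\<theta> \<theta> (\<pi> (v \<theta> p s)) - V\<theta> \<theta> (\<pi> (v \<theta> p s))) \<le> (1 + real (card J)) * \<epsilon>"
        by (rule close[OF \<theta> \<pi>B])
    qed (use \<epsilon> t u0[OF \<theta> p] v0[OF \<theta>] W\<theta>_lip[OF \<theta>] in auto)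
    also have "\<dots> \<le> ((1 + real (card J)) * \<epsilon>) * exp ((2 * L + 1) * T)"
      using t \<epsilon> lipschitz_on_nonneg[OF W\<theta>_lip[OF \<theta>]]
      by (intro mult_left_mono) (auto intro!: mult_left_mono)
    also have "\<dots> = \<epsilon> * c" by (simp add: c_def)
    also have "\<dots> = \<gamma>'" using c by (simp add: \<epsilon>_def)
    finally show ?thesis .
  qed
  have vB: "v \<theta> p t \<in> B" if "\<theta> \<in> cube" "p \<in> P" "t \<in> {0..T}" for \<theta> p t
  proof -
    have "norm (v \<theta> p t) \<le> norm (u \<theta> p t) + norm (u \<theta> p t - v \<theta> p t)"
      by (metis norm_minus_commute norm_triangle_sub)
    then show ?thesis using uR[OF that] uv[OF that] by (auto simp: B_def R'_def \<gamma>'_def)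
  qed
  \<comment> \<open>Up to time \<open>T\<close> the curve \<open>v\<close> stays in
    \<open>B\<close>, so the truncation is invisible and \<open>v\<close> follows the ReLU field
    itself.\<close>
  have flow_v: "flow (V\<theta> \<theta>) T (x p) = v \<theta> p T" if "\<theta> \<in> cube" "p \<in> P" for \<theta> p
  proof (rule flow_eqI[OF V\<theta>_lip[OF that(1)]])
    show "(v \<theta> p has_vector_derivative V\<theta> \<theta> (v \<theta> p t)) (at t within {0..T})" if "t \<in> {0..T}" for t
      using v'[OF \<open>\<theta> \<in> cube\<close>, of p t] \<pi>_id[OF vB[OF \<open>\<theta> \<in> cube\<close> \<open>p \<in> P\<close> that]]
      by (simp add: has_vector_derivative_at_within)
  qed (use \<open>T > 0\<close> v0[OF that(1)] in auto)
  have "\<exists>K. \<forall>y\<in>B. norm (D j y) \<le> K" for j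
    using lipschitz_on_balls_bounded[OF lipschitz_on_balls_global[OF M[of j]], of R']
    by (metis B_def dist_0_norm mem_cball)
  then have "\<forall>j. \<exists>K. \<forall>y\<in>B. norm (D j y) \<le> K" by simp
  from choice[OF this] obtain K where K: "\<And>j y. y \<in> B \<Longrightarrow> norm (D j y) \<le> K j" by blast
  \<comment> \<open>On \<open>B\<close> the fields for \<open>\<theta>\<close> and
    \<open>\<theta>0\<close> differ by at most \<open>S \<theta>\<close>, which tends to 0, and
    \<open>L'\<close> is uniform over the cube.\<close>
  have v_cont: "continuous_on cube (\<lambda>\<theta>. v \<theta> p T)" for p
    unfolding continuous_on_def
  proof
    fix \<theta>0 assume \<theta>0: "\<theta>0 \<in> cube"
    define S where "S \<theta> = (\<Sum>j\<in>J. \<bar>\<theta> j - \<theta>0 j\<bar> * \<bar>K j\<bar>)" for \<theta>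
    have "((\<lambda>\<theta>. \<theta> j) \<longlongrightarrow> \<theta>0 j) (at \<theta>0 within cube)" for j
      using continuous_on_subset[OF continuous_on_product_coordinates subset_UNIV, of cube j] \<theta>0
      unfolding continuous_on_def by blast
    then have "((\<lambda>\<theta>. S \<theta> * exp ((2 * L' + 1) * T)) \<longlongrightarrow>
        (\<Sum>j\<in>J. \<bar>\<theta>0 j - \<theta>0 j\<bar> * \<bar>K j\<bar>) * exp ((2 * L' + 1) * T)) (at \<theta>0 within cube)"
      unfolding S_def by (intro tendsto_intros)
    then have lim: "((\<lambda>\<theta>. S \<theta> * exp ((2 * L' + 1) * T)) \<longlongrightarrow> 0) (at \<theta>0 within cube)"
      by simp
    have "norm (v \<theta> p T - v \<theta>0 p T) \<le> S \<theta> * exp ((2 * L' + 1) * T)" if \<theta>: "\<theta> \<in> cube" for \<theta>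
    proof (rule gronwall_norm_difference[where f = "\<lambda>y. V\<theta> \<theta> (\<pi> y)" and g = "\<lambda>y. V\<theta> \<theta>0 (\<pi> y)"])
      show "0 \<le> S \<theta>" by (auto simp: S_def intro: sum_nonneg)
      fix t
      have "V\<theta> \<theta> y - V\<theta> \<theta>0 y = (\<Sum>j\<in>J. (\<theta> j - \<theta>0 j) *\<^sub>R D j y)" for y
        by (simp add: V\<theta>_def scaleR_diff_left sum_subtractf)
      moreover have "norm (\<Sum>j\<in>J. (\<theta> j - \<theta>0 j) *\<^sub>R D j y) \<le> S \<theta>" if "y \<in> B" for y
        unfolding S_def
      proof (rule sum_norm_le)
        fix j
        show "norm ((\<theta> j - \<theta>0 j) *\<^sub>R D j y) \<le> \<bar>\<theta> j - \<theta>0 j\<bar> * \<bar>K j\<bar>"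
          using K[OF that, of j] by (auto intro!: mult_left_mono)
      qed
      ultimately show "norm (V\<theta> \<theta> (\<pi> (v \<theta>0 p t)) - V\<theta> \<theta>0 (\<pi> (v \<theta>0 p t))) \<le> S \<theta>"
        using \<pi>B by simp
    qed (use \<open>T > 0\<close> v0 \<theta> \<theta>0 v' V\<theta>\<pi>_lip in \<open>auto intro: has_vector_derivative_at_within\<close>)
    then have "((\<lambda>\<theta>. v \<theta> p T - v \<theta>0 p T) \<longlongrightarrow> 0) (at \<theta>0 within cube)"
      by (intro Lim_null_comparison[OF _ lim]) (auto simp: eventually_at_filter)
    then show "((\<lambda>\<theta>. v \<theta> p T) \<longlongrightarrow> v \<theta>0 p T) (at \<theta>0 within cube)"
      by (simp add: LIM_zero_iff)
  qed
  have hv: "\<bar>h p k (u \<theta> p T) - h p k (v \<theta> p T)\<bar> < \<eta>" if "\<theta> \<in> cube" "p \<in> P" for \<theta> p k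
  proof (rule \<gamma>(2))
    have T: "T \<in> {0..T}" using \<open>T > 0\<close> by simp
    show "u \<theta> p T \<in> B" using uR[OF that T] by (auto simp: B_def R'_def)
    show "v \<theta> p T \<in> B" by (rule vB[OF that T])
    show "dist (u \<theta> p T) (v \<theta> p T) \<le> \<gamma>" using uv[OF that T] by (simp add: dist_norm \<gamma>'_def)
  qed (use that in \<open>simp add: J_def\<close>)
  \<comment> \<open>On the faces the margin \<open>\<eta>\<close> known for \<open>u\<close> leaves
    a strict sign for \<open>v\<close>, by \<open>hv\<close>.\<close>
  obtain \<theta> where \<theta>: "\<theta> \<in> cube" and zero: "\<And>j. j \<in> J \<Longrightarrow> h (fst j) (snd j) (v \<theta> (fst j) T) = 0"
  proof (rule poincare_miranda[OF finJ, of "\<lambda>\<theta> j. h (fst j) (snd j) (v \<theta> (fst j) T)"])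
    show "continuous_on {\<theta>. \<forall>j. \<theta> j \<in> {-1..1}} (\<lambda>\<theta>. h (fst j) (snd j) (v \<theta> (fst j) T))" for j
      unfolding cube_def[symmetric] by (rule continuous_on_compose2[OF h v_cont]) simp
    fix \<theta> :: "'p \<times> 'n \<Rightarrow> real" and j
    assume j: "j \<in> J" and "\<forall>j. \<theta> j \<in> {-1..1}"
    then have \<theta>: "\<theta> \<in> cube" and p: "fst j \<in> P" by (auto simp: cube_def J_def)
    show "0 < h (fst j) (snd j) (v \<theta> (fst j) T)" if "\<theta> j = 1"
      using upos[OF \<theta> p, of "snd j"] hv[OF \<theta> p, of "snd j"] that by simp
    show "h (fst j) (snd j) (v \<theta> (fst j) T) < 0" if "\<theta> j = -1"
      using uneg[OF \<theta> p, of "snd j"] hv[OF \<theta> p, of "snd j"] that by simp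
  qed (use that in \<open>unfold cube_def, blast\<close>)
  show thesis
  proof (rule that[OF V\<theta>_relu[of \<theta>]])
    fix p assume p: "p \<in> P"
    have "v \<theta> p T = x (\<sigma> p)"
      using zero[of "(p, _)"] p by (intro h0) (auto simp: J_def)
    then show "flow (V\<theta> \<theta>) T (x p) = x (\<sigma> p)" using flow_v[OF \<theta> p] by simp
  qed
qed

section \<open>Moving configurations by shears\<close>

text \<open>The field is pulled back along the shear \<open>y \<mapsto> y + G (a \<bullet> y)\<close>; the pull-back is linear in the
  field, so an affine family stays affine.\<close>

lemma robust_shear_imp:
  fixes x x' :: "'p \<Rightarrow> real^'n"
  assumes "robust T P \<sigma> x" and G: "polynomial_function G" and aG: "\<And>s. a \<bullet> G s = 0"
    and x': "\<And>p. p \<in> P \<Longrightarrow> x p = x' p + G (a \<bullet> x' p)" and \<sigma>: "\<And>p. p \<in> P \<Longrightarrow> \<sigma> p \<in> P"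
  shows "robust T P \<sigma> x'"
proof -
  obtain W E h R \<eta> where *: "robust_family T P \<sigma> x W E h R \<eta>"
    using assms(1) unfolding robust_def by blast
  then have W: "lipschitz_on_balls W" and E: "\<And>j. lipschitz_on_balls (E j)"
    and h: "\<And>p k. continuous_on UNIV (h p k)" and \<eta>: "\<eta> > 0"
    and h0: "\<And>p y. p \<in> P \<Longrightarrow> (\<And>k. h p k y = 0) \<Longrightarrow> y = x (\<sigma> p)"
    unfolding robust_family_def by blast+
  obtain G' where G': "polynomial_function G'" "\<And>s. (G has_vector_derivative G' s) (at s)"
    using has_vector_derivative_polynomial_function[OF G] by blast
  define S where "S y = y + G (a \<bullet> y)" for y
  have aS: "a \<bullet> S y = a \<bullet> y" for y by (simp add: S_def inner_add_right aG)
  have S_inj: "y = z" if "S y = S z" for y z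
    using that aS[of y] aS[of z] by (simp add: S_def)
  have aff: "lipschitz_on_balls (\<lambda>y. a \<bullet> y)"
    by (rule lipschitz_on_balls_linear[OF bounded_linear_inner_right])
  have Glip: "lipschitz_on_balls (\<lambda>y. G (a \<bullet> y))" and G'lip: "lipschitz_on_balls (\<lambda>y. G' (a \<bullet> y))"
    by (rule lipschitz_on_balls_compose[OF aff lipschitz_on_balls_polynomial_function], fact)+
  have Slip: "lipschitz_on_balls S"
    unfolding S_def[abs_def]
    by (rule lipschitz_on_balls_add[OF lipschitz_on_balls_linear[OF bounded_linear_ident] Glip])
  \<comment> \<open>The differential of the inverse shear
    \<open>z \<mapsto> z - G (a \<bullet> z)\<close> at \<open>S y\<close>, applied to
    \<open>F (S y)\<close>; it is evaluated with
    \<open>a \<bullet> S y = a \<bullet> y\<close>.\<close>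
  define pull where "pull F y = F (S y) - (a \<bullet> F (S y)) *\<^sub>R G' (a \<bullet> y)" for F y
  have pull: "lipschitz_on_balls (pull F)" if "lipschitz_on_balls F" for F
  proof -
    have FS: "lipschitz_on_balls (\<lambda>y. F (S y))" by (rule lipschitz_on_balls_compose[OF Slip that])
    show ?thesis unfolding pull_def[abs_def]
      by (intro lipschitz_on_balls_diff lipschitz_on_balls_scaleR lipschitz_on_balls_inner FS G'lip)
  qed
  obtain K where K: "\<And>y. norm y \<le> R \<Longrightarrow> norm (G (a \<bullet> y)) \<le> K"
    using lipschitz_on_balls_bounded[OF Glip] by metis
  have "robust_family T P \<sigma> x' (pull W) (\<lambda>j. pull (E j)) (\<lambda>p k y. h p k (S y)) (R + K) \<eta>"
    unfolding robust_family_def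
  proof (intro conjI ballI allI impI)
    show "lipschitz_on_balls (pull W)" "lipschitz_on_balls (pull (E j))" for j
      by (auto intro: pull W E)
    show "continuous_on UNIV (\<lambda>y. h p k (S y))" for p k
      by (rule continuous_on_compose2[OF h lipschitz_on_balls_continuous[OF Slip]]) simp
    show "y = x' (\<sigma> p)" if "p \<in> P" "\<forall>k. h p k (S y) = 0" for p y
    proof (rule S_inj)
      show "S y = S (x' (\<sigma> p))"
        using h0[of p "S y"] that x'[of "\<sigma> p"] \<sigma> by (simp add: S_def)
    qed
  next
    fix \<theta> :: "'p \<times> 'n \<Rightarrow> real" and p
    assume "\<forall>j. \<theta> j \<in> {-1..1}" and p: "p \<in> P"
    with conjunct2[OF conjunct2[OF conjunct2[OF conjunct2[OF conjunct2[OF *[unfolded robust_family_def]]]]]]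
    obtain u where u0: "u 0 = x p" and u: "\<forall>t\<in>{0..T}. norm (u t) \<le> R \<and>
         (u has_vector_derivative (W (u t) + (\<Sum>j\<in>P \<times> UNIV. \<theta> j *\<^sub>R E j (u t)))) (at t within {0..T})"
      and uT: "\<forall>k. (\<theta> (p, k) = 1 \<longrightarrow> \<eta> \<le> h p k (u T)) \<and> (\<theta> (p, k) = -1 \<longrightarrow> h p k (u T) \<le> - \<eta>)"
      by blast
    define v where "v t = u t - G (a \<bullet> u t)" for t
    have av: "a \<bullet> v t = a \<bullet> u t" for t by (simp add: v_def inner_diff_right aG)
    have Sv: "S (v t) = u t" for t using av[of t] by (simp add: S_def v_def)
    show "\<exists>u. u 0 = x' p \<and>
         (\<forall>t\<in>{0..T}. norm (u t) \<le> R + K \<and>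
           (u has_vector_derivative (pull W (u t) + (\<Sum>j\<in>P \<times> UNIV. \<theta> j *\<^sub>R pull (E j) (u t))))
             (at t within {0..T})) \<and>
         (\<forall>k. (\<theta> (p, k) = 1 \<longrightarrow> \<eta> \<le> h p k (S (u T))) \<and> (\<theta> (p, k) = -1 \<longrightarrow> h p k (S (u T)) \<le> - \<eta>))"
    proof (intro exI[of _ v] conjI ballI)
      show "v 0 = x' p" by (rule S_inj) (simp add: Sv u0 x'[OF p], simp add: S_def)
      show "\<forall>k. (\<theta> (p, k) = 1 \<longrightarrow> \<eta> \<le> h p k (S (v T))) \<and> (\<theta> (p, k) = -1 \<longrightarrow> h p k (S (v T)) \<le> - \<eta>)"
        using uT by (simp add: Sv)
      fix t assume t: "t \<in> {0..T}"
      then have uR: "norm (u t) \<le> R" using u by blast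
      then show "norm (v t) \<le> R + K"
        using K[OF uR] norm_triangle_ineq4[of "u t" "G (a \<bullet> u t)"] by (simp add: v_def)
      define F where "F = W (u t) + (\<Sum>j\<in>P \<times> UNIV. \<theta> j *\<^sub>R E j (u t))"
      have u': "(u has_vector_derivative F) (at t within {0..T})" using u t by (simp add: F_def)
      have "((\<lambda>t. a \<bullet> u t) has_vector_derivative a \<bullet> F) (at t within {0..T})"
        by (rule bounded_linear.has_vector_derivative[OF bounded_linear_inner_right u'])
      from vector_diff_chain_within[OF this has_vector_derivative_at_within[OF G'(2)]]
      have "((\<lambda>t. G (a \<bullet> u t)) has_vector_derivative (a \<bullet> F) *\<^sub>R G' (a \<bullet> u t)) (at t within {0..T})"
        by (simp add: o_def)
      then have "(v has_vector_derivative F - (a \<bullet> F) *\<^sub>R G' (a \<bullet> u t)) (at t within {0..T})"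
        unfolding v_def by (rule has_vector_derivative_diff[OF u'])
      moreover have "F - (a \<bullet> F) *\<^sub>R G' (a \<bullet> u t)
          = pull W (v t) + (\<Sum>j\<in>P \<times> UNIV. \<theta> j *\<^sub>R pull (E j) (v t))"
        by (simp add: F_def pull_def Sv av inner_add_right inner_sum_right scaleR_add_left
            scaleR_left.sum sum_subtractf scaleR_diff_right)
      ultimately show "(v has_vector_derivative
          (pull W (v t) + (\<Sum>j\<in>P \<times> UNIV. \<theta> j *\<^sub>R pull (E j) (v t)))) (at t within {0..T})"
        by simp
    qed
  qed (use \<eta> in auto)
  then show ?thesis unfolding robust_def by blast
qed

lemma robust_shear:
  fixes x x' :: "'p \<Rightarrow> real^'n"
  assumes G: "polynomial_function G" and aG: "\<And>s. a \<bullet> G s = 0"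
    and x': "\<And>p. p \<in> P \<Longrightarrow> x' p = x p + G (a \<bullet> x p)" and \<sigma>: "\<And>p. p \<in> P \<Longrightarrow> \<sigma> p \<in> P"
  shows "robust T P \<sigma> x \<longleftrightarrow> robust T P \<sigma> x'"
proof
  assume "robust T P \<sigma> x"
  then show "robust T P \<sigma> x'"
  proof (rule robust_shear_imp)
    show "polynomial_function (\<lambda>s. - G s)" using G by (rule polynomial_function_minus)
    show "x p = x' p + - G (a \<bullet> x' p)" if "p \<in> P" for p
      using x'[OF that] by (simp add: inner_add_right aG)
  qed (use aG \<sigma> in auto)
next
  assume "robust T P \<sigma> x'"
  then show "robust T P \<sigma> x" by (rule robust_shear_imp[OF _ G aG]) (use x' \<sigma> in auto)
qed

text \<open>Lagrange interpolation. The values of \<open>G\<close> are linear combinations of the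
  \<open>v p\<close>, so orthogonality to \<open>a\<close> passes from the data to the whole curve,
  as a shear requires.\<close>

lemma polynomial_interpolation:
  fixes v :: "'p \<Rightarrow> 'a::euclidean_space" and s :: "'p \<Rightarrow> real"
  assumes "finite P" "inj_on s P" "\<And>p. p \<in> P \<Longrightarrow> a \<bullet> v p = 0"
  obtains G where "polynomial_function G" "\<And>t. a \<bullet> G t = 0" "\<And>p. p \<in> P \<Longrightarrow> G (s p) = v p"
proof
  define l where "l p t = (\<Prod>q\<in>P - {p}. (t - s q) / (s p - s q))" for p and t :: real
  define G where "G t = (\<Sum>p\<in>P. l p t *\<^sub>R v p)" for t
  have "real_polynomial_function (\<lambda>t. t - s q)" for q
    unfolding real_polynomial_function_eq
    by (intro polynomial_function_diff polynomial_function_id polynomial_function_const)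
  then have "real_polynomial_function (l p)" for p
    unfolding l_def using \<open>finite P\<close>
    by (intro real_polynomial_function_prod real_polynomial_function_divide) auto
  then have "polynomial_function (l p)" for p
    by (simp add: real_polynomial_function_eq)
  then show "polynomial_function G"
    unfolding G_def[abs_def] using \<open>finite P\<close>
    by (intro polynomial_function_sum polynomial_function_mult polynomial_function_const)
  show "a \<bullet> G t = 0" for t
    by (simp add: G_def inner_sum_right assms(3))
  show "G (s p) = v p" if p: "p \<in> P" for p
  proof -
    have "l p (s p) = 1"
      unfolding l_def using p assms(2) by (intro prod.neutral) (auto simp: inj_on_def)
    moreover have "l q (s p) = 0" if "q \<in> P" "q \<noteq> p" for q
      unfolding l_def using \<open>finite P\<close> p that by (intro prod_zero) (auto intro!: bexI[of _ p])
    ultimately show ?thesis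
      using \<open>finite P\<close> p by (simp add: G_def sum.remove[OF _ p])
  qed
qed

text \<open>Each difference \<open>x p - x q\<close>, and the vector \<open>axis i 1\<close>,
  excludes a hyperplane of directions; finitely many hyperplanes do not fill the space.\<close>

lemma generic_direction:
  fixes x :: "'p \<Rightarrow> real^'n"
  assumes "finite P" "inj_on x P"
  obtains a :: "real^'n" where "a $ i \<noteq> 0" "inj_on (\<lambda>p. a \<bullet> x p) P"
proof -
  define Z where "Z = insert (axis i 1) ((\<lambda>(p, q). x p - x q) ` {(p, q) \<in> P \<times> P. p \<noteq> q})"
  have "finite {(p, q) \<in> P \<times> P. p \<noteq> q}"
    by (rule finite_subset[of _ "P \<times> P"]) (use assms in auto)
  then have "finite Z" by (simp add: Z_def)
  have "z \<noteq> 0" if z: "z \<in> Z" for z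
  proof -
    consider "z = axis i 1" | p q where "z = x p - x q" "p \<in> P" "q \<in> P" "p \<noteq> q"
      using z by (auto simp: Z_def)
    then show ?thesis
    proof cases
      case 2
      then show ?thesis using inj_onD[OF assms(2), of p q] by auto
    qed simp
  qed
  then have "negligible {a. z \<bullet> a = 0}" if "z \<in> Z" for z
    using that by (intro negligible_hyperplane) auto
  then have "negligible (\<Union>z\<in>Z. {a. z \<bullet> a = 0})"
    using \<open>finite Z\<close> by (intro negligible_Union) auto
  then have "(\<Union>z\<in>Z. {a. z \<bullet> a = 0}) \<noteq> UNIV" by (metis non_negligible_UNIV)
  then obtain a where a: "\<And>z. z \<in> Z \<Longrightarrow> z \<bullet> a \<noteq> 0" by blast
  show thesis
  proof
    show "a $ i \<noteq> 0" using a[of "axis i 1"] by (simp add: Z_def inner_axis' )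
    show "inj_on (\<lambda>p. a \<bullet> x p) P"
    proof (rule inj_onI, rule ccontr)
      fix p q assume pq: "p \<in> P" "q \<in> P" "a \<bullet> x p = a \<bullet> x q" "p \<noteq> q"
      have "(x p - x q) \<bullet> a \<noteq> 0" by (rule a) (use pq in \<open>auto simp: Z_def\<close>)
      then show False using pq by (simp add: inner_commute[of "x p - x q"] inner_diff_right)
    qed
  qed
qed

text \<open>Two shears move any configuration of distinct points onto the line spanned by
  \<open>axis i2 1\<close>: the first makes the \<open>i2\<close>-coordinates distinct and prescribed, the second uses them
  to clear the other coordinates.\<close>

lemma robust_line_iff:
  fixes x :: "'p \<Rightarrow> real^'n" and i1 i2 :: 'n
  assumes "finite P" "inj_on x P" "inj_on q P" "i1 \<noteq> i2" and \<sigma>: "\<And>p. p \<in> P \<Longrightarrow> \<sigma> p \<in> P"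
  shows "robust T P \<sigma> x \<longleftrightarrow> robust T P \<sigma> (\<lambda>p. axis i2 (q p))"
proof -
  obtain a where a: "a $ i1 \<noteq> 0" "inj_on (\<lambda>p. a \<bullet> x p) P"
    using generic_direction[OF assms(1,2)] by blast
  \<comment> \<open>A vector orthogonal to \<open>a\<close> whose \<open>i2\<close>-component
    \<open>a $ i1\<close> is nonzero: moving along it keeps \<open>a \<bullet> x p\<close> and
    adjusts the \<open>i2\<close>-coordinate at will.\<close>
  define w :: "real^'n" where "w = axis i2 (a $ i1) - axis i1 (a $ i2)"
  have aw: "a \<bullet> w = 0" by (simp add: w_def inner_diff_right inner_axis mult.commute)
  obtain G where G: "polynomial_function G" "\<And>s. a \<bullet> G s = 0"
    "\<And>p. p \<in> P \<Longrightarrow> G (a \<bullet> x p) = ((q p - x p $ i2) / a $ i1) *\<^sub>R w"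
  proof (rule polynomial_interpolation[OF assms(1) a(2), where a = a
        and v = "\<lambda>p. ((q p - x p $ i2) / a $ i1) *\<^sub>R w"])
    show "a \<bullet> ((q p - x p $ i2) / a $ i1) *\<^sub>R w = 0" for p by (simp add: aw)
  qed (rule that)
  define x' where "x' p = x p + G (a \<bullet> x p)" for p
  have w2: "w $ i2 = a $ i1" using \<open>i1 \<noteq> i2\<close> by (simp add: w_def axis_def)
  have x'2: "x' p $ i2 = q p" if "p \<in> P" for p
    using a(1) by (simp add: x'_def G(3)[OF that] w2)
  have proj: "axis i2 1 \<bullet> y = y $ i2" for y :: "real^'n"
    by (simp add: inner_axis')
  have inj: "inj_on (\<lambda>p. x' p $ i2) P" using assms(3) x'2 by (simp add: inj_on_def)
  obtain H where H: "polynomial_function H" "\<And>s. axis i2 1 \<bullet> H s = 0"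
    "\<And>p. p \<in> P \<Longrightarrow> H (x' p $ i2) = axis i2 (q p) - x' p"
  proof (rule polynomial_interpolation[OF assms(1) inj, where a = "axis i2 1"
        and v = "\<lambda>p. axis i2 (q p) - x' p"])
    show "axis i2 1 \<bullet> (axis i2 (q p) - x' p) = 0" if "p \<in> P" for p
      using x'2[OF that] by (simp only: proj) (simp add: axis_def)
  qed (rule that)
  have "robust T P \<sigma> x \<longleftrightarrow> robust T P \<sigma> x'"
    by (rule robust_shear[OF G(1,2)]) (auto simp: x'_def \<sigma>)
  also have "\<dots> \<longleftrightarrow> robust T P \<sigma> (\<lambda>p. axis i2 (q p))"
    by (rule robust_shear[OF H(1,2)]) (use H(3) \<sigma> in \<open>auto simp: proj\<close>)
  finally show ?thesis .
qed

text \<open>Both configurations are sheared onto the same points of a line. Robustness thus depends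
  on the permutation alone, and the points may be placed wherever the dynamics is
  convenient.\<close>

corollary robust_iff:
  fixes x y :: "'p \<Rightarrow> real^'n"
  assumes "finite P" "inj_on x P" "inj_on y P" "CARD('n) \<ge> 2" and \<sigma>: "\<And>p. p \<in> P \<Longrightarrow> \<sigma> p \<in> P"
  shows "robust T P \<sigma> x \<longleftrightarrow> robust T P \<sigma> y"
proof -
  obtain q :: "'p \<Rightarrow> nat" where "inj_on q P"
    using finite_imp_inj_to_nat_seg[OF assms(1)] by blast
  then have q: "inj_on (\<lambda>p. real (q p)) P" by (simp add: inj_on_def)
  obtain i1 i2 :: 'n where "i1 \<noteq> i2"
    using assms(4) by (metis card_2_iff' ex_card top_greatest)
  have "robust T P \<sigma> x \<longleftrightarrow> robust T P \<sigma> (\<lambda>p. axis i2 (real (q p)))"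
    by (rule robust_line_iff[OF assms(1,2) q \<open>i1 \<noteq> i2\<close> \<sigma>])
  also have "\<dots> \<longleftrightarrow> robust T P \<sigma> y"
    by (rule robust_line_iff[OF assms(1,3) q \<open>i1 \<noteq> i2\<close> \<sigma>, symmetric])
  finally show ?thesis .
qed

section \<open>Rotations of concentric circles\<close>

lemma bounded_linear_vec_component_complex:
  "bounded_linear (\<lambda>y::real^'n. Complex (y $ i) (y $ j))"
  unfolding linear_conv_bounded_linear[symmetric]
  by (rule linearI) (simp_all add: complex_eq_iff)

lemma bounded_linear_plane:
  "bounded_linear (\<lambda>z. axis i (Re z) + axis j (Im z) :: real^'n)"
  unfolding linear_conv_bounded_linear[symmetric]
  by (rule linearI) (simp_all add: vec_eq_iff axis_def algebra_simps)

lemma clamp_lipschitz: "1-lipschitz_on UNIV (\<lambda>s::real. max 0 (min 1 s))"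
  by (rule lipschitz_onI) (auto simp: dist_real_def)

lemma abs_lipschitz: "1-lipschitz_on UNIV (\<lambda>s::real. \<bar>s\<bar>)"
  by (rule lipschitz_onI) (auto simp: dist_real_def)

lemma norm_lipschitz: "1-lipschitz_on UNIV (norm :: 'a::real_normed_vector \<Rightarrow> real)"
  by (rule lipschitz_onI) (auto simp: dist_real_def dist_norm norm_triangle_ineq3)

lemma inverse_max_lipschitz: "4-lipschitz_on UNIV (\<lambda>s::real. inverse (max s (1/2)))"
proof (rule lipschitz_onI)
  fix x y :: real
  define X Y where XY: "X = max x (1/2)" "Y = max y (1/2)"
  have "1/2 \<le> X" "1/2 \<le> Y" "\<bar>Y - X\<bar> \<le> \<bar>x - y\<bar>" by (auto simp: XY)
  then have "(1/2) * (1/2) \<le> X * Y" by (intro mult_mono) auto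
  then have "inverse (X * Y) \<le> 4" using le_imp_inverse_le[of "1/4" "X * Y"] by simp
  have "inverse X - inverse Y = (Y - X) * inverse (X * Y)"
    using \<open>1/2 \<le> X\<close> \<open>1/2 \<le> Y\<close> by (simp add: field_simps)
  then have "\<bar>inverse X - inverse Y\<bar> = \<bar>Y - X\<bar> * inverse (X * Y)"
    using \<open>1/2 \<le> X\<close> \<open>1/2 \<le> Y\<close> by (simp add: abs_mult)
  also have "\<dots> \<le> \<bar>x - y\<bar> * 4"
    using \<open>\<bar>Y - X\<bar> \<le> \<bar>x - y\<bar>\<close> \<open>inverse (X * Y) \<le> 4\<close> \<open>1/2 \<le> X\<close> \<open>1/2 \<le> Y\<close>
    by (intro mult_mono) auto
  finally show "dist (inverse (max x (1/2))) (inverse (max y (1/2))) \<le> 4 * dist x y"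
    by (simp add: dist_real_def XY)
qed simp

lemma cos_ge_one_minus_square: "1 - b\<^sup>2 / 2 \<le> cos (b::real)"
proof -
  have "\<bar>sin (b / 2)\<bar> \<le> \<bar>b / 2\<bar>" by (rule abs_sin_x_le_abs_x)
  then have "(sin (b / 2))\<^sup>2 \<le> (b / 2)\<^sup>2" by (simp only: abs_le_square_iff)
  moreover have "cos b = 1 - 2 * (sin (b / 2))\<^sup>2"
    using cos_double_sin[of "b / 2"] by simp
  ultimately show ?thesis by (simp add: power_divide)
qed

lemma sin_ge_half:
  fixes b :: real
  assumes "0 \<le> b" "b \<le> 1"
  shows "b / 2 \<le> sin b"
proof -
  have "sin 0 - 0 / 2 \<le> sin b - b / 2"
  proof (rule DERIV_nonneg_imp_nondecreasing[OF assms(1)])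
    fix x assume x: "0 \<le> x" "x \<le> b"
    have "x\<^sup>2 \<le> 1" by (rule power_le_one) (use x assms in auto)
    then have "0 \<le> cos x - 1 / 2" using cos_ge_one_minus_square[of x] by simp
    then show "\<exists>y. ((\<lambda>x. sin x - x / 2) has_real_derivative y) (at x) \<and> 0 \<le> y"
      by (intro exI[of _ "cos x - 1 / 2"]) (auto intro!: derivative_eq_intros)
  qed
  then show ?thesis by simp
qed

text \<open>An angular error \<open>b\<close> costs only \<open>b\<^sup>2 / 2\<close>, of second
  order in \<open>m\<close>, whereas the radial factor moves by about \<open>m\<close>; for
  \<open>m \<le> 1/16\<close> at least half of the radial effect survives. So the radial sign does
  not depend on the angular parameter.\<close>

lemma polar_displacement:
  fixes m b :: real
  assumes "0 \<le> m" "m \<le> 1/16" "\<bar>b\<bar> \<le> m"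
  shows "m / 2 \<le> exp m * cos b - 1" "exp (- m) * cos b - 1 \<le> - (m / 2)"
proof -
  have "b\<^sup>2 \<le> m\<^sup>2" using assms by (metis abs_le_square_iff abs_of_nonneg)
  then have c: "1 - m\<^sup>2 / 2 \<le> cos b" using cos_ge_one_minus_square[of b] by simp
  have m2: "m\<^sup>2 \<le> m / 16" unfolding power2_eq_square using assms mult_left_mono[of m "1/16" m] by simp
  have "(1 + m) * (1 - m\<^sup>2 / 2) \<le> exp m * cos b"
    using c assms m2 by (intro mult_mono) (auto intro: exp_ge_add_one_self)
  moreover have "1 + m / 2 \<le> (1 + m) * (1 - m\<^sup>2 / 2)"
  proof -
    have "(1 + m) * m\<^sup>2 \<le> 2 * (m / 16)" using assms m2 by (intro mult_mono) auto
    moreover have "(1 + m) * (1 - m\<^sup>2 / 2) = 1 + m - (1 + m) * m\<^sup>2 / 2" by (simp add: algebra_simps)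
    ultimately show ?thesis using assms by simp
  qed
  ultimately show "m / 2 \<le> exp m * cos b - 1" by simp
  have "(1 - m / 2) * (1 + m) \<ge> 1" using assms m2 by (simp add: algebra_simps power2_eq_square)
  moreover have "(1 + m) \<le> exp m" by (rule exp_ge_add_one_self)
  then have "(1 - m / 2) * (1 + m) \<le> (1 - m / 2) * exp m" using assms by (intro mult_left_mono) auto
  ultimately have "(1 - m / 2) * exp m \<ge> 1" by linarith
  then have "exp (- m) \<le> 1 - m / 2" by (simp add: exp_minus field_simps)
  moreover have "exp (- m) * cos b \<le> exp (- m) * 1" by (intro mult_left_mono) auto
  ultimately show "exp (- m) * cos b - 1 \<le> - (m / 2)" by linarith
qed

text \<open>Point \<open>p\<close> sits on the circle of radius \<open>r p\<close> at angle \<open>\<phi> p\<close>; the points on the circle of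
  radius \<open>\<rho>\<close> are among \<open>\<kappa> \<rho>\<close> equidistant ones, which \<open>\<sigma>\<close> rotates by one step.\<close>

locale circle_config =
  fixes i1 i2 :: "'n::finite" and T :: real and n :: nat
    and P :: "'p set" and \<sigma> :: "'p \<Rightarrow> 'p" and r :: "'p \<Rightarrow> nat" and \<kappa> :: "nat \<Rightarrow> nat" and \<phi> :: "'p \<Rightarrow> real"
  assumes i12: "i1 \<noteq> i2" and T: "T > 0" and finP: "finite P"
    and r: "\<And>p. p \<in> P \<Longrightarrow> 1 \<le> r p" "\<And>p. p \<in> P \<Longrightarrow> r p \<le> n"
    and \<kappa>: "\<And>p. p \<in> P \<Longrightarrow> 1 \<le> \<kappa> (r p)" "\<And>p. p \<in> P \<Longrightarrow> \<kappa> (r p) \<le> n"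
    and \<sigma>: "\<And>p. p \<in> P \<Longrightarrow> r (\<sigma> p) = r p"
      "\<And>p. p \<in> P \<Longrightarrow> cis (\<phi> (\<sigma> p)) = cis (\<phi> p + 2 * pi / real (\<kappa> (r p)))"
    and sep: "\<And>p q. p \<in> P \<Longrightarrow> q \<in> P \<Longrightarrow> p \<noteq> q \<Longrightarrow> r p = r q \<Longrightarrow>
      \<exists>m. 1 \<le> m \<and> m < \<kappa> (r p) \<and> cis (\<phi> q) = cis (\<phi> p + real m * (2 * pi / real (\<kappa> (r p))))"
begin

definition plane :: "complex \<Rightarrow> real^'n" where "plane z = axis i1 (Re z) + axis i2 (Im z)"

definition coords :: "real^'n \<Rightarrow> complex" where "coords y = Complex (y $ i1) (y $ i2)"

definition step :: "'p \<Rightarrow> real" where "step p = 2 * pi / real (\<kappa> (r p))"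

text \<open>Small enough for two purposes: \<open>8 * \<delta> \<le> step p\<close> keeps angular
  perturbations below an eighth of a step, and \<open>r p * \<delta> \<le> 1/8\<close> keeps the
  radius within \<open>1/4\<close> of \<open>r p\<close>.\<close>

definition \<delta> :: real where "\<delta> = 1 / (8 * (real n + 1))"

definition clamp :: "real \<Rightarrow> real" where "clamp s = max 0 (min 1 s)"

text \<open>Equal to 1 within \<open>1/4\<close> of the circle and to 0 from distance
  \<open>1/2\<close> on, so that circles of different integer radii do not interact.\<close>

definition annulus :: "nat \<Rightarrow> real^'n \<Rightarrow> real" where
  "annulus \<rho> y = clamp (2 - 4 * \<bar>norm (coords y) - real \<rho>\<bar>)"

text \<open>A cutoff in the angle, equal to 1 up to \<open>\<alpha> / 4\<close> and to 0 from
  \<open>3/8 * \<alpha>\<close> on. It is expressed through the cosine \<open>c\<close> of the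
  angle, which avoids choosing a branch of the argument.\<close>

definition profile :: "real \<Rightarrow> real \<Rightarrow> real" where
  "profile \<alpha> c = clamp ((c - cos (3/8 * \<alpha>)) / (cos (\<alpha>/4) - cos (3/8 * \<alpha>)))"

text \<open>The middle part of the arc from \<open>p\<close> to \<open>\<sigma> p\<close>; the truncation by \<open>1/2\<close> only serves to
  make the bump Lipschitz at the centre of the circles.\<close>

definition bump :: "'p \<Rightarrow> real^'n \<Rightarrow> real" where
  "bump p y = annulus (r p) y *
     profile (step p) ((y $ i1 * cos (\<phi> p + step p / 2) + y $ i2 * sin (\<phi> p + step p / 2)) *
       inverse (max (norm (coords y)) (1/2)))"

definition rotation :: "real^'n \<Rightarrow> real^'n" where
  "rotation y = (\<Sum>\<rho>\<in>r ` P. annulus \<rho> y * (2 * pi / (T * real (\<kappa> \<rho>)))) *\<^sub>R plane (\<i> * coords y)"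

text \<open>The indices \<open>i1\<close> and \<open>i2\<close> stand for the radial and the
  tangential direction. Being linear in \<open>y\<close>, these two fields shift the logarithm of
  the radius and the angle at constant rate.\<close>

definition dir :: "'n \<Rightarrow> real^'n \<Rightarrow> real^'n" where
  "dir k y = (if k = i1 then plane (coords y) else if k = i2 then plane (\<i> * coords y) else axis k 1)"

definition kick :: "'p \<times> 'n \<Rightarrow> real^'n \<Rightarrow> real^'n" where
  "kick j y = (\<delta> / T * bump (fst j) y) *\<^sub>R dir (snd j) y"

definition centre :: "'p \<Rightarrow> complex" where "centre p = of_real (real (r p)) * cis (\<phi> p)"

text \<open>Multiplication by \<open>cnj (centre (\<sigma> p))\<close> turns the target onto the
  positive real axis, at the square of its radius; the real part then measures the radial error and
  the imaginary part the angular one.\<close>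

definition gauge :: "'p \<Rightarrow> 'n \<Rightarrow> real^'n \<Rightarrow> real" where
  "gauge p k y = (if k = i1 then Re (coords y * cnj (centre (\<sigma> p))) - (real (r p))\<^sup>2
     else if k = i2 then Im (coords y * cnj (centre (\<sigma> p))) else y $ k)"

section \<open>Regularity of the circle fields and gauges\<close>

lemma coords_linear: "bounded_linear coords"
  unfolding coords_def[abs_def] by (rule bounded_linear_vec_component_complex)

lemma plane_linear: "bounded_linear plane"
  unfolding plane_def[abs_def] by (rule bounded_linear_plane)

lemma coords_plane [simp]: "coords (plane z) = z"
  using i12 by (simp add: coords_def plane_def axis_def complex_eq_iff)

lemma plane_component [simp]: "k \<noteq> i1 \<Longrightarrow> k \<noteq> i2 \<Longrightarrow> plane z $ k = 0"
  by (simp add: plane_def axis_def)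

lemma plane_coords:
  assumes "\<And>k. k \<noteq> i1 \<Longrightarrow> k \<noteq> i2 \<Longrightarrow> y $ k = 0"
  shows "plane (coords y) = y"
proof -
  have "plane (coords y) $ k = y $ k" for k
    using assms i12 by (auto simp: plane_def coords_def axis_def)
  then show ?thesis by (simp add: vec_eq_iff)
qed

lemma lob_clamp: "lipschitz_on_balls f \<Longrightarrow> lipschitz_on_balls (\<lambda>y. clamp (f y))"
  unfolding clamp_def
  by (rule lipschitz_on_balls_compose[OF _ lipschitz_on_balls_global[OF clamp_lipschitz]])

lemma lob_coords: "lipschitz_on_balls coords"
  by (rule lipschitz_on_balls_linear[OF coords_linear])

lemma lob_norm_coords: "lipschitz_on_balls (\<lambda>y. norm (coords y))"
  by (rule lipschitz_on_balls_compose[OF lob_coords lipschitz_on_balls_global[OF norm_lipschitz]])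

lemma lob_annulus: "lipschitz_on_balls (annulus \<rho>)"
  unfolding annulus_def[abs_def]
  by (intro lob_clamp lipschitz_on_balls_diff lipschitz_on_balls_const lipschitz_on_balls_mult
      lipschitz_on_balls_compose[OF _ lipschitz_on_balls_global[OF abs_lipschitz]] lob_norm_coords)

lemma lob_component: "lipschitz_on_balls (\<lambda>y::real^'n. y $ k)"
  by (rule lipschitz_on_balls_linear[OF bounded_linear_vec_nth])

lemma lob_bump: "lipschitz_on_balls (bump p)"
  unfolding bump_def[abs_def] profile_def divide_inverse[of "_ - _"]
  by (intro lob_clamp lipschitz_on_balls_mult lipschitz_on_balls_diff lipschitz_on_balls_const
      lipschitz_on_balls_add lob_component lob_annulus
      lipschitz_on_balls_compose[OF lob_norm_coords lipschitz_on_balls_global[OF inverse_max_lipschitz]])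

lemma lob_rotation: "lipschitz_on_balls rotation"
proof -
  have "bounded_linear (\<lambda>y. plane (\<i> * coords y))"
    by (rule bounded_linear_compose[OF plane_linear bounded_linear_compose[OF bounded_linear_mult_right coords_linear]])
  then show ?thesis
    unfolding rotation_def[abs_def]
    by (intro lipschitz_on_balls_scaleR lipschitz_on_balls_sum lipschitz_on_balls_mult lob_annulus
      lipschitz_on_balls_const lipschitz_on_balls_linear)
qed

lemma lob_kick: "lipschitz_on_balls (kick j)"
proof -
  have "bounded_linear (\<lambda>y. plane (\<i> * coords y))" "bounded_linear (\<lambda>y. plane (coords y))"
    by (intro bounded_linear_compose[OF plane_linear] bounded_linear_compose[OF bounded_linear_mult_right]
        coords_linear)+
  then have "lipschitz_on_balls (dir k)" for k
    unfolding dir_def[abs_def]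
    by (cases "k = i1"; cases "k = i2") (simp_all add: lipschitz_on_balls_linear lipschitz_on_balls_const)
  then show ?thesis
    unfolding kick_def[abs_def]
    by (intro lipschitz_on_balls_scaleR lipschitz_on_balls_mult lob_bump lipschitz_on_balls_const)
qed

lemma continuous_gauge: "continuous_on UNIV (gauge p k)"
proof -
  have "continuous_on UNIV coords" by (rule bounded_linear.continuous_on[OF coords_linear continuous_on_id])
  then show ?thesis
    unfolding gauge_def[abs_def]
    by (cases "k = i1"; cases "k = i2") (auto intro!: continuous_intros)
qed

lemma gauge_zero:
  assumes "p \<in> P" "\<And>k. gauge p k y = 0"
  shows "y = plane (centre (\<sigma> p))"
proof -
  let ?c = "centre (\<sigma> p)"
  have rp: "real (r p) > 0" using r(1)[OF assms(1)] by simp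
  have nc: "?c * cnj ?c = of_real ((real (r p))\<^sup>2)"
    unfolding complex_norm_square[symmetric] by (simp add: centre_def \<sigma>(1)[OF assms(1)] norm_mult)
  have "coords y * cnj ?c = of_real ((real (r p))\<^sup>2)"
    using assms(2)[of i1] assms(2)[of i2] i12 by (simp add: gauge_def complex_eq_iff)
  then have "coords y * cnj ?c = ?c * cnj ?c" using nc by simp
  moreover have "cnj ?c \<noteq> 0" using rp by (simp add: centre_def \<sigma>(1)[OF assms(1)])
  ultimately have "coords y = ?c" by simp
  moreover have "y $ k = 0" if "k \<noteq> i1" "k \<noteq> i2" for k
    using assms(2)[of k] that by (simp add: gauge_def)
  ultimately show ?thesis using plane_coords[of y] by simp
qed

section \<open>Sizes and supports of the bumps\<close>

lemma step_bounds:
  assumes "p \<in> P"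
  shows "0 < step p" "step p \<le> 2 * pi" "8 * \<delta> \<le> step p" "real (\<kappa> (r p)) * step p = 2 * pi"
proof -
  have k: "1 \<le> real (\<kappa> (r p))" "real (\<kappa> (r p)) \<le> real n"
    using \<kappa>[OF assms] by auto
  show "0 < step p" "step p \<le> 2 * pi" "real (\<kappa> (r p)) * step p = 2 * pi"
    using k by (auto simp: step_def divide_simps mult_le_cancel_left1)
  have "8 * \<delta> = 1 / (real n + 1)"
    using of_nat_0_le_iff[of n, where 'a = real] by (simp add: \<delta>_def divide_simps)
  also have "\<dots> \<le> 2 * pi / real (\<kappa> (r p))"
    using k pi_gt3 by (intro frac_le) auto
  finally show "8 * \<delta> \<le> step p" by (simp add: step_def)
qed

lemma \<delta>_bounds: "0 < \<delta>" "\<delta> \<le> 1/8" "p \<in> P \<Longrightarrow> real (r p) * \<delta> \<le> 1/8" "p \<in> P \<Longrightarrow> \<delta> \<le> 1/16"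
proof -
  show "0 < \<delta>" "\<delta> \<le> 1/8" by (auto simp: \<delta>_def divide_simps)
  assume "p \<in> P"
  then have rp: "1 \<le> real (r p)" "real (r p) \<le> real n" using r[of p] by auto
  show "real (r p) * \<delta> \<le> 1/8" using rp by (simp add: \<delta>_def divide_simps)
  show "\<delta> \<le> 1/16" using rp by (simp add: \<delta>_def divide_simps)
qed

lemma profile_bounds: "0 \<le> profile \<alpha> c" "profile \<alpha> c \<le> 1"
  by (auto simp: profile_def clamp_def)

lemma profile_gap:
  assumes "0 < \<alpha>" "\<alpha> \<le> 2 * pi"
  shows "cos (3/8 * \<alpha>) < cos (\<alpha>/4)"
  by (rule cos_monotone_0_pi) (use assms pi_gt_zero in linarith)+

lemma profile_one:
  assumes "0 < \<alpha>" "\<alpha> \<le> 2 * pi" "\<bar>x\<bar> \<le> \<alpha> / 4"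
  shows "profile \<alpha> (cos x) = 1"
proof -
  have "cos (\<alpha>/4) \<le> cos \<bar>x\<bar>"
    by (rule cos_monotone_0_pi_le) (use assms pi_gt_zero in linarith)+
  then have "cos (\<alpha>/4) - cos (3/8 * \<alpha>) \<le> cos x - cos (3/8 * \<alpha>)" by simp
  then have "1 \<le> (cos x - cos (3/8 * \<alpha>)) / (cos (\<alpha>/4) - cos (3/8 * \<alpha>))"
    using profile_gap[OF assms(1,2)] by (simp add: le_divide_eq_1_pos)
  then show ?thesis by (simp add: profile_def clamp_def)
qed

lemma profile_zero:
  assumes "0 < \<alpha>" "\<alpha> \<le> 2 * pi" "3/8 * \<alpha> \<le> x" "x \<le> 2 * pi - 3/8 * \<alpha>"
  shows "profile \<alpha> (cos x) = 0"
proof -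
  have "cos x \<le> cos (3/8 * \<alpha>)"
  proof (cases "x \<le> pi")
    case True
    show ?thesis by (rule cos_monotone_0_pi_le) (use assms True in linarith)+
  next
    case False
    have "cos (2 * pi - x) \<le> cos (3/8 * \<alpha>)"
      by (rule cos_monotone_0_pi_le) (use assms False in linarith)+
    then show ?thesis by (simp add: cos_diff)
  qed
  then have "(cos x - cos (3/8 * \<alpha>)) / (cos (\<alpha>/4) - cos (3/8 * \<alpha>)) \<le> 0"
    using profile_gap[OF assms(1,2)] by (simp add: divide_nonpos_pos)
  then show ?thesis by (simp add: profile_def clamp_def)
qed

lemma annulus_eq:
  assumes "p \<in> P" "\<bar>norm (coords y) - real (r p)\<bar> \<le> 1/4"
  shows "annulus \<rho> y = (if \<rho> = r p then 1 else 0)"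
proof (cases "\<rho> = r p")
  case False
  then have "1 \<le> \<bar>real \<rho> - real (r p)\<bar>" by linarith
  then have "3/4 \<le> \<bar>norm (coords y) - real \<rho>\<bar>" using assms(2) by linarith
  then show ?thesis using False by (simp add: annulus_def clamp_def)
qed (use assms in \<open>simp add: annulus_def clamp_def\<close>)

text \<open>This decouples the points: on its arc, even when it overshoots by an eighth of a step,
  the trajectory from \<open>p\<close> meets no bump but its own. The next bump is centred at
  \<open>3/2\<close> steps and has half-width \<open>3/8\<close> of a step, so it begins exactly at
  \<open>9/8\<close>.\<close>

lemma bump_eq:
  assumes p: "p \<in> P" and q: "q \<in> P" and y: "coords y = of_real \<rho> * cis (\<phi> p + a)"
    and \<rho>: "\<bar>\<rho> - real (r p)\<bar> \<le> 1/4" and a: "0 \<le> a" "a \<le> 9/8 * step p"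
  shows "bump q y = (if q = p then profile (step p) (cos (a - step p / 2)) else 0)"
proof -
  have "1 \<le> real (r p)" using r(1)[OF p] by simp
  then have "\<rho> > 1/2" using \<rho> by linarith
  then have ny: "norm (coords y) = \<rho>" using y by (simp add: norm_mult)
  have ann: "annulus s y = (if s = r p then 1 else 0)" for s
    using annulus_eq[OF p, of y s] \<rho> by (simp add: ny)
  have comp: "y $ i1 = \<rho> * cos (\<phi> p + a)" "y $ i2 = \<rho> * sin (\<phi> p + a)"
    using y by (simp_all add: coords_def complex_eq_iff)
  have "(y $ i1 * cos b + y $ i2 * sin b) * inverse (max (norm (coords y)) (1/2)) = cos (\<phi> p + a - b)" for b
    using \<open>\<rho> > 1/2\<close> by (simp add: ny comp cos_diff field_simps)
  then have bq: "bump q y = (if r q = r p then profile (step q) (cos (\<phi> p + a - (\<phi> q + step q / 2))) else 0)"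
    by (simp add: bump_def ann)
  show ?thesis
  proof (cases "q = p")
    case True
    have "\<phi> p + a - (\<phi> p + step p / 2) = a - step p / 2" by simp
    then show ?thesis using True bq by simp
  next
    case False
    have "profile (step q) (cos (\<phi> p + a - (\<phi> q + step q / 2))) = 0" if rq: "r q = r p"
    proof -
      have st: "step q = step p" using rq by (simp add: step_def)
      obtain m where m: "1 \<le> m" "m < \<kappa> (r p)" "cis (\<phi> q) = cis (\<phi> p + real m * step p)"
        using sep[OF p q not_sym[OF False] rq[symmetric]] unfolding step_def by blast
      \<comment> \<open>Angular distance from the current position to the centre of the bump of
        \<open>q\<close>, which lies \<open>m\<close> steps ahead;
        \<open>1 \<le> m \<le> \<kappa> (r p) - 1\<close> keeps it away from 0 and from
        \<open>2 * pi\<close>.\<close>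
      define x where "x = real m * step p + step p / 2 - a"
      have "cos (\<phi> p + a - (\<phi> q + step q / 2)) = Re (cis (\<phi> p) * cis (a - step q / 2) * cnj (cis (\<phi> q)))"
        by (simp only: cis_cnj cis_mult) (simp add: algebra_simps)
      also have "\<dots> = cos (- x)"
        unfolding m(3) st x_def by (simp only: cis_cnj cis_mult) (simp add: algebra_simps)
      finally have cx: "cos (\<phi> p + a - (\<phi> q + step q / 2)) = cos x" by simp
      have "1 * step p \<le> real m * step p"
        using m(1) step_bounds(1)[OF p] by (intro mult_right_mono) auto
      moreover have "real m * step p \<le> (real (\<kappa> (r p)) - 1) * step p"
        using m(2) step_bounds(1)[OF p] by (intro mult_right_mono) auto
      then have "real m * step p \<le> 2 * pi - step p"
        using step_bounds(4)[OF p] by (simp add: algebra_simps)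
      ultimately have "3/8 * step p \<le> x" "x \<le> 2 * pi - 3/8 * step p"
        unfolding x_def using a step_bounds(1)[OF p] by linarith+
      then show ?thesis
        unfolding cx unfolding st by (rule profile_zero[OF step_bounds(1,2)[OF p]])
    qed
    then show ?thesis using False by (simp add: bq)
  qed
qed

text \<open>In logarithmic polar coordinates the family is solved explicitly in terms of
  the time \<open>I t\<close> weighted by the bump: the displacement caused by the parameters is
  \<open>\<delta> / T * I t\<close> times the parameter vector.\<close>

lemma weighted_time:
  assumes p: "p \<in> P" and \<theta>2: "\<bar>\<theta>2\<bar> \<le> 1"
  obtains I where "I 0 = 0" "T / 4 \<le> I T" "\<And>t. 0 \<le> t \<Longrightarrow> 0 \<le> I t" "\<And>t. 0 \<le> t \<Longrightarrow> I t \<le> t"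
    "\<And>t. (I has_real_derivative
        profile (step p) (cos (step p / T * t + \<delta> / T * \<theta>2 * I t - step p / 2))) (at t)"
proof -
  \<comment> \<open>The angle obeys the scalar autonomous equation with right-hand side
    \<open>f\<close>, whatever the radial parameter is. \<open>I\<close> is afterwards the integral
    of the bump along its solution.\<close>
  define B where "B a = profile (step p) (cos (a - step p / 2))" for a
  define f where "f a = step p / T + \<delta> / T * \<theta>2 * B a" for a
  note st = step_bounds[OF p]
  have cos_lip: "1-lipschitz_on UNIV (cos :: real \<Rightarrow> real)"
  proof (rule lipschitz_onI)
    fix x y :: real
    have "norm (cos x - cos y) \<le> 1 * norm (x - y)"
      by (rule field_differentiable_bound[where f' = "\<lambda>x. - sin x" and S = UNIV])
         (auto intro!: derivative_eq_intros)
    then show "dist (cos x) (cos y) \<le> 1 * dist x y" by (simp add: dist_norm)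
  qed simp
  have "\<exists>L. L-lipschitz_on UNIV B"
  proof -
    let ?K = "1 / (cos (step p / 4) - cos (3/8 * step p))"
    have "(1 * (1 + 0))-lipschitz_on UNIV (\<lambda>a. cos (a - step p / 2))"
      by (rule lipschitz_on_compose2[OF _ lipschitz_on_subset[OF cos_lip]])
         (use lipschitz_on_add[OF lipschitz_on_id lipschitz_on_constant, of UNIV "- (step p / 2)"] in auto)
    then have "(\<bar>?K\<bar> * (1 * (1 + 0) + 0))-lipschitz_on UNIV (\<lambda>a. ?K * (cos (a - step p / 2) + - cos (3/8 * step p)))"
      by (intro lipschitz_on_cmult_real lipschitz_on_add lipschitz_on_constant)
    then have "(1 * (\<bar>?K\<bar> * (1 * (1 + 0) + 0)))-lipschitz_on UNIV
        (\<lambda>a. clamp (?K * (cos (a - step p / 2) + - cos (3/8 * step p))))"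
      unfolding clamp_def
      by (rule lipschitz_on_compose2) (rule lipschitz_on_subset[OF clamp_lipschitz], simp)
    moreover have "B = (\<lambda>a. clamp (?K * (cos (a - step p / 2) + - cos (3/8 * step p))))"
      by (simp add: B_def profile_def fun_eq_iff)
    ultimately show ?thesis by auto
  qed
  then obtain L where L: "L-lipschitz_on UNIV B" by blast
  have "(0 + \<bar>\<delta> / T * \<theta>2\<bar> * L)-lipschitz_on UNIV f"
    unfolding f_def[abs_def] by (intro lipschitz_on_add lipschitz_on_constant lipschitz_on_cmult_real L)
  then obtain a where a0: "a 0 = 0" and a': "\<And>t. (a has_vector_derivative f (a t)) (at t)"
    using lipschitz_ode_solution by blast
  have Bcont: "continuous_on UNIV (\<lambda>t. B (a t))"
    by (rule continuous_on_compose2[OF lipschitz_on_continuous_on[OF L]])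
       (auto intro: has_vector_derivative_imp_continuous_on[OF a'])
  obtain I where I0: "I 0 = 0" and I: "\<And>t. (I has_vector_derivative B (a t)) (at t)"
    using antiderivative_exists[OF Bcont] by blast
  have I': "(I has_real_derivative B (a t)) (at t)" for t
    using I by (simp add: has_real_derivative_iff_has_vector_derivative)
  have a_eq: "a t = step p / T * t + \<delta> / T * \<theta>2 * I t" for t
  proof -
    define d where "d t = a t - (step p / T * t + \<delta> / T * \<theta>2 * I t)" for t
    have "(a has_real_derivative f (a t)) (at t)" for t
      using a' by (simp add: has_real_derivative_iff_has_vector_derivative)
    then have "(d has_real_derivative 0) (at t)" for t
      unfolding d_def[abs_def] using T
      by (auto intro!: derivative_eq_intros I' simp: f_def)
    then have "d t = d 0" using DERIV_isconst_all by blast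
    then show ?thesis by (simp add: d_def a0 I0)
  qed
  have B01: "0 \<le> B s" "B s \<le> 1" for s by (auto simp: B_def profile_bounds)
  have mono: "0 \<le> I t - I s" "I t - I s \<le> t - s" if "s \<le> t" for s t
  proof -
    have "I s \<le> I t"
      by (rule DERIV_nonneg_imp_nondecreasing[OF that]) (use I' B01 in blast)
    moreover have "s - I s \<le> t - I t"
    proof (rule DERIV_nonneg_imp_nondecreasing[OF that])
      fix x
      show "\<exists>y. ((\<lambda>t. t - I t) has_real_derivative y) (at x) \<and> 0 \<le> y"
        using B01[of "a x"]
        by (intro exI[of _ "1 - B (a x)"]) (auto intro!: derivative_eq_intros I')
    qed
    ultimately show "0 \<le> I t - I s" "I t - I s \<le> t - s" by auto
  qed
  have pert: "\<bar>\<delta> / T * \<theta>2 * I t\<bar> \<le> \<delta>" if "0 \<le> t" "t \<le> T" for t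
  proof -
    have "\<bar>\<delta> / T * \<theta>2 * I t\<bar> = \<delta> / T * (\<bar>\<theta>2\<bar> * \<bar>I t\<bar>)"
      using \<delta>_bounds(1) T by (simp add: abs_mult)
    also have "\<dots> \<le> \<delta> / T * (1 * T)"
      using \<theta>2 mono[of 0 t] I0 that \<delta>_bounds(1) T by (intro mult_left_mono mult_mono) auto
    also have "\<dots> = \<delta>" using T by simp
    finally show ?thesis .
  qed
  \<comment> \<open>In the middle quarter of the time interval the unperturbed angle is within
    \<open>1/8\<close> of a step of the arc's midpoint, and the perturbation adds at most another
    \<open>1/8\<close>; within \<open>1/4\<close> of a step the bump equals 1. This quarter accounts
    for \<open>T / 4 \<le> I T\<close>.\<close>
  have mid: "B (a t) = 1" if t: "3/8 * T \<le> t" "t \<le> 5/8 * T" for t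
  proof -
    have "3/8 * step p \<le> step p / T * t" "step p / T * t \<le> 5/8 * step p"
      using t T st(1) mult_left_mono[of "3/8 * T" t "step p / T"] mult_left_mono[of t "5/8 * T" "step p / T"]
      by auto
    then have "\<bar>a t - step p / 2\<bar> \<le> step p / 4"
      using pert[of t] t T st(3) unfolding a_eq abs_le_iff by linarith
    then show ?thesis unfolding B_def by (rule profile_one[OF st(1,2)])
  qed
  have "I (3/8 * T) - 3/8 * T \<le> I (5/8 * T) - 5/8 * T"
  proof (rule DERIV_nonneg_imp_nondecreasing[where f = "\<lambda>t. I t - t"])
    fix x assume "3/8 * T \<le> x" "x \<le> 5/8 * T"
    then show "\<exists>y. ((\<lambda>t. I t - t) has_real_derivative y) (at x) \<and> 0 \<le> y"
      using mid[of x] by (intro exI[of _ "B (a x) - 1"]) (auto intro!: derivative_eq_intros I')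
  qed (use T in simp)
  then have "T / 4 \<le> I T" using mono[of "5/8 * T" T] mono[of 0 "3/8 * T"] T I0 by simp
  then show thesis
    using that[of I] I0 mono[of 0] I' by (simp add: B_def a_eq)
qed

text \<open>The trajectory is written down explicitly: with \<open>m = \<delta> / T * I T\<close>,
  its endpoint is the target turned by \<open>\<theta> (p, i2) * m\<close>, with radius multiplied
  by \<open>exp (\<theta> (p, i1) * m)\<close> and with the remaining coordinates
  \<open>\<theta> (p, k) * m\<close>. As \<open>m\<close> is bounded below, each gauge has the sign
  of its own parameter on the faces of the cube.\<close>

lemma robust_circle: "robust T P \<sigma> (\<lambda>p. plane (centre p))"
proof -
  define R where "R = real CARD('n) * (real n + 1)"
  \<comment> \<open>The margin comes from \<open>m \<ge> \<delta> / 4\<close> and the weakest of the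
    gauges, the angular one, which is at least \<open>m / 4\<close>.\<close>
  have "robust_family T P \<sigma> (\<lambda>p. plane (centre p)) rotation kick gauge R (\<delta> / 16)"
    unfolding robust_family_def
  proof (intro conjI ballI allI impI)
    fix \<theta> :: "'p \<times> 'n \<Rightarrow> real" and p
    assume cube: "\<forall>j. \<theta> j \<in> {-1..1}" and p: "p \<in> P"
    have \<theta>: "\<bar>\<theta> j\<bar> \<le> 1" for j using cube[rule_format, of j] by (simp add: abs_le_iff)
    note st = step_bounds[OF p] and \<delta> = \<delta>_bounds(1,2) \<delta>_bounds(3,4)[OF p]
    have rp: "1 \<le> real (r p)" "real (r p) \<le> real n" using r[OF p] by auto
    obtain I where I0: "I 0 = 0" and IT: "T / 4 \<le> I T" and I_ge: "\<And>t. 0 \<le> t \<Longrightarrow> 0 \<le> I t"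
      and I_le: "\<And>t. 0 \<le> t \<Longrightarrow> I t \<le> t"
      and I': "\<And>t. (I has_real_derivative
        profile (step p) (cos (step p / T * t + \<delta> / T * \<theta> (p, i2) * I t - step p / 2))) (at t)"
      using weighted_time[OF p \<theta>[of "(p, i2)"]] by blast
    define a where "a t = step p / T * t + \<delta> / T * \<theta> (p, i2) * I t" for t
    define B where "B t = profile (step p) (cos (a t - step p / 2))" for t
    define lam where "lam t = \<delta> / T * \<theta> (p, i1) * I t" for t
    define w where "w t = of_real (lam t) + \<i> * of_real (\<phi> p + a t)" for t
    define \<zeta> where "\<zeta> t = of_real (real (r p)) * exp (w t)" for t
    define u where "u t = plane (\<zeta> t) + (\<Sum>k\<in>-{i1, i2}. (\<delta> / T * \<theta> (p, k) * I t) *\<^sub>R axis k 1)" for t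
    have I'': "(I has_real_derivative B t) (at t)" for t using I' by (simp add: B_def a_def)
    have \<zeta>_polar: "\<zeta> t = of_real (real (r p) * exp (lam t)) * cis (\<phi> p + a t)" for t
      by (simp add: \<zeta>_def w_def exp_add cis_conv_exp exp_of_real)
    have kick_small: "\<bar>\<delta> / T * \<theta> j * I t\<bar> \<le> \<delta>" if "0 \<le> t" "t \<le> T" for j t
    proof -
      have "\<bar>\<delta> / T * \<theta> j * I t\<bar> = \<delta> / T * (\<bar>\<theta> j\<bar> * I t)"
        using \<delta>(1) T I_ge[OF that(1)] by (simp add: abs_mult)
      also have "\<dots> \<le> \<delta> / T * (1 * T)"
        using \<theta>[of j] I_ge[OF that(1)] I_le[OF that(1)] that \<delta>(1) T by (intro mult_left_mono mult_mono) auto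
      also have "\<dots> = \<delta>" using T by simp
      finally show ?thesis .
    qed
    have lam_small: "\<bar>lam t\<bar> \<le> \<delta>" if "0 \<le> t" "t \<le> T" for t using kick_small[OF that] by (simp add: lam_def)
    \<comment> \<open>The tolerance \<open>1/4\<close> is the half-width of the plateau of
      \<open>annulus\<close>, so the speed of rotation is unaffected by the radial kicks.\<close>
    have radius: "\<bar>real (r p) * exp (lam t) - real (r p)\<bar> \<le> 1/4" if t: "0 \<le> t" "t \<le> T" for t
    proof -
      have "\<bar>exp (lam t) - 1\<bar> \<le> 2 * \<bar>lam t\<bar>"
        using exp_bound_lemma[of "lam t"] lam_small[OF t] \<delta> by (auto simp: abs_le_iff) (smt (verit) exp_ge_add_one_self)+
      then have "real (r p) * \<bar>exp (lam t) - 1\<bar> \<le> real (r p) * (2 * \<delta>)"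
        using lam_small[OF t] by (intro mult_left_mono) auto
      then have "real (r p) * \<bar>exp (lam t) - 1\<bar> \<le> 1/4" using \<delta>(3) by simp
      moreover have "real (r p) * \<bar>exp (lam t) - 1\<bar> = \<bar>real (r p) * exp (lam t) - real (r p)\<bar>"
        by (simp add: abs_mult[symmetric, of "real (r p)", simplified] algebra_simps)
      ultimately show ?thesis by simp
    qed
    have coords_axis: "coords (\<Sum>k\<in>-{i1, i2}. g k *\<^sub>R axis k 1) = 0" for g
    proof -
      have "(\<Sum>k\<in>-{i1, i2}. g k *\<^sub>R axis k 1 :: real^'n) $ i = 0" if "i \<in> {i1, i2}" for i
        using that by (auto simp: axis_def intro!: sum.neutral split: if_splits)
      then show ?thesis by (simp add: coords_def complex_eq_iff)
    qed
    have coords_u: "coords (u t) = \<zeta> t" for t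
      using linear_add[OF bounded_linear.linear[OF coords_linear]] coords_axis
      unfolding u_def by simp
    have u_comp: "u t $ k = \<delta> / T * \<theta> (p, k) * I t" if "k \<noteq> i1" "k \<noteq> i2" for t k
      using that by (simp add: u_def axis_def if_distrib sum.delta cong: if_cong)
    \<comment> \<open>The kick changes the angular speed by at most
      \<open>\<delta> / T \<le> step p / T\<close>, so the angle never falls behind its start; in
      total it advances the angle by at most \<open>\<delta> \<le> step p / 8\<close> beyond one
      step.\<close>
    have a_range: "0 \<le> a t" "a t \<le> 9/8 * step p" if t: "0 \<le> t" "t \<le> T" for t
    proof -
      have k: "\<bar>\<delta> / T * \<theta> (p, i2) * I t\<bar> \<le> \<delta> / T * t"
      proof -
        have "\<bar>\<delta> / T * \<theta> (p, i2) * I t\<bar> = \<delta> / T * (\<bar>\<theta> (p, i2)\<bar> * I t)"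
          using \<delta>(1) T I_ge[OF t(1)] by (simp add: abs_mult)
        also have "\<dots> \<le> \<delta> / T * (1 * t)"
          using \<theta>[of "(p, i2)"] I_ge[OF t(1)] I_le[OF t(1)] \<delta>(1) T t by (intro mult_left_mono mult_mono) auto
        finally show ?thesis by simp
      qed
      have "\<delta> / T * t \<le> step p / T * t"
        using st(3) \<delta>(1) T t by (intro mult_right_mono divide_right_mono) auto
      then show "0 \<le> a t" using k unfolding a_def by linarith
      have "step p / T * t \<le> step p / T * T" using st(1) T t by (intro mult_left_mono) auto
      then have "step p / T * t \<le> step p" using T by simp
      moreover have "x + y \<le> 9/8 * s" if "x \<le> s" "y \<le> \<delta>" "8 * \<delta> \<le> s" for x y s :: real
        using that by linarith
      ultimately show "a t \<le> 9/8 * step p"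
        using abs_le_D1[OF kick_small[OF t, of "(p, i2)"]] st(3) unfolding a_def by blast
    qed
    \<comment> \<open>Along this curve the rotation has constant speed and the sum over all points
      collapses to the terms of \<open>p\<close>, so the parameters of other points drop
      out.\<close>
    have field: "rotation (u t) + (\<Sum>j\<in>P \<times> UNIV. \<theta> j *\<^sub>R kick j (u t)) =
        (step p / T) *\<^sub>R plane (\<i> * \<zeta> t) + (\<Sum>k\<in>UNIV. (\<theta> (p, k) * (\<delta> / T * B t)) *\<^sub>R dir k (u t))"
      if t: "0 \<le> t" "t \<le> T" for t
    proof -
      have cu: "coords (u t) = of_real (real (r p) * exp (lam t)) * cis (\<phi> p + a t)"
        by (simp only: coords_u \<zeta>_polar)
      have ann: "annulus \<rho> (u t) = (if \<rho> = r p then 1 else 0)" for \<rho>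
        by (rule annulus_eq[OF p]) (use radius[OF t] in \<open>simp add: cu norm_mult\<close>)
      have "(\<Sum>\<rho>\<in>r ` P. annulus \<rho> (u t) * (2 * pi / (T * real (\<kappa> \<rho>))))
          = (\<Sum>\<rho>\<in>r ` P. if \<rho> = r p then 2 * pi / (T * real (\<kappa> \<rho>)) else 0)"
        by (intro sum.cong) (auto simp: ann)
      also have "\<dots> = step p / T" using finP p by (simp add: sum.delta step_def)
      finally have "rotation (u t) = (step p / T) *\<^sub>R plane (\<i> * \<zeta> t)"
        by (simp only: rotation_def coords_u)
      moreover have "bump q (u t) = (if q = p then B t else 0)" if "q \<in> P" for q
        unfolding B_def by (rule bump_eq[OF p that cu radius[OF t] a_range[OF t]])
      then have "(\<Sum>j\<in>P \<times> UNIV. \<theta> j *\<^sub>R kick j (u t)) =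
          (\<Sum>q\<in>P. if q = p then \<Sum>k\<in>UNIV. (\<theta> (p, k) * (\<delta> / T * B t)) *\<^sub>R dir k (u t) else 0)"
        unfolding sum.cartesian_product'
        by (intro sum.cong) (auto simp: kick_def)
      ultimately show ?thesis using finP p by (simp add: sum.delta)
    qed
    have dir_sum: "(\<Sum>k\<in>UNIV. g k *\<^sub>R dir k (u t)) = g i1 *\<^sub>R plane (\<zeta> t) + g i2 *\<^sub>R plane (\<i> * \<zeta> t)
        + (\<Sum>k\<in>-{i1, i2}. g k *\<^sub>R axis k 1)" for g t
    proof -
      have "(\<Sum>k\<in>UNIV. g k *\<^sub>R dir k (u t)) = (\<Sum>k\<in>{i1, i2}. g k *\<^sub>R dir k (u t)) + (\<Sum>k\<in>-{i1, i2}. g k *\<^sub>R dir k (u t))"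
        by (subst sum.union_disjoint[symmetric]) auto
      also have "(\<Sum>k\<in>-{i1, i2}. g k *\<^sub>R dir k (u t)) = (\<Sum>k\<in>-{i1, i2}. g k *\<^sub>R axis k 1)"
        by (intro sum.cong) (auto simp: dir_def)
      finally show ?thesis using i12 by (simp add: dir_def coords_u)
    qed
    have deriv: "(u has_vector_derivative (rotation (u t) + (\<Sum>j\<in>P \<times> UNIV. \<theta> j *\<^sub>R kick j (u t)))) (at t)"
      if t: "0 \<le> t" "t \<le> T" for t
    proof -
      define w' where "w' = of_real (\<delta> / T * \<theta> (p, i1) * B t) + \<i> * of_real (step p / T + \<delta> / T * \<theta> (p, i2) * B t)"
      have "(lam has_real_derivative \<delta> / T * \<theta> (p, i1) * B t) (at t)"
        unfolding lam_def[abs_def] by (rule DERIV_cmult[OF I''])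
      moreover have "((\<lambda>t. \<phi> p + a t) has_real_derivative step p / T + \<delta> / T * \<theta> (p, i2) * B t) (at t)"
        unfolding a_def using T by (auto intro!: derivative_eq_intros I'')
      ultimately have "(w has_vector_derivative w') (at t)"
        unfolding w_def[abs_def] w'_def
        by (intro has_vector_derivative_add has_vector_derivative_of_real
            bounded_linear.has_vector_derivative[OF bounded_linear_mult_right]) auto
      from field_vector_diff_chain_at[OF this DERIV_exp]
      have "((\<lambda>t. exp (w t)) has_vector_derivative w' * exp (w t)) (at t)" by (simp add: o_def)
      then have "(\<zeta> has_vector_derivative of_real (real (r p)) * (w' * exp (w t))) (at t)"
        unfolding \<zeta>_def[abs_def]
        by (rule bounded_linear.has_vector_derivative[OF bounded_linear_mult_right])
      then have "(\<zeta> has_vector_derivative w' * \<zeta> t) (at t)" by (simp add: \<zeta>_def ac_simps)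
      then have "((\<lambda>t. plane (\<zeta> t)) has_vector_derivative plane (w' * \<zeta> t)) (at t)"
        by (rule bounded_linear.has_vector_derivative[OF plane_linear])
      moreover have "((\<lambda>t. \<Sum>k\<in>-{i1, i2}. (\<delta> / T * \<theta> (p, k) * I t) *\<^sub>R axis k 1) has_vector_derivative
          (\<Sum>k\<in>-{i1, i2}. (\<delta> / T * \<theta> (p, k) * B t) *\<^sub>R axis k 1 :: real^'n)) (at t)"
      proof (intro has_vector_derivative_sum bounded_linear.has_vector_derivative[OF bounded_linear_scaleR_left])
        show "((\<lambda>t. \<delta> / T * \<theta> (p, k) * I t) has_vector_derivative \<delta> / T * \<theta> (p, k) * B t) (at t)" for k
          using DERIV_cmult[OF I''] by (simp only: has_real_derivative_iff_has_vector_derivative)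
      qed
      ultimately have "(u has_vector_derivative plane (w' * \<zeta> t) +
          (\<Sum>k\<in>-{i1, i2}. (\<delta> / T * \<theta> (p, k) * B t) *\<^sub>R axis k 1)) (at t)"
        unfolding u_def[abs_def] by (rule has_vector_derivative_add)
      moreover have "w' * \<zeta> t = (\<delta> / T * \<theta> (p, i1) * B t) *\<^sub>R \<zeta> t
          + (step p / T + \<delta> / T * \<theta> (p, i2) * B t) *\<^sub>R (\<i> * \<zeta> t)"
        unfolding w'_def scaleR_conv_of_real by (simp only: distrib_right mult.assoc mult.left_commute)
      ultimately show ?thesis
        unfolding field[OF t] dir_sum
        using linear_add[OF bounded_linear.linear[OF plane_linear]]
          linear_scale[OF bounded_linear.linear[OF plane_linear]]
        by (simp add: scaleR_add_left ac_simps)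
    qed
    have bounded: "norm (u t) \<le> R" if t: "0 \<le> t" "t \<le> T" for t
    proof -
      have n\<zeta>: "norm (\<zeta> t) \<le> real n + 1"
      proof -
        have "norm (\<zeta> t) = real (r p) * exp (lam t)" by (simp add: \<zeta>_polar norm_mult)
        then show ?thesis using abs_le_D1[OF radius[OF t]] rp(2) by linarith
      qed
      have "\<bar>u t $ k\<bar> \<le> real n + 1" for k
      proof -
        consider "k = i1" | "k = i2" | "k \<noteq> i1" "k \<noteq> i2" by blast
        then show ?thesis
        proof cases
          case 1
          have "u t $ k = Re (coords (u t))" using 1 by (simp add: coords_def)
          then show ?thesis using n\<zeta> abs_Re_le_cmod[of "\<zeta> t"] by (simp add: coords_u)
        next
          case 2
          have "u t $ k = Im (coords (u t))" using 2 by (simp add: coords_def)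
          then show ?thesis using n\<zeta> abs_Im_le_cmod[of "\<zeta> t"] by (simp add: coords_u)
        next
          case 3
          then show ?thesis using kick_small[OF t, of "(p, k)"] \<delta> by (simp add: u_comp)
        qed
      qed
      then have "(\<Sum>k\<in>UNIV. \<bar>u t $ k\<bar>) \<le> R" unfolding R_def by (intro sum_bounded_above) blast
      then show ?thesis using norm_le_l1_cart[of "u t"] by linarith
    qed
    define m where "m = \<delta> / T * I T"
    have m: "\<delta> / 4 \<le> m" "m \<le> \<delta>" "0 \<le> m" "m \<le> 1/16"
    proof -
      have "\<delta> / T * (T / 4) \<le> m" "m \<le> \<delta> / T * T"
        unfolding m_def using IT I_le[of T] \<delta>(1) T by (intro mult_left_mono; simp)+
      then show "\<delta> / 4 \<le> m" "m \<le> \<delta>" "0 \<le> m" "m \<le> 1/16" using \<delta> T by auto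
    qed
    \<comment> \<open>By time \<open>T\<close> the rotation has contributed exactly one step, which
      the conjugate of the target removes; only the kicks remain.\<close>
    have end_polar: "coords (u T) * cnj (centre (\<sigma> p)) =
        of_real ((real (r p))\<^sup>2 * exp (\<theta> (p, i1) * m)) * cis (\<theta> (p, i2) * m)"
    proof -
      have "a T = step p + \<theta> (p, i2) * m" using T by (simp add: a_def m_def)
      moreover have "lam T = \<theta> (p, i1) * m" by (simp add: lam_def m_def)
      moreover have "centre (\<sigma> p) = of_real (real (r p)) * cis (\<phi> p + step p)"
        using \<sigma>[OF p] by (simp add: centre_def step_def)
      moreover have "cis (\<phi> p + (step p + \<theta> (p, i2) * m)) * cnj (cis (\<phi> p + step p)) = cis (\<theta> (p, i2) * m)"
        by (simp add: cis_cnj cis_mult)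
      ultimately show ?thesis
        unfolding coords_u \<zeta>_polar
        by (simp add: power2_eq_square mult.assoc mult.left_commute)
    qed
    have r2: "1 \<le> (real (r p))\<^sup>2" using rp(1) by simp
    have gauge_end: "(\<theta> (p, k) = 1 \<longrightarrow> \<delta> / 16 \<le> gauge p k (u T)) \<and>
        (\<theta> (p, k) = -1 \<longrightarrow> gauge p k (u T) \<le> - (\<delta> / 16))" for k
    proof -
      consider "k = i1" | "k = i2" | "k \<noteq> i1" "k \<noteq> i2" by blast
      then show ?thesis
      proof cases
        case 1
        define b where "b = \<theta> (p, i2) * m"
        have b: "\<bar>b\<bar> \<le> m" using \<theta>[of "(p, i2)"] m(3) by (simp add: b_def abs_mult mult_left_le_one_le)
        have g: "gauge p k (u T) = (real (r p))\<^sup>2 * (exp (\<theta> (p, k) * m) * cos b - 1)"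
          using 1 by (simp add: gauge_def end_polar b_def algebra_simps)
        note pd = polar_displacement[OF m(3,4) b]
        have "1 * (m / 2) \<le> (real (r p))\<^sup>2 * (exp m * cos b - 1)"
          using r2 pd(1) m by (intro mult_mono) auto
        moreover have "1 * (m / 2) \<le> (real (r p))\<^sup>2 * - (exp (- m) * cos b - 1)"
          using r2 pd(2) m by (intro mult_mono) auto
        then have "(real (r p))\<^sup>2 * (exp (- m) * cos b - 1) \<le> - (m / 2)"
          by (simp only: mult_minus_right)
        ultimately show ?thesis using m(1) \<delta>(1) by (auto simp: g)
      next
        case 2
        define l where "l = \<theta> (p, i1) * m"
        have "\<bar>l\<bar> \<le> m" using \<theta>[of "(p, i1)"] m(3) by (simp add: l_def abs_mult mult_left_le_one_le)
        then have "1/2 \<le> exp l" using exp_ge_add_one_self[of l] m(4) by linarith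
        then have "1 * (1/2) \<le> (real (r p))\<^sup>2 * exp l" using r2 by (intro mult_mono) auto
        moreover have "m / 2 \<le> sin m" using sin_ge_half[of m] m by simp
        ultimately have "1/2 * (m / 2) \<le> (real (r p))\<^sup>2 * exp l * sin m"
          using m(3) by (intro mult_mono) auto
        moreover have "gauge p k (u T) = (real (r p))\<^sup>2 * exp l * sin (\<theta> (p, k) * m)"
          using 2 i12 by (simp add: gauge_def end_polar l_def)
        ultimately show ?thesis using m(1) by auto
      next
        case 3
        then have "gauge p k (u T) = \<theta> (p, k) * m" by (simp add: gauge_def u_comp m_def)
        then show ?thesis using m(1) \<delta>(1) by auto
      qed
    qed
    show "\<exists>u. u 0 = plane (centre p) \<and>
        (\<forall>t\<in>{0..T}. norm (u t) \<le> R \<and>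
          (u has_vector_derivative (rotation (u t) + (\<Sum>j\<in>P \<times> UNIV. \<theta> j *\<^sub>R kick j (u t))))
            (at t within {0..T})) \<and>
        (\<forall>k. (\<theta> (p, k) = 1 \<longrightarrow> \<delta> / 16 \<le> gauge p k (u T)) \<and>
          (\<theta> (p, k) = -1 \<longrightarrow> gauge p k (u T) \<le> - (\<delta> / 16)))"
    proof (intro exI[of _ u] conjI ballI)
      show "u 0 = plane (centre p)"
        by (simp add: u_def \<zeta>_polar lam_def a_def I0 centre_def)
      show "\<forall>k. (\<theta> (p, k) = 1 \<longrightarrow> \<delta> / 16 \<le> gauge p k (u T)) \<and>
          (\<theta> (p, k) = -1 \<longrightarrow> gauge p k (u T) \<le> - (\<delta> / 16))"
        using gauge_end by blast
      fix t assume "t \<in> {0..T}"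
      then have t: "0 \<le> t" "t \<le> T" by auto
      show "norm (u t) \<le> R" by (rule bounded[OF t])
      show "(u has_vector_derivative (rotation (u t) + (\<Sum>j\<in>P \<times> UNIV. \<theta> j *\<^sub>R kick j (u t))))
          (at t within {0..T})"
        by (rule has_vector_derivative_at_within[OF deriv[OF t]])
    qed
  qed (use \<delta>_bounds(1) in \<open>auto intro: lob_rotation lob_kick continuous_gauge gauge_zero\<close>)
  then show ?thesis unfolding robust_def by blast
qed

end

section \<open>Permutations and the main theorem\<close>

text \<open>Coinciding centres would share the midpoint of their arcs. Seen from \<open>p\<close>
  the bump of \<open>q\<close> vanishes at this midpoint, while seen from \<open>q\<close> it equals
  1.\<close>

lemma (in circle_config) inj_on_centre: "inj_on (\<lambda>p. plane (centre p)) P"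
proof (rule inj_onI, rule ccontr)
  fix p q assume pq: "p \<in> P" "q \<in> P" "plane (centre p) = plane (centre q)" "p \<noteq> q"
  then have eq: "centre p = centre q" by (metis coords_plane)
  then have "norm (centre p) = norm (centre q)" by simp
  then have rpq: "r p = r q" by (simp add: centre_def norm_mult)
  then have st: "step p = step q" by (simp add: step_def)
  define y where "y = plane (of_real (real (r p)) * cis (\<phi> p + step p / 2))"
  have yp: "coords y = of_real (real (r p)) * cis (\<phi> p + step p / 2)" by (simp add: y_def)
  also have "\<dots> = centre p * cis (step p / 2)" by (simp add: centre_def cis_mult mult.assoc)
  also have "\<dots> = of_real (real (r q)) * cis (\<phi> q + step q / 2)"
    unfolding eq st by (simp add: centre_def cis_mult mult.assoc)
  finally have yq: "coords y = of_real (real (r q)) * cis (\<phi> q + step q / 2)" .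
  have "bump q y = 0"
    using bump_eq[OF pq(1,2) yp] pq(4) step_bounds(1)[OF pq(1)] by simp
  moreover have "bump q y = profile (step q) (cos 0)"
    using bump_eq[OF pq(2,2) yq] step_bounds(1)[OF pq(2)] by simp
  ultimately show False
    using profile_one[OF step_bounds(1,2)[OF pq(2)], of 0] step_bounds(1)[OF pq(2)] by simp
qed

section \<open>Cycles of a permutation as regular polygons\<close>

lemma cis_eq_if_mod_eq:
  assumes "i mod k = j mod k" "k > 0"
  shows "cis (real i * (2 * pi / real k)) = cis (real j * (2 * pi / real k))"
proof -
  have "cis (real i * (2 * pi / real k)) = cis (real (i mod k) * (2 * pi / real k))" for i
  proof -
    have "real i = real (i div k) * real k + real (i mod k)"
      by (metis div_mult_mod_eq of_nat_add of_nat_mult)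
    then have "real i * (2 * pi / real k) = 2 * pi * real (i div k) + real (i mod k) * (2 * pi / real k)"
      using \<open>k > 0\<close> by (simp add: field_simps)
    then have "cis (real i * (2 * pi / real k))
        = cis (2 * pi * real (i div k)) * cis (real (i mod k) * (2 * pi / real k))"
      by (simp only: cis_mult)
    moreover have "cis (2 * pi * real (i div k)) = 1" by (simp add: cis_multiple_2pi)
    ultimately show ?thesis by simp
  qed
  then show ?thesis using assms(1) by metis
qed

lemma card_orbit_period:
  assumes "permutation \<sigma>"
  shows "(\<sigma> ^^ card (orbit \<sigma> b)) b = b" "card (orbit \<sigma> b) > 0"
    and "(\<sigma> ^^ i) b = (\<sigma> ^^ j) b \<longleftrightarrow> i mod card (orbit \<sigma> b) = j mod card (orbit \<sigma> b)"
proof -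
  let ?k = "funpow_dist1 \<sigma> b b"
  have b: "b \<in> orbit \<sigma> b" by (rule permutation_self_in_orbit[OF assms])
  note inj = inj_on_funpow_dist1[OF b]
  have k: "card (orbit \<sigma> b) = ?k"
    using card_image[OF inj] orbit_conv_funpow_dist1[OF b] by simp
  have per: "(\<sigma> ^^ ?k) b = b" by (rule funpow_dist1_prop[OF b])
  show "(\<sigma> ^^ card (orbit \<sigma> b)) b = b" unfolding k by (rule per)
  show "card (orbit \<sigma> b) > 0" unfolding k by simp
  have mod: "(\<sigma> ^^ i) b = (\<sigma> ^^ (i mod ?k)) b" for i
    by (rule funpow_mod_eq[OF per, symmetric])
  have "(\<sigma> ^^ (i mod ?k)) b = (\<sigma> ^^ (j mod ?k)) b \<longleftrightarrow> i mod ?k = j mod ?k"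
    using inj_on_eq_iff[OF inj, of "i mod ?k" "j mod ?k"] by simp
  then show "(\<sigma> ^^ i) b = (\<sigma> ^^ j) b \<longleftrightarrow> i mod card (orbit \<sigma> b) = j mod card (orbit \<sigma> b)"
    unfolding k mod[of i] mod[of j] .
qed

text \<open>Each cycle gets its own circle, whose radius is the number of the cycle in an
  enumeration. The angle of a point counts the applications of \<open>\<sigma>\<close> that lead to
  it from a base point; the count matters only modulo the length of the cycle, hence the comparison
  through \<open>cis\<close>. A fixed point has \<open>\<kappa> = 1\<close> and its step is a full
  turn.\<close>

lemma permutation_circle_config:
  fixes i1 i2 :: "'n::finite"
  assumes "\<sigma> permutes P" "finite P" "i1 \<noteq> i2" "T > 0"
  obtains r \<kappa> \<phi> where "circle_config i1 i2 T (card P) P \<sigma> r \<kappa> \<phi>"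
proof -
  have perm: "permutation \<sigma>" using assms(1,2) by (auto simp: permutation_permutes)
  let ?O = "orbit \<sigma> ` P"
  have eq: "orbit \<sigma> q = orbit \<sigma> p" if "q \<in> orbit \<sigma> p" for p q
    using orbit_cyclic_eq3[OF cyclic_on_orbit'[OF perm] that] .
  have self: "p \<in> orbit \<sigma> p" for p by (rule permutation_self_in_orbit[OF perm])
  have sub: "orbit \<sigma> p \<subseteq> P" if "p \<in> P" for p by (rule permutes_orbit_subset[OF assms(1) that])
  obtain f where f: "bij_betw f ?O {1..card ?O}"
    using ex_bij_betw_finite_nat[of ?O] assms(2) ex_bij_betw_nat_finite_1[of ?O]
    by (meson bij_betw_inv finite_imageI)
  define r where "r p = f (orbit \<sigma> p)" for p
  have r_eq: "r p = r q \<longleftrightarrow> orbit \<sigma> p = orbit \<sigma> q" if "p \<in> P" "q \<in> P" for p q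
    using f that unfolding r_def bij_betw_def by (metis imageI inj_on_eq_iff)
  define \<kappa> where "\<kappa> \<rho> = card {q \<in> P. r q = \<rho>}" for \<rho>
  have \<kappa>: "\<kappa> (r p) = card (orbit \<sigma> p)" if "p \<in> P" for p
  proof -
    have "{q \<in> P. r q = r p} = orbit \<sigma> p"
    proof (intro set_eqI iffI)
      fix q assume "q \<in> {q \<in> P. r q = r p}"
      then show "q \<in> orbit \<sigma> p" using r_eq[of q p] that self[of q] by auto
    next
      fix q assume "q \<in> orbit \<sigma> p"
      then show "q \<in> {q \<in> P. r q = r p}" using sub[OF that] eq[of q p] by (auto simp: r_def)
    qed
    then show ?thesis by (simp add: \<kappa>_def)
  qed
  \<comment> \<open>The choice is made from the orbit as a set, so all points of a cycle share one
    base point.\<close>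
  define base where "base p = (SOME b. b \<in> orbit \<sigma> p)" for p
  have base: "base p \<in> orbit \<sigma> p" for p unfolding base_def by (rule someI, rule self)
  have "\<exists>d. (\<sigma> ^^ d) (base p) = p" for p
  proof -
    have "p \<in> orbit \<sigma> (base p)" using self[of p] eq[OF base[of p]] by blast
    then show ?thesis unfolding orbit_altdef_permutation[OF perm] by (auto simp: eq_commute)
  qed
  then obtain d where d: "\<And>p. (\<sigma> ^^ d p) (base p) = p" by metis
  define \<phi> where "\<phi> p = real (d p) * (2 * pi / real (\<kappa> (r p)))" for p
  have period: "(\<sigma> ^^ i) (base p) = (\<sigma> ^^ j) (base p) \<longleftrightarrow> i mod \<kappa> (r p) = j mod \<kappa> (r p)"
    if "p \<in> P" for i j p
    using card_orbit_period(3)[OF perm, of i "base p" j] eq[OF base[of p]] \<kappa>[OF that] by simp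
  have \<kappa>_pos: "\<kappa> (r p) > 0" if "p \<in> P" for p
    using card_orbit_period(2)[OF perm] \<kappa>[OF that] by simp
  have base_eq: "base q = base p" if "orbit \<sigma> q = orbit \<sigma> p" for p q
    using that by (simp add: base_def)
  have "circle_config i1 i2 T (card P) P \<sigma> r \<kappa> \<phi>"
  proof
    fix p assume p: "p \<in> P"
    have "f (orbit \<sigma> p) \<in> {1..card ?O}" using f p unfolding bij_betw_def by blast
    then show "1 \<le> r p" "r p \<le> card P"
      using card_image_le[OF assms(2), of "orbit \<sigma>"] by (auto simp: r_def)
    show "1 \<le> \<kappa> (r p)" using \<kappa>_pos[OF p] by simp
    show "\<kappa> (r p) \<le> card P" unfolding \<kappa>_def by (rule card_mono) (use assms in auto)
    have orb: "orbit \<sigma> (\<sigma> p) = orbit \<sigma> p" by (rule permutation_orbit_step[OF perm])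
    then show rs: "r (\<sigma> p) = r p" by (simp add: r_def)
    have "(\<sigma> ^^ Suc (d p)) (base p) = (\<sigma> ^^ d (\<sigma> p)) (base p)"
      using d[of p] d[of "\<sigma> p"] base_eq[OF orb] by simp
    then have "Suc (d p) mod \<kappa> (r p) = d (\<sigma> p) mod \<kappa> (r p)" by (simp only: period[OF p])
    from cis_eq_if_mod_eq[OF this \<kappa>_pos[OF p]]
    show "cis (\<phi> (\<sigma> p)) = cis (\<phi> p + 2 * pi / real (\<kappa> (r p)))"
      by (simp add: \<phi>_def rs algebra_simps add_divide_distrib)
    fix q assume q: "q \<in> P" "p \<noteq> q" "r p = r q"
    let ?k = "\<kappa> (r p)"
    \<comment> \<open>The residue of \<open>d q - d p\<close>; adding \<open>?k\<close> first keeps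
      the subtraction within the natural numbers.\<close>
    define m where "m = (d q + (?k - d p mod ?k)) mod ?k"
    have "orbit \<sigma> p = orbit \<sigma> q" using q(3) unfolding r_eq[OF p q(1)] .
    from base_eq[OF this[symmetric]] have bq: "base q = base p" .
    have "d p + (d q + (?k - d p mod ?k)) = d q + ?k * (d p div ?k + 1)"
    proof -
      have "?k * (d p div ?k + 1) = ?k * (d p div ?k) + ?k" by simp
      then show ?thesis
        using mult_div_mod_eq[of ?k "d p"] mod_less_divisor[OF \<kappa>_pos[OF p], of "d p"] by linarith
    qed
    then have pm: "(d p + m) mod ?k = d q mod ?k"
      unfolding m_def by (metis mod_add_right_eq mod_mult_self2)
    have "m \<noteq> 0"
    proof
      assume "m = 0"
      then have "d p mod ?k = d q mod ?k" using pm by simp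
      then have "(\<sigma> ^^ d p) (base p) = (\<sigma> ^^ d q) (base p)" by (simp only: period[OF p])
      then show False using d[of p] d[of q] bq q(2) by simp
    qed
    moreover have "m < ?k" unfolding m_def using \<kappa>_pos[OF p] by simp
    moreover have "cis (\<phi> q) = cis (\<phi> p + real m * (2 * pi / real ?k))"
      using cis_eq_if_mod_eq[OF pm \<kappa>_pos[OF p]] q(3) by (simp add: \<phi>_def distrib_right add_divide_distrib)
    ultimately show "\<exists>m. 1 \<le> m \<and> m < ?k \<and> cis (\<phi> q) = cis (\<phi> p + real m * (2 * pi / real ?k))"
      by (intro exI[of _ m]) auto
  qed (use assms in auto)
  then show thesis by (rule that)
qed

text \<open>The set of inputs and the set of targets have the same cardinality, hence so have their
  complements in the union; any bijection \<open>h\<close> between the complements completes the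
  injection.\<close>

lemma partial_injection_extends:
  assumes "finite I" "inj_on x I" "inj_on y I"
  obtains \<sigma> where "\<sigma> permutes (x ` I \<union> y ` I)" "\<And>i. i \<in> I \<Longrightarrow> \<sigma> (x i) = y i"
proof -
  define P where "P = x ` I \<union> y ` I"
  have fin: "finite P" using assms(1) by (simp add: P_def)
  have "card (P - x ` I) = card (P - y ` I)"
    using assms by (simp add: P_def card_Diff_subset card_image)
  then obtain h where h: "bij_betw h (P - x ` I) (P - y ` I)"
    using fin by (metis finite_Diff finite_same_card_bij)
  define g where "g = y \<circ> the_inv_into I x"
  have g: "bij_betw g (x ` I) (y ` I)"
    unfolding g_def
    using bij_betw_trans[OF bij_betw_the_inv_into[of x I "x ` I"], of y "y ` I"] assms
    by (simp add: bij_betw_def)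
  define \<sigma> where "\<sigma> p = (if p \<in> x ` I then g p else if p \<in> P then h p else p)" for p
  have "bij_betw \<sigma> (x ` I) (y ` I)"
    using g by (rule bij_betw_cong[THEN iffD1, rotated]) (simp add: \<sigma>_def)
  moreover have "bij_betw \<sigma> (P - x ` I) (P - y ` I)"
    using h by (rule bij_betw_cong[THEN iffD1, rotated]) (simp add: \<sigma>_def)
  ultimately have "bij_betw \<sigma> (x ` I \<union> (P - x ` I)) (y ` I \<union> (P - y ` I))"
    by (rule bij_betw_combine) auto
  moreover have "x ` I \<union> (P - x ` I) = P" "y ` I \<union> (P - y ` I) = P" by (auto simp: P_def)
  ultimately have "\<sigma> permutes P"
    using bij_imp_permutes[of \<sigma> P] by (simp add: \<sigma>_def P_def)
  moreover have "\<sigma> (x i) = y i" if "i \<in> I" for i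
    using that assms(2) by (simp add: \<sigma>_def g_def the_inv_into_f_f)
  ultimately show thesis using that by (simp add: P_def)
qed

theorem shallow_relu_property_P0:
  assumes "CARD('n::finite) \<ge> 2" "T > 0"
  shows "property_P0 (shallow_relu_fields :: (real^'n \<Rightarrow> real^'n) set) T"
  unfolding property_P0_def
proof (intro allI impI)
  fix M :: nat and x y :: "nat \<Rightarrow> real^'n"
  assume "inj_on x {1..M} \<and> inj_on y {1..M}"
  then obtain \<sigma> where perm: "\<sigma> permutes (x ` {1..M} \<union> y ` {1..M})" and xy: "\<And>i. i \<in> {1..M} \<Longrightarrow> \<sigma> (x i) = y i"
    using partial_injection_extends[of "{1..M}" x y] by auto
  define P where "P = x ` {1..M} \<union> y ` {1..M}"
  have fin: "finite P" by (simp add: P_def)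
  obtain i1 i2 :: 'n where i12: "i1 \<noteq> i2"
    using assms(1) by (metis card_2_iff' ex_card top_greatest)
  obtain r \<kappa> \<phi> where "circle_config i1 i2 T (card P) P \<sigma> r \<kappa> \<phi>"
    using permutation_circle_config[OF perm[folded P_def] fin i12 assms(2)] by blast
  then interpret circle_config i1 i2 T "card P" P \<sigma> r \<kappa> \<phi> .
  have "\<sigma> p \<in> P" if "p \<in> P" for p
    using permutes_in_image[OF perm] that by (simp add: P_def)
  \<comment> \<open>The points index themselves: robustness is carried by shears from their places
    on the circles back to their true positions.\<close>
  then have "robust T P \<sigma> (\<lambda>p. p)"
    using robust_circle robust_iff[OF fin inj_on_centre _ assms(1), of "\<lambda>p. p"] by simp
  then obtain V where "V \<in> shallow_relu_fields" "\<And>p. p \<in> P \<Longrightarrow> flow V T p = \<sigma> p"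
    using robust_imp_shallow_relu[OF fin assms(2)] by blast
  then show "\<exists>V\<in>shallow_relu_fields. \<forall>i\<in>{1..M}. flow V T (x i) = y i"
    using xy by (intro bexI[of _ V]) (auto simp: P_def)
qed

text \<open>Centres at distance \<open>3 * \<delta>\<close> leave a gap between the closed balls.
  The targets are the same centres in exchanged order, \<open>3 - i\<close> being the transposition
  of 1 and 2.\<close>

lemma swap_data:
  assumes "\<delta> > 0"
  obtains x :: "nat \<Rightarrow> real^'n" where "disjoint_family_on (\<lambda>i. cball (x i) \<delta>) {1..2}"
    "cball (x 1) \<delta> \<inter> cball (x 2) \<delta> = {}" "inj_on (\<lambda>i. x (3 - i)) {1..2}"
proof
  fix k :: 'n
  define x :: "nat \<Rightarrow> real^'n" where "x i = axis k (if i = 1 then 0 else 3 * \<delta>)" for i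
  have dist: "dist (x 1) (x 2) = 3 * \<delta>"
  proof -
    have "x 1 - x 2 = (- 3 * \<delta>) *\<^sub>R axis k 1" by (simp add: x_def vec_eq_iff axis_def)
    then show ?thesis using assms by (simp add: dist_norm)
  qed
  show disj: "cball (x 1) \<delta> \<inter> cball (x 2) \<delta> = {}"
  proof (intro equals0I)
    fix z assume "z \<in> cball (x 1) \<delta> \<inter> cball (x 2) \<delta>"
    then show False using dist_triangle2[of "x 1" "x 2" z] dist assms by auto
  qed
  have "i = 1 \<or> i = 2" if "i \<in> {1..2}" for i :: nat using that by auto
  then show "disjoint_family_on (\<lambda>i. cball (x i) \<delta>) {1..2}"
    using disj unfolding disjoint_family_on_def by (metis Int_commute)
  have ne: "x 1 \<noteq> x 2" using dist assms by auto
  show "inj_on (\<lambda>i. x (3 - i)) {1..2}"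
  proof (rule inj_onI)
    fix i j :: nat assume "i \<in> {1..2}" "j \<in> {1..2}" "x (3 - i) = x (3 - j)"
    moreover from this have "i = 1 \<or> i = 2" "j = 1 \<or> j = 2" by auto
    ultimately show "i = j" using ne by auto
  qed
qed

lemma shallow_relu_not_property_Ppos:
  assumes "T > 0" "\<delta> > 0"
  shows "\<not> property_Ppos (shallow_relu_fields :: (real^'n \<Rightarrow> real^'n) set) T \<delta>"
proof
  assume P: "property_Ppos (shallow_relu_fields :: (real^'n \<Rightarrow> real^'n) set) T \<delta>"
  obtain x :: "nat \<Rightarrow> real^'n" where x: "disjoint_family_on (\<lambda>i. cball (x i) \<delta>) {1..2}"
    "cball (x 1) \<delta> \<inter> cball (x 2) \<delta> = {}" "inj_on (\<lambda>i. x (3 - i)) {1..2}"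
    using swap_data[OF assms(2)] by blast
  have \<epsilon>: "0 < \<delta> / 2" "\<delta> / 2 < \<delta>" using assms(2) by auto
  obtain V where V: "V \<in> shallow_relu_fields"
    and all: "\<forall>i\<in>{1..2}. flow V T ` cball (x i) \<delta> \<subseteq> ball (x (3 - i)) (\<delta> / 2)"
    using P[unfolded property_Ppos_def, rule_format, of x 2 "\<lambda>i. x (3 - i)" "\<delta> / 2"] x(1,3) \<epsilon> by blast
  have sw: "flow V T ` cball (x 1) \<delta> \<subseteq> ball (x 2) (\<delta> / 2)"
      "flow V T ` cball (x 2) \<delta> \<subseteq> ball (x 1) (\<delta> / 2)"
    using bspec[OF all, of 1] bspec[OF all, of 2] by simp_all
  obtain L where L: "L-lipschitz_on UNIV V" using shallow_relu_lipschitz[OF V] by blast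
  show False
  proof (rule semiflow_no_swap[where \<Psi> = "flow V", OF _ _ _ _ assms(1) \<epsilon> x(2) sw])
    show "continuous_on UNIV (flow V t)" if "t \<ge> 0" for t
      by (rule lipschitz_on_continuous_on[OF flow_lipschitz[OF L that]])
  qed (auto intro: flow_continuous_time[OF L] flow_0[OF L] flow_add[OF L])
qed

lemma continuous_semiflows_not_SCC:
  fixes S :: "(real \<Rightarrow> real^'n \<Rightarrow> real^'n) set"
  assumes "\<forall>\<Psi>\<in>S. continuous_semiflow \<Psi>"
  shows "\<not> SCC S"
proof
  assume P: "SCC S"
  obtain x :: "nat \<Rightarrow> real^'n" where x: "disjoint_family_on (\<lambda>i. cball (x i) 1) {1..2}"
    "cball (x 1) 1 \<inter> cball (x 2) 1 = {}" "inj_on (\<lambda>i. x (3 - i)) {1..2}"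
    using swap_data[OF zero_less_one] by blast
  \<comment> \<open>Closed unit balls serve as the compact convex sets, so the radii are 1 and
    \<open>1 / 2\<close>; the terminal time, which \<open>SCC\<close> leaves free, is fixed only
    afterwards and enters the swap argument as an arbitrary positive number.\<close>
  have \<epsilon>: "0 < 1 / (2 :: real)" "1 / 2 < (1 :: real)" by auto
  obtain \<Psi> \<tau> where \<Psi>: "\<Psi> \<in> S" and \<tau>: "\<tau> > 0"
    and all: "\<forall>i\<in>{1..2}. \<Psi> \<tau> ` cball (x i) 1 \<subseteq> ball (x (3 - i)) (1 / 2)"
    using P[unfolded SCC_def, rule_format, of 2 "\<lambda>i. cball (x i) 1" "\<lambda>i. x (3 - i)" "1 / 2"] x(1,3)
    by (auto simp: convex_cball)
  have sw: "\<Psi> \<tau> ` cball (x 1) 1 \<subseteq> ball (x 2) (1 / 2)"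
      "\<Psi> \<tau> ` cball (x 2) 1 \<subseteq> ball (x 1) (1 / 2)"
    using bspec[OF all, of 1] bspec[OF all, of 2] by simp_all
  have cont: "continuous_on ({0..} \<times> UNIV) (\<lambda>(t, x). \<Psi> t x)" and zero: "\<Psi> 0 = id"
    and add: "\<And>t s. t \<ge> 0 \<Longrightarrow> s \<ge> 0 \<Longrightarrow> \<Psi> (t + s) = \<Psi> t \<circ> \<Psi> s"
    using assms \<Psi> unfolding continuous_semiflow_def by blast+
  show False
  proof (rule semiflow_no_swap[where \<Psi> = \<Psi>, OF _ _ _ _ \<tau> \<epsilon> x(2) sw])
    show "continuous_on {0..} (\<lambda>t. \<Psi> t z)" for z
    proof -
      have "continuous_on {0..} (\<lambda>t. case (t, z) of (t, x) \<Rightarrow> \<Psi> t x)"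
        by (rule continuous_on_compose2[OF cont]) (auto intro!: continuous_intros)
      then show ?thesis by simp
    qed
    show "continuous_on UNIV (\<Psi> t)" if "t \<ge> 0" for t
    proof -
      have "continuous_on UNIV (\<lambda>z. case (t, z) of (t, x) \<Rightarrow> \<Psi> t x)"
        by (rule continuous_on_compose2[OF cont]) (use that in \<open>auto intro!: continuous_intros\<close>)
      then show ?thesis by simp
    qed
  qed (simp_all add: zero add)
qed

theorem corollary2p8:
  fixes T \<delta> :: real
  assumes "CARD('n::finite) \<ge> 2" and "T > 0" and "\<delta> \<ge> 0"
  shows "(property_P (shallow_relu_fields :: (real^'n \<Rightarrow> real^'n) set) T \<delta> \<longleftrightarrow> \<delta> = 0) \<and>
         (\<forall>S :: (real \<Rightarrow> real^'n \<Rightarrow> real^'n) set.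
            (\<forall>\<Psi>\<in>S. continuous_semiflow \<Psi>) \<longrightarrow> \<not> SCC S)"
proof (intro conjI allI impI)
  show "property_P (shallow_relu_fields :: (real^'n \<Rightarrow> real^'n) set) T \<delta> \<longleftrightarrow> \<delta> = 0"
  proof (cases "\<delta> = 0")
    case True
    then show ?thesis using shallow_relu_property_P0[OF assms(1,2)] by (simp add: property_P_def)
  next
    case False
    then show ?thesis
      using shallow_relu_not_property_Ppos[OF assms(2), where \<delta> = \<delta>] assms(3)
      by (simp add: property_P_def)
  qed
qed (rule continuous_semiflows_not_SCC)

end
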